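(* Let $G$ be a $2$-connected graph and let $L$ be a longest cycle of $G$. Let $B_1, B_2, \ldots, B_k$ ($k\ge 1$) be $L$-bridges of $G$ that are pairwise vertex-disjoint and such that the subgraph of the overlap graph $O_G(L)$ induced by $\{B_1,\dots,B_k\}$ is a tree. Then $$\sum_{i=1}^{k} \lambda(B_i) \leq \lfloor |E(L)|/2 \rfloor.$$
   Context: For a subgraph $H$ of a graph $G$, an $H$-bridge of $G$ is either (i) an edge in $E(G)\setminus E(H)$ with both endpoints in $V(H)$, or (ii) a subgraph consisting of a component $D$ of $G-V(H)$ together with all edges between $V(D)$ and $V(H)$. The attachments of an $H$-bridge $B$ are the vertices in $V(H)\cap V(B)$. For a cycle $L$, two $L$-bridges $B_1,B_2$ overlap if $L$ cannot be partitioned into two subpaths $L_1,L_2$ such that the attachments of $B_i$ lie entirely on $L_i$ for $i=1,2$. The overlap graph $O_G(L)$ has the $L$-bridges as vertices, two being adjacent iff they overlap. The length $\lambda(B)$ of an $H$-bridge $B$ is the maximum number of edges of a tree contained in $B$ whose leaves are exactly the attachments of $B$. *)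

theory Defs
  imports Main
begin

datatype 'a ugraph = Graph (verts: "'a set") (edges: "'a set set")

definition simple_graph :: "'a ugraph \<Rightarrow> bool" where
  "simple_graph G \<longleftrightarrow>
     finite (verts G) \<and> (\<forall>e\<in>edges G. e \<subseteq> verts G \<and> card e = 2)"

definition subgraph :: "'a ugraph \<Rightarrow> 'a ugraph \<Rightarrow> bool" where
  "subgraph H G \<longleftrightarrow>
     simple_graph H \<and> verts H \<subseteq> verts G \<and> edges H \<subseteq> edges G"

definition induced_subgraph :: "'a ugraph \<Rightarrow> 'a set \<Rightarrow> 'a ugraph" where
  "induced_subgraph G X = Graph (verts G \<inter> X) {e \<in> edges G. e \<subseteq> X}"

definition delete_verts :: "'a ugraph \<Rightarrow> 'a set \<Rightarrow> 'a ugraph" where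
  "delete_verts G X = induced_subgraph G (verts G - X)"

(* The null graph does not count as connected. *)
definition connected_graph :: "'a ugraph \<Rightarrow> bool" where
  "connected_graph G \<longleftrightarrow>
     verts G \<noteq> {} \<and>
     (\<forall>u\<in>verts G. \<forall>v\<in>verts G. (u, v) \<in> {(x, y). {x, y} \<in> edges G}\<^sup>*)"

definition component :: "'a ugraph \<Rightarrow> 'a ugraph \<Rightarrow> bool" where
  "component G D \<longleftrightarrow>
     subgraph D G \<and> connected_graph D \<and>
     (\<forall>D'. subgraph D' G \<and> connected_graph D' \<and> subgraph D D' \<longrightarrow> D' = D)"

definition two_connected :: "'a ugraph \<Rightarrow> bool" where
  "two_connected G \<longleftrightarrow>
     simple_graph G \<and> card (verts G) \<ge> 3 \<and> connected_graph G \<and>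
     (\<forall>v\<in>verts G. connected_graph (delete_verts G {v}))"

(* Single vertices count as paths. *)
definition is_path :: "'a ugraph \<Rightarrow> bool" where
  "is_path P \<longleftrightarrow> (\<exists>vs. vs \<noteq> [] \<and> distinct vs \<and>
     P = Graph (set vs) {{vs ! i, vs ! Suc i} | i. Suc i < length vs})"

definition is_cycle :: "'a ugraph \<Rightarrow> bool" where
  "is_cycle C \<longleftrightarrow> (\<exists>vs. length vs \<ge> 3 \<and> distinct vs \<and>
     C = Graph (set vs) {{vs ! i, vs ! (Suc i mod length vs)} | i. i < length vs})"

definition longest_cycle :: "'a ugraph \<Rightarrow> 'a ugraph \<Rightarrow> bool" where
  "longest_cycle G L \<longleftrightarrow>
     is_cycle L \<and> subgraph L G \<and>
     (\<forall>C. is_cycle C \<and> subgraph C G \<longrightarrow> card (edges C) \<le> card (edges L))"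

definition is_tree :: "'a ugraph \<Rightarrow> bool" where
  "is_tree T \<longleftrightarrow>
     simple_graph T \<and> connected_graph T \<and> (\<nexists>C. is_cycle C \<and> subgraph C T)"

definition degree :: "'a ugraph \<Rightarrow> 'a \<Rightarrow> nat" where
  "degree G v = card {e \<in> edges G. v \<in> e}"

definition leaves :: "'a ugraph \<Rightarrow> 'a set" where
  "leaves T = {v \<in> verts T. degree T v = 1}"

definition is_bridge :: "'a ugraph \<Rightarrow> 'a ugraph \<Rightarrow> 'a ugraph \<Rightarrow> bool" where
  "is_bridge G H B \<longleftrightarrow>
     (\<exists>e. e \<in> edges G - edges H \<and> e \<subseteq> verts H \<and> B = Graph e {e}) \<or>
     (\<exists>D. component (delete_verts G (verts H)) D \<and>
        B = Graph
              (verts D \<union> {v \<in> verts H. \<exists>u\<in>verts D. {u, v} \<in> edges G})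
              (edges D \<union> {{u, v} | u v. u \<in> verts D \<and> v \<in> verts H \<and> {u, v} \<in> edges G}))"

definition attachments :: "'a ugraph \<Rightarrow> 'a ugraph \<Rightarrow> 'a set" where
  "attachments H B = verts H \<inter> verts B"

(* Here L is split by its edges, so the two subpaths share exactly their two end
   vertices.  For vertex-disjoint bridges with at least two attachments each, splitting
   the vertices of L instead gives the same relation. *)
definition overlap :: "'a ugraph \<Rightarrow> 'a ugraph \<Rightarrow> 'a ugraph \<Rightarrow> bool" where
  "overlap L B1 B2 \<longleftrightarrow>
     \<not> (\<exists>L1 L2. is_path L1 \<and> is_path L2 \<and>
          verts L1 \<union> verts L2 = verts L \<and>
          edges L1 \<union> edges L2 = edges L \<and> edges L1 \<inter> edges L2 = {} \<and>
          attachments L B1 \<subseteq> verts L1 \<and> attachments L B2 \<subseteq> verts L2)"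

definition overlap_graph :: "'a ugraph \<Rightarrow> 'a ugraph \<Rightarrow> 'a ugraph ugraph" where
  "overlap_graph G L =
     Graph {B. is_bridge G L B}
       {{B1, B2} | B1 B2. is_bridge G L B1 \<and> is_bridge G L B2 \<and> B1 \<noteq> B2 \<and> overlap L B1 B2}"

(* If B has at least two attachments, as every bridge of a cycle in a 2-connected graph
   does, such a tree exists and the maximum is over a finite nonempty set. *)
definition bridge_length :: "'a ugraph \<Rightarrow> 'a ugraph \<Rightarrow> nat" where
  "bridge_length H B =
     Max {card (edges T) | T. is_tree T \<and> subgraph T B \<and> leaves T = attachments H B}"

end

theory Submission
  imports Defs "HOL-Library.Multiset"
begin

text \<open>
  Choose in every bridge a longest tree whose leaves are the attachments. An \<^emph>\<open>exchange\<close>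
  replaces arcs of \<open>L\<close> between consecutive attachments by tree paths, at most one in each bridge,
  so that a single cycle results; as \<open>L\<close> is longest, the arcs removed are at least as long as the
  paths added. It remains to combine these inequalities, which is done for abstract rings of
  coloured points (a colour for each bridge) by induction on the number of points.

  \<^item> If two consecutive points have the same colour, one of them, \<open>q\<close>, is deleted; the arc that
    arises is shortened by twice the length that the tree loses with its leaf \<open>q\<close>.
  \<^item> Otherwise some leaf \<open>B\<close> of the overlap tree, with neighbour \<open>A\<close>, lies on a segment
    \<open>b1 a1 b2 a2 \<dots> bm\<close> of the ring with all \<open>ai\<close> of colour \<open>A\<close>: take a leaf on a shortest
    segment. Replacing the segment by \<open>a1 a2 \<dots>\<close> and by \<open>\<dots> a2 a1\<close> gives two rings without \<open>B\<close>
    whose average length is that of the old ring minus the closed walk \<open>b1 b2 \<dots> bm b1\<close> in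
    the tree of \<open>B\<close>, and this walk uses every edge of that tree at least twice.
\<close>

section \<open>Cyclic lists\<close>

text \<open>Two paths in one tree may meet, while trees of different bridges never do; this is why
  an exchange may use only one path per bridge. The restriction shapes the induction: each
  inequality of a smaller ring must come from an exchange of the larger ring that again has at most
  one chord of each colour. When a leaf colour \<open>B\<close> is eliminated, the lifted exchange
  can afford one chord of colour \<open>B\<close>, because no point of colour \<open>B\<close> is
  left outside the segment. The smaller rings need not come from a graph, so the induction runs over
  integer arc lengths, with the exchange inequalities as its hypothesis. The goal compares twice the
  sum of the tree sizes with the length of the ring, so every lost tree edge has to be paid for with
  two units of length. Two rings are needed for a leaf colour because either order of the points of
  \<open>A\<close> uses only part of the closed walk; both together use each of its steps twice.
  Acyclicity of the overlap graph supplies leaves. Connectedness supplies the neighbour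
  \<open>A\<close>, and it shows that a colour crossing no other one is alone.\<close>

definition ipairs :: "'a list \<Rightarrow> ('a \<times> 'a) list" where
  "ipairs xs = zip xs (tl xs)"

text \<open>The closing pair is included: one point yields the loop \<open>(x, x)\<close>, two
  points yield their pair in both orders. Lists with fewer than three elements are thus degenerate
  as cycles, whence the many bounds \<open>length ws \<ge> 3\<close>.\<close>

definition cpairs :: "'a list \<Rightarrow> ('a \<times> 'a) list" where
  "cpairs xs = zip xs (rotate1 xs)"

lemma ipairs_simps [simp]:
  "ipairs [] = []" "ipairs [x] = []" "ipairs (x # y # zs) = (x, y) # ipairs (y # zs)"
  by (simp_all add: ipairs_def)

lemma ipairs_append:
  "xs \<noteq> [] \<Longrightarrow> ys \<noteq> [] \<Longrightarrow> ipairs (xs @ ys) = ipairs xs @ (last xs, hd ys) # ipairs ys"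
proof (induction xs rule: induct_list012)
  case (2 x) then show ?case by (cases ys) auto
qed auto

lemma ipairs_Cons: "ys \<noteq> [] \<Longrightarrow> ipairs (x # ys) = (x, hd ys) # ipairs ys"
  by (cases ys) auto

lemma zip_shift: "zip (x # xs) (xs @ [y]) = ipairs (x # xs) @ [(last (x # xs), y)]"
  by (induction xs arbitrary: x) auto

lemma cpairs_conv_ipairs: "xs \<noteq> [] \<Longrightarrow> cpairs xs = ipairs xs @ [(last xs, hd xs)]"
  by (cases xs) (auto simp: cpairs_def zip_shift simp del: zip_Cons_Cons)

lemma cpairs_Nil [simp]: "cpairs [] = []"
  by (simp add: cpairs_def)

lemma cpairs_append:
  "xs \<noteq> [] \<Longrightarrow> ys \<noteq> [] \<Longrightarrow>
   cpairs (xs @ ys) = ipairs xs @ (last xs, hd ys) # ipairs ys @ [(last ys, hd xs)]"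
  by (simp add: cpairs_conv_ipairs ipairs_append)

lemma length_cpairs [simp]: "length (cpairs xs) = length xs"
  by (simp add: cpairs_def)

lemma map_fst_cpairs [simp]: "map fst (cpairs xs) = xs"
  by (simp add: cpairs_def)

lemma mset_cpairs_rotate1: "mset (cpairs (rotate1 xs)) = mset (cpairs xs)"
proof (cases xs)
  case (Cons x ys)
  show ?thesis
  proof (cases "ys = []")
    case False
    then show ?thesis using Cons cpairs_append[of ys "[x]"] cpairs_append[of "[x]" ys]
      by simp
  qed (simp add: Cons)
qed simp

lemma ipairs_rev: "ipairs (rev xs) = rev (map prod.swap (ipairs xs))"
proof (induction xs rule: induct_list012)
  case (3 x y zs)
  have "ipairs (rev (y # zs) @ [x]) = ipairs (rev (y # zs)) @ [(y, x)]"
    by (subst ipairs_append) (auto simp: last_rev)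
  then show ?case using 3 by simp
qed auto

lemma mset_cpairs_rev: "mset (cpairs (rev xs)) = image_mset prod.swap (mset (cpairs xs))"
  by (cases "xs = []") (auto simp: cpairs_conv_ipairs ipairs_rev last_rev hd_rev)

lemma set_ipairs_rev: "(p, q) \<in> set (ipairs (rev xs)) \<longleftrightarrow> (q, p) \<in> set (ipairs xs)"
  by (force simp: ipairs_rev)

lemma set_cpairs_rotate1 [simp]: "set (cpairs (rotate1 xs)) = set (cpairs xs)"
  using mset_cpairs_rotate1 by (metis set_mset_mset)

lemma set_cpairs_rev: "(p, q) \<in> set (cpairs (rev xs)) \<longleftrightarrow> (q, p) \<in> set (cpairs xs)"
proof -
  have "set (cpairs (rev xs)) = prod.swap ` set (cpairs xs)"
    using mset_cpairs_rev[of xs] by (metis set_image_mset set_mset_mset)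
  then show ?thesis by force
qed

lemma ipairs_in_set: "(p, q) \<in> set (ipairs xs) \<Longrightarrow> p \<in> set (butlast xs) \<and> q \<in> set (tl xs)"
  by (induction xs rule: induct_list012) (auto split: if_splits)

lemma cpairs_in_set: "(p, q) \<in> set (cpairs xs) \<Longrightarrow> p \<in> set xs \<and> q \<in> set xs"
  by (auto simp: cpairs_def dest: set_zip_leftD set_zip_rightD)

text \<open>The orbit of a list under rotations and reflections, that is, all ways to write down one
  cyclic order up to orientation. In this form invariance only has to be checked for the two
  generators.\<close>

inductive requiv :: "'a list \<Rightarrow> 'a list \<Rightarrow> bool" where
  requiv_refl [intro, simp]: "requiv xs xs"
| requiv_rotate1: "requiv xs ys \<Longrightarrow> requiv xs (rotate1 ys)"
| requiv_rev: "requiv xs ys \<Longrightarrow> requiv xs (rev ys)"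

lemma requiv_swap: "requiv xs (ys @ zs) \<Longrightarrow> requiv xs (zs @ ys)"
proof -
  assume a: "requiv xs (ys @ zs)"
  have "requiv xs (rotate n (ys @ zs))" for n
    by (induction n) (auto simp: a intro: requiv_rotate1)
  then show ?thesis by (metis rotate_append)
qed

lemma requiv_swap_Cons: "requiv xs (y # zs) \<Longrightarrow> requiv xs (zs @ [y])"
  using requiv_swap[of xs "[y]" zs] by simp

lemma requiv_set: "requiv xs ys \<Longrightarrow> set ys = set xs"
  by (induction rule: requiv.induct) auto

lemma requiv_distinct: "requiv xs ys \<Longrightarrow> distinct ys = distinct xs"
  by (induction rule: requiv.induct) auto

lemma requiv_length: "requiv xs ys \<Longrightarrow> length ys = length xs"
  by (induction rule: requiv.induct) auto

definition arc :: "'a list \<Rightarrow> 'a \<Rightarrow> 'a \<Rightarrow> bool" where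
  "arc ws p q \<longleftrightarrow> (p, q) \<in> set (cpairs ws)"

definition adj :: "'a list \<Rightarrow> 'a \<Rightarrow> 'a \<Rightarrow> bool" where
  "adj ws p q \<longleftrightarrow> arc ws p q \<or> arc ws q p"

lemma adj_sym: "adj ws p q \<longleftrightarrow> adj ws q p"
  by (auto simp: adj_def)

lemma arc_rotate1 [simp]: "arc (rotate1 xs) = arc xs"
  by (auto simp: arc_def fun_eq_iff)

lemma arc_swap: "arc (xs @ ys) = arc (ys @ xs)"
proof -
  have "arc (rotate n (xs @ ys)) = arc (xs @ ys)" for n
    by (induction n) auto
  then show ?thesis by (metis rotate_append)
qed

lemma adj_requiv: "requiv xs ys \<Longrightarrow> adj ys = adj xs"
  by (induction rule: requiv.induct)
     (auto simp: adj_def arc_def set_cpairs_rev fun_eq_iff)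

text \<open>Once \<open>y\<close> is rotated to the front, its successor and predecessor can be read
  off. The term \<open>hd (r @ [y])\<close> also covers the one-point list, where \<open>y\<close>
  succeeds itself.\<close>

lemma arc_Cons_iff:
  assumes "distinct (y # r)"
  shows "arc (y # r) y q \<longleftrightarrow> q = hd (r @ [y])" "arc (y # r) p y \<longleftrightarrow> p = last (y # r)"
proof -
  have *: "cpairs (y # r) = (y, hd (r @ [y])) # ipairs r @ (if r = [] then [] else [(last r, y)])"
    using cpairs_append[of "[y]" r] by (auto simp: cpairs_conv_ipairs)
  show "arc (y # r) y q \<longleftrightarrow> q = hd (r @ [y])"
    using assms unfolding arc_def *
    by (auto dest!: ipairs_in_set in_set_butlastD)
  show "arc (y # r) p y \<longleftrightarrow> p = last (y # r)"
    using assms unfolding arc_def *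
    by (cases r) (auto dest!: ipairs_in_set list.set_sel(2))
qed

lemma arc_fun: "distinct ws \<Longrightarrow> arc ws p q \<Longrightarrow> arc ws p q' \<Longrightarrow> q = q'"
proof -
  assume d: "distinct ws" and a: "arc ws p q" "arc ws p q'"
  then obtain xs ys where w: "ws = xs @ p # ys"
    by (metis arc_def cpairs_in_set split_list)
  have "arc (p # ys @ xs) = arc ws" using arc_swap[of "p # ys" xs] w by simp
  moreover have "distinct (p # ys @ xs)" using d w by auto
  ultimately show ?thesis using a arc_Cons_iff(1) by metis
qed

lemma arc_inj: "distinct ws \<Longrightarrow> arc ws p q \<Longrightarrow> arc ws p' q \<Longrightarrow> p = p'"
proof -
  assume d: "distinct ws" and a: "arc ws p q" "arc ws p' q"
  then obtain xs ys where w: "ws = xs @ q # ys"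
    by (metis arc_def cpairs_in_set split_list)
  have "arc (q # ys @ xs) = arc ws" using arc_swap[of "q # ys" xs] w by simp
  moreover have "distinct (q # ys @ xs)" using d w by auto
  ultimately show ?thesis using a arc_Cons_iff(2) by metis
qed

lemma arc_antisym:
  assumes "distinct ws" "length ws \<ge> 3" "arc ws p q" "arc ws q p" shows False
proof -
  obtain xs ys where w: "ws = xs @ p # ys"
    using assms by (metis arc_def cpairs_in_set split_list)
  define r where "r = ys @ xs"
  have "arc (p # r) = arc ws" using arc_swap[of "p # ys" xs] w by (simp add: r_def)
  moreover have d: "distinct (p # r)" using assms w by (auto simp: r_def)
  ultimately have "q = hd (r @ [p])" "q = last (p # r)"
    using assms arc_Cons_iff[OF d] by metis+
  moreover have "length r \<ge> 2" using assms w by (simp add: r_def)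
  then obtain a b r' where "r = a # b # r'" by (cases r rule: remdups_adj.cases) auto
  ultimately show False using d by (auto split: if_splits)
qed

text \<open>A distinct list of neighbouring points cannot turn back: with two points placed the
  direction is fixed, and each further point is the next one. Only the second point has a choice,
  which a reflection normalises. The lemma brings an exchange that keeps certain arcs into the form
  \<open>zs @ rest\<close>.\<close>

lemma adj_contiguous:
  assumes "distinct vs" "zs \<noteq> []" "distinct zs" "set zs \<subseteq> set vs"
    and "\<And>p q. (p, q) \<in> set (ipairs zs) \<Longrightarrow> adj vs p q"
  shows "\<exists>rest. requiv vs (zs @ rest)"
  using assms(2-)
proof (induction zs rule: rev_induct)
  case (snoc z zs)
  show ?case
  proof (cases "zs = []")
    case True
    then obtain xs ys where "vs = xs @ z # ys" using snoc.prems split_list[of z vs] by auto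
    then show ?thesis using True requiv_swap[of vs xs "z # ys"] by auto
  next
    case False
    have ip: "ipairs (zs @ [z]) = ipairs zs @ [(last zs, z)]"
      using False by (simp add: ipairs_append)
    obtain rest where r: "requiv vs (zs @ rest)"
      using snoc.IH[OF False] snoc.prems ip by auto
    define y where "y = last zs"
    obtain zs' where zs: "zs = zs' @ [y]" using False by (metis append_butlast_last_id y_def)
    have "requiv vs (y # rest @ zs')" using r requiv_swap[of vs zs' "y # rest"] zs by simp
    note r2 = this
    have a: "adj (y # rest @ zs') y z"
      using adj_requiv[OF r2] snoc.prems ip by (simp add: y_def)
    have dd: "distinct (y # rest @ zs')" using requiv_distinct[OF r2] assms by simp
    have zy: "z \<noteq> y" "z \<notin> set zs'" using snoc.prems zs by auto
    from a have "z = hd (rest @ zs' @ [y]) \<or> z = last (y # rest @ zs')"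
      unfolding adj_def arc_Cons_iff[OF dd] by simp
    then consider "rest \<noteq> []" "z = hd rest" | "zs' = []" "rest \<noteq> []" "z = last rest"
      using zy by (cases rest; cases zs'; auto split: if_splits dest: last_in_set)
    then show ?thesis
    proof cases
      case 1
      then show ?thesis using r by (metis append_Cons append_Nil append_assoc list.exhaust_sel)
    next
      case 2
      have "requiv vs (rev (y # rest))" using r2 2 requiv_rev[of vs "y # rest"] by simp
      then have "requiv vs (y # rev rest)" using requiv_swap[of vs "rev rest" "[y]"] by simp
      moreover have "rev rest = z # tl (rev rest)" using 2 by (metis hd_rev list.collapse rev_is_Nil_conv)
      ultimately show ?thesis using zs 2 by (metis append_Cons append_Nil append_assoc)
    qed
  qed
qed simp

section \<open>Weighted rings and exchanges\<close>

lemma adj_neighbours: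
  assumes "distinct ws" "length ws \<ge> 3" "x \<in> set ws"
  shows "\<exists>u v. u \<noteq> v \<and> (\<forall>z. adj ws x z \<longleftrightarrow> z = u \<or> z = v)"
proof -
  obtain xs ys where w: "ws = xs @ x # ys" using assms by (metis split_list)
  define r where "r = ys @ xs"
  have a: "arc (x # r) = arc ws" using arc_swap[of "x # ys" xs] w by (simp add: r_def)
  have d: "distinct (x # r)" using assms w by (auto simp: r_def)
  have "length r \<ge> 2" using assms w by (simp add: r_def)
  then obtain a b r' where r: "r = a # b # r'" by (cases r rule: remdups_adj.cases) auto
  have "adj ws x z \<longleftrightarrow> z = a \<or> z = last (b # r')" for z
    unfolding adj_def a[symmetric] arc_Cons_iff[OF d] using r by simp
  moreover have "a \<noteq> last (b # r')" using d r by (auto split: if_splits)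
  ultimately show ?thesis by blast
qed

lemma arc_in_set: "arc ws p q \<Longrightarrow> p \<in> set ws \<and> q \<in> set ws"
  unfolding arc_def by (rule cpairs_in_set)

lemma arc_irrefl: "distinct ws \<Longrightarrow> length ws \<ge> 2 \<Longrightarrow> arc ws p p \<Longrightarrow> False"
proof -
  assume assms: "distinct ws" "length ws \<ge> 2" "arc ws p p"
  obtain xs ys where w: "ws = xs @ p # ys" using assms by (metis arc_in_set split_list)
  define r where "r = ys @ xs"
  have a: "arc (p # r) = arc ws" using arc_swap[of "p # ys" xs] w by (simp add: r_def)
  have d: "distinct (p # r)" using assms w by (auto simp: r_def)
  have "r \<noteq> []" using assms w by (auto simp: r_def)
  then show False using arc_Cons_iff(1)[OF d, of p] assms a d by (cases r) auto
qed

lemma arc_append_iff: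
  assumes "xs \<noteq> []" "ys \<noteq> []"
  shows "arc (xs @ ys) p q \<longleftrightarrow> (p, q) \<in> set (ipairs xs) \<or> p = last xs \<and> q = hd ys
    \<or> (p, q) \<in> set (ipairs ys) \<or> p = last ys \<and> q = hd xs"
  using assms by (auto simp: arc_def cpairs_append)

lemma sum_list_map_if_eq:
  "(\<And>x. x \<in> set xs \<Longrightarrow> f x = g x) \<Longrightarrow> sum_list (map f xs) = sum_list (map g xs)"
  by (metis map_eq_conv)

section \<open>Exchanges of a weighted ring\<close>

locale weighted_colours =
  fixes c :: "'p \<Rightarrow> 'c" and lam :: "'p set \<Rightarrow> int"
  \<comment> \<open>holds if \<open>lam S\<close> is the number of edges of the subtree spanned by \<open>S\<close>\<close>
  assumes lam_delete: "\<lbrakk>finite S; card S \<ge> 3; \<And>x. x \<in> S \<Longrightarrow> c x = C; p \<in> S; q \<in> S; r \<in> S;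
      p \<noteq> q; r \<noteq> q; p \<noteq> r\<rbrakk>
    \<Longrightarrow> 2 * (lam S - lam (S - {q})) + lam {p, r} \<le> lam {p, q} + lam {q, r}"
begin

text \<open>A step between neighbours is charged as an arc, in either direction, even if both points
  have the same colour. Replacing such an arc by a tree path is covered by a separate clause of
  \<open>ring_ok\<close>.\<close>

definition wt :: "'p list \<Rightarrow> ('p \<Rightarrow> int) \<Rightarrow> 'p \<times> 'p \<Rightarrow> int" where
  "wt ws l e = (if arc ws (fst e) (snd e) then l (fst e)
     else if arc ws (snd e) (fst e) then l (snd e) else lam {fst e, snd e})"

definition total :: "'p list \<Rightarrow> ('p \<Rightarrow> int) \<Rightarrow> ('p \<times> 'p) list \<Rightarrow> int" where
  "total ws l es = sum_list (map (wt ws l) es)"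

text \<open>Reading the colour at the first end is enough, since \<open>steps_ok\<close> gives both
  ends of a chord the same colour.\<close>

definition chord_cols :: "'p list \<Rightarrow> ('p \<times> 'p) list \<Rightarrow> 'c list" where
  "chord_cols ws es = map (c \<circ> fst) (filter (\<lambda>e. \<not> adj ws (fst e) (snd e)) es)"

definition steps_ok :: "'p list \<Rightarrow> ('p \<times> 'p) list \<Rightarrow> bool" where
  "steps_ok ws es \<longleftrightarrow> (\<forall>(p, q)\<in>set es. adj ws p q \<or> c p = c q)"

text \<open>The list \<open>vs\<close> is the order in which the new cycle meets the attachments. It
  visits all of them, so an exchange is a Hamiltonian cycle on the points, made of arcs and
  chords.\<close>

definition exch :: "'p list \<Rightarrow> 'p list \<Rightarrow> bool" where
  "exch ws vs \<longleftrightarrow> distinct vs \<and> set vs = set ws \<and> steps_ok ws (cpairs vs) \<and>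
     distinct (chord_cols ws (cpairs vs))"

text \<open>The number \<open>l p\<close> is the length of the arc from \<open>p\<close> to the next point. The arcs of a
  ring with two points are parallel, so they cannot be told apart by \<^term>\<open>arc\<close>; such rings
  only have the exchanges of a single arc.\<close>
definition ring_ok :: "'p list \<Rightarrow> ('p \<Rightarrow> int) \<Rightarrow> bool" where
  "ring_ok ws l \<longleftrightarrow> distinct ws \<and>
     (\<forall>p q. arc ws p q \<longrightarrow> p \<noteq> q \<longrightarrow> c p = c q \<longrightarrow> lam {p, q} \<le> l p) \<and>
     (length ws \<ge> 3 \<longrightarrow> (\<forall>vs. exch ws vs \<longrightarrow> total ws l (cpairs vs) \<le> sum l (set ws)))"

lemma total_simps [simp]:
  "total ws l [] = 0" "total ws l (e # es) = wt ws l e + total ws l es"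
  "total ws l (es @ fs) = total ws l es + total ws l fs"
  by (simp_all add: total_def)

lemma chord_cols_simps [simp]:
  "chord_cols ws [] = []"
  "chord_cols ws (e # es) = (if adj ws (fst e) (snd e) then [] else [c (fst e)]) @ chord_cols ws es"
  "chord_cols ws (es @ fs) = chord_cols ws es @ chord_cols ws fs"
  by (simp_all add: chord_cols_def)

lemma steps_ok_simps [simp]:
  "steps_ok ws []"
  "steps_ok ws (e # es) \<longleftrightarrow> (adj ws (fst e) (snd e) \<or> c (fst e) = c (snd e)) \<and> steps_ok ws es"
  "steps_ok ws (es @ fs) \<longleftrightarrow> steps_ok ws es \<and> steps_ok ws fs"
  by (auto simp: steps_ok_def)

lemma total_cong:
  "(\<And>p q. (p, q) \<in> set es \<Longrightarrow> wt ws l (p, q) = wt ws' l' (p, q)) \<Longrightarrow> total ws l es = total ws' l' es"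
  unfolding total_def by (rule sum_list_map_if_eq) auto

lemma chord_cols_cong:
  "(\<And>p q. (p, q) \<in> set es \<Longrightarrow> adj ws p q = adj ws' p q) \<Longrightarrow> chord_cols ws es = chord_cols ws' es"
  unfolding chord_cols_def by (metis (mono_tags, lifting) filter_cong prod.collapse)

lemma steps_ok_cong:
  "(\<And>p q. (p, q) \<in> set es \<Longrightarrow> adj ws p q = adj ws' p q) \<Longrightarrow> steps_ok ws es = steps_ok ws' es"
  unfolding steps_ok_def by auto

lemma wt_arc: "arc ws p q \<Longrightarrow> wt ws l (p, q) = l p"
  by (simp add: wt_def)

lemma wt_arc_rev: "distinct ws \<Longrightarrow> length ws \<ge> 3 \<Longrightarrow> arc ws q p \<Longrightarrow> wt ws l (p, q) = l q"
  using arc_antisym by (fastforce simp: wt_def)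

lemma wt_chord: "\<not> adj ws p q \<Longrightarrow> wt ws l (p, q) = lam {p, q}"
  by (simp add: wt_def adj_def)

text \<open>In a ring of two points the two orders of the pair would denote two different
  arcs.\<close>

lemma wt_swap: "distinct ws \<Longrightarrow> length ws \<ge> 3 \<Longrightarrow> wt ws l (prod.swap e) = wt ws l e"
  using arc_antisym[of ws "fst e" "snd e"] by (auto simp: wt_def insert_commute)

lemma total_mset: "mset es = mset fs \<Longrightarrow> total ws l es = total ws l fs"
  unfolding total_def by (metis mset_map sum_mset_sum_list)

lemma chord_cols_mset: "mset (chord_cols ws es) = image_mset (c \<circ> fst)
    (filter_mset (\<lambda>e. \<not> adj ws (fst e) (snd e)) (mset es))"
  by (simp add: chord_cols_def)

lemma exch_rotate1: "exch ws vs \<Longrightarrow> exch ws (rotate1 vs)"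
proof -
  have "mset (chord_cols ws (cpairs (rotate1 vs))) = mset (chord_cols ws (cpairs vs))"
    by (simp only: chord_cols_mset mset_cpairs_rotate1)
  then have "distinct (chord_cols ws (cpairs (rotate1 vs))) = distinct (chord_cols ws (cpairs vs))"
    by (rule mset_eq_imp_distinct_iff)
  then show "exch ws vs \<Longrightarrow> exch ws (rotate1 vs)"
    by (simp add: exch_def steps_ok_def)
qed

text \<open>After reversal \<open>chord_cols\<close> reads the colour at the other end of each
  chord, where it is the same by \<open>steps_ok\<close>.\<close>

lemma exch_rev: "exch ws vs \<Longrightarrow> exch ws (rev vs)"
proof -
  assume e: "exch ws vs"
  have "mset (chord_cols ws (cpairs (rev vs))) =
    image_mset (c \<circ> fst \<circ> prod.swap) (filter_mset (\<lambda>e. \<not> adj ws (fst e) (snd e)) (mset (cpairs vs)))"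
    by (simp add: chord_cols_mset mset_cpairs_rev filter_mset_image_mset o_def adj_sym
        multiset.map_comp)
  also have "\<dots> = mset (chord_cols ws (cpairs vs))"
    unfolding chord_cols_mset using e
    by (intro image_mset_cong) (auto simp: exch_def steps_ok_def)
  finally have "distinct (chord_cols ws (cpairs (rev vs))) = distinct (chord_cols ws (cpairs vs))"
    by (rule mset_eq_imp_distinct_iff)
  moreover have "steps_ok ws (cpairs (rev vs))"
    unfolding steps_ok_def
  proof clarify
    fix a b assume ab: "(a, b) \<in> set (cpairs (rev vs))" "c a \<noteq> c b"
    then have "(b, a) \<in> set (cpairs vs)" by (simp add: set_cpairs_rev)
    then have "adj ws b a" using e ab(2) by (auto simp: exch_def steps_ok_def)
    then show "adj ws a b" by (simp only: adj_sym)
  qed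
  ultimately show ?thesis using e by (simp add: exch_def)
qed

lemma exch_requiv: "requiv vs vs' \<Longrightarrow> exch ws vs \<Longrightarrow> exch ws vs'"
  by (induction rule: requiv.induct) (auto intro: exch_rotate1 exch_rev)

lemma total_requiv:
  assumes "distinct ws" "length ws \<ge> 3"
  shows "requiv vs vs' \<Longrightarrow> total ws l (cpairs vs') = total ws l (cpairs vs)"
proof (induction rule: requiv.induct)
  case (requiv_rotate1 xs ys)
  then show ?case using total_mset[OF mset_cpairs_rotate1] by metis
next
  case (requiv_rev xs ys)
  have "total ws l (cpairs (rev ys)) = sum_mset (image_mset (wt ws l) (mset (cpairs (rev ys))))"
    by (simp add: total_def sum_mset_sum_list flip: mset_map)
  also have "\<dots> = sum_mset (image_mset (wt ws l) (mset (cpairs ys)))"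
    by (simp add: mset_cpairs_rev multiset.map_comp o_def wt_swap[OF assms])
  also have "\<dots> = total ws l (cpairs ys)"
    by (simp add: total_def sum_mset_sum_list flip: mset_map)
  finally show ?case using requiv_rev by simp
qed simp

lemma sum_list_butlast_last: "xs \<noteq> [] \<Longrightarrow> sum_list (map f xs) = sum_list (map f (butlast xs)) + (f (last xs) :: int)"
  by (induction xs) auto

lemma sum_set_butlast_last:
  "distinct xs \<Longrightarrow> xs \<noteq> [] \<Longrightarrow> sum f (set xs) = sum f (set (butlast xs)) + (f (last xs) :: int)"
  using sum_list_butlast_last[of xs f] by (simp add: sum_list_distinct_conv_sum_set distinct_butlast)

definition arcs_on :: "'p list \<Rightarrow> 'p list \<Rightarrow> bool" where
  "arcs_on ws xs \<longleftrightarrow> (\<forall>(s, t)\<in>set (ipairs xs). arc ws s t)"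

lemma total_arcs_on: "arcs_on ws xs \<Longrightarrow> total ws l (ipairs xs) = sum_list (map l (butlast xs))"
  unfolding arcs_on_def by (induction xs rule: induct_list012) (auto simp: wt_arc)

lemma chord_cols_arcs_on: "arcs_on ws xs \<Longrightarrow> chord_cols ws (ipairs xs) = []"
  by (auto simp: chord_cols_def filter_empty_conv adj_def arcs_on_def)

lemma steps_ok_arcs_on: "arcs_on ws xs \<Longrightarrow> steps_ok ws (ipairs xs)"
  by (auto simp: steps_ok_def adj_def arcs_on_def)

lemma chord_cols_rev_arcs_on: "arcs_on ws xs \<Longrightarrow> chord_cols ws (ipairs (rev xs)) = []"
  by (auto simp: chord_cols_def filter_empty_conv adj_def arcs_on_def set_ipairs_rev)

lemma steps_ok_rev_arcs_on: "arcs_on ws xs \<Longrightarrow> steps_ok ws (ipairs (rev xs))"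
  by (auto simp: steps_ok_def adj_def arcs_on_def set_ipairs_rev)

lemma total_rev_arcs_on:
  assumes "arcs_on ws xs" "distinct ws" "length ws \<ge> 3"
  shows "total ws l (ipairs (rev xs)) = sum_list (map l (butlast xs))"
proof -
  have "total ws l (rev es) = total ws l es" for es by (rule total_mset) simp
  then have "total ws l (ipairs (rev xs)) = total ws l (map prod.swap (ipairs xs))"
    by (simp add: ipairs_rev)
  also have "\<dots> = total ws l (ipairs xs)"
    by (simp add: total_def o_def wt_swap[OF assms(2,3)])
  finally show ?thesis using total_arcs_on[OF assms(1)] by simp
qed

text \<open>The inequalities see the ring only through its points and arcs, so the list may be
  rotated freely.\<close>

lemma ring_ok_arc_cong: "arc ws = arc ws' \<Longrightarrow> set ws = set ws' \<Longrightarrow> length ws = length ws' \<Longrightarrow>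
    distinct ws = distinct ws' \<Longrightarrow> ring_ok ws l = ring_ok ws' l"
proof -
  assume a: "arc ws = arc ws'" "set ws = set ws'" "length ws = length ws'" "distinct ws = distinct ws'"
  have "adj ws = adj ws'" "wt ws l = wt ws' l"
    using a by (auto simp: adj_def wt_def fun_eq_iff)
  then show ?thesis using a
    unfolding ring_ok_def exch_def steps_ok_def chord_cols_def total_def by simp
qed

lemma chord_unique:
  assumes "exch ws vs" "(s, t) \<in> set (cpairs vs)" "\<not> adj ws s t"
    "(s', t') \<in> set (cpairs vs)" "\<not> adj ws s' t'" "c s = c s'"
  shows "s = s' \<and> t = t'"
proof -
  have "inj_on (c \<circ> fst) (set (filter (\<lambda>e. \<not> adj ws (fst e) (snd e)) (cpairs vs)))"
    using assms(1) by (simp add: exch_def chord_cols_def distinct_map)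
  from inj_onD[OF this, of "(s, t)" "(s', t')"] assms show ?thesis by auto
qed

text \<open>Every point has exactly two neighbours in the ring and two in the exchange. If a ring
  neighbour of \<open>x\<close> is lost, some neighbour in the exchange is new, and the step to it
  is a chord.\<close>

lemma chord_at:
  assumes "distinct ws" "length ws \<ge> 3" "exch ws vs" "adj ws x y" "\<not> adj vs x y"
  shows "\<exists>s t. (s, t) \<in> set (cpairs vs) \<and> \<not> adj ws s t \<and> (x = s \<or> x = t) \<and> c s = c x"
proof -
  have vs: "distinct vs" "set vs = set ws" "length vs \<ge> 3"
    using assms(1-3) distinct_card unfolding exch_def by metis+
  have x: "x \<in> set ws" using assms(4) by (auto simp: adj_def dest: arc_in_set)
  obtain u v where u: "u \<noteq> v" "\<And>z. adj ws x z \<longleftrightarrow> z = u \<or> z = v"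
    using adj_neighbours[OF assms(1,2) x] by blast
  obtain u' v' where u': "u' \<noteq> v'" "\<And>z. adj vs x z \<longleftrightarrow> z = u' \<or> z = v'"
    using adj_neighbours[of vs x] vs x by auto
  obtain z where z: "adj vs x z" "\<not> adj ws x z"
    using u u' assms(4,5) by metis
  then consider "(x, z) \<in> set (cpairs vs)" | "(z, x) \<in> set (cpairs vs)"
    by (auto simp: adj_def arc_def)
  then show ?thesis
  proof cases
    case 1 then show ?thesis using z by blast
  next
    case 2
    moreover have "c z = c x" using assms(3) z 2 by (auto simp: exch_def steps_ok_def adj_sym)
    ultimately show ?thesis using z by (metis adj_sym)
  qed
qed

text \<open>Let \<open>w\<close> follow \<open>q\<close>. An exchange of the smaller ring that keeps
  the arc from \<open>p\<close> to \<open>w\<close> lifts by putting \<open>q\<close> back on that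
  arc. Otherwise some chord joins \<open>p\<close> to a point \<open>r\<close>; it is rerouted as
  the chord \<open>r q\<close> followed by the arc between \<open>q\<close> and \<open>p\<close>, so
  no colour gains a chord. \<open>lam_delete\<close> pays for the detour and for twice the lost tree
  length.\<close>

lemma ring_ok_delete:
  assumes ok: "ring_ok (p # q # outs) l" and cpq: "c p = c q" and outs: "outs \<noteq> []"
    and S: "S = {x \<in> set (p # q # outs). c x = c p}" "card S \<ge> 3"
  shows "ring_ok (p # outs) (l(p := l p + l q - 2 * (lam S - lam (S - {q}))))"
proof -
  define l' where "l' = l(p := l p + l q - 2 * (lam S - lam (S - {q})))"
  define w where "w = hd outs"
  let ?ws = "p # q # outs" and ?ws' = "p # outs"
  have d: "distinct ?ws" and H1: "\<And>p' q'. arc ?ws p' q' \<Longrightarrow> p' \<noteq> q' \<Longrightarrow> c p' = c q' \<Longrightarrow> lam {p', q'} \<le> l p'"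
    and H2: "\<And>vs. exch ?ws vs \<Longrightarrow> total ?ws l (cpairs vs) \<le> sum l (set ?ws)"
    using ok outs by (auto simp: ring_ok_def neq_Nil_conv)
  have d': "distinct ?ws'" using d by simp
  have wouts: "w \<in> set outs" and louts: "last outs \<in> set outs" using outs by (auto simp: w_def)
  have arc_ws: "arc ?ws s t \<longleftrightarrow> s = p \<and> t = q \<or> s = q \<and> t = w \<or> (s, t) \<in> set (ipairs outs)
      \<or> s = last outs \<and> t = p" for s t
    using arc_append_iff[of "[p, q]" outs s t] outs by (auto simp: w_def)
  have arc_ws': "arc ?ws' s t \<longleftrightarrow> s = p \<and> t = w \<or> (s, t) \<in> set (ipairs outs)
      \<or> s = last outs \<and> t = p" for s t
    using arc_append_iff[of "[p]" outs s t] outs by (auto simp: w_def)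
  have ipo: "(s, t) \<in> set (ipairs outs) \<Longrightarrow> s \<in> set outs \<and> t \<in> set outs" for s t
    using ipairs_in_set[of s t outs] by (auto dest: in_set_butlastD list.set_sel(2)[OF outs])
  have adj_eq: "adj ?ws s t = adj ?ws' s t" if "s \<noteq> q" "t \<noteq> q" "{s, t} \<noteq> {p, w}" for s t
    using that by (auto simp: adj_def arc_ws arc_ws')
  have wt_eq: "wt ?ws l (s, t) = wt ?ws' l' (s, t)" if "s \<noteq> q" "t \<noteq> q" "{s, t} \<noteq> {p, w}" for s t
  proof -
    have "arc ?ws s t = arc ?ws' s t" "arc ?ws t s = arc ?ws' t s"
      using that by (auto simp: arc_ws arc_ws')
    moreover have "arc ?ws' s t \<Longrightarrow> l' s = l s" "arc ?ws' t s \<Longrightarrow> l' t = l t"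
      using that d ipo louts by (auto simp: arc_ws' l'_def)
    ultimately show ?thesis by (auto simp: wt_def)
  qed
  \<comment> \<open>The cost of rerouting the chord \<open>p r\<close> through \<open>q\<close>.
    Here \<open>l p\<close> may replace \<open>lam {p, q}\<close> by the chord clause of
    \<open>ring_ok\<close> for the arc from \<open>p\<close> to \<open>q\<close>.\<close>
  have tri: "2 * (lam S - lam (S - {q})) + lam {p, r} \<le> l p + lam {q, r}"
    if "r \<in> set outs" "c r = c p" for r
  proof -
    have "2 * (lam S - lam (S - {q})) + lam {p, r} \<le> lam {p, q} + lam {q, r}"
      by (rule lam_delete[where C = "c p"]) (use S that d cpq in auto)
    moreover have "lam {p, q} \<le> l p" using H1[of p q] d cpq arc_ws by auto
    ultimately show ?thesis by linarith
  qed
  have sum_eq: "sum l' (set ?ws') = sum l (set ?ws) - 2 * (lam S - lam (S - {q}))"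
  proof -
    have "sum l' (set outs) = sum l (set outs)"
      using d by (intro sum.cong) (auto simp: l'_def)
    then show ?thesis using d by (simp add: l'_def)
  qed
  have "ring_ok ?ws' l'"
    unfolding ring_ok_def
  proof (intro conjI allI impI)
    show "distinct ?ws'" by (rule d')
  next
    fix s t assume a: "arc ?ws' s t" "s \<noteq> t" "c s = c t"
    show "lam {s, t} \<le> l' s"
    proof (cases "s = p")
      case True
      then have t: "t = w" using a d ipo louts by (auto simp: arc_ws')
      have "lam {q, w} \<le> l q" using H1[of q w] a True t arc_ws cpq wouts d by auto
      then show ?thesis using tri[of w] wouts a True t by (simp add: l'_def)
    next
      case False
      then have "arc ?ws s t" using a by (auto simp: arc_ws arc_ws')
      then show ?thesis using H1 a False by (simp add: l'_def)
    qed
  next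
    fix vs' assume n3: "length ?ws' \<ge> 3" and ex: "exch ?ws' vs'"
    have vs': "distinct vs'" "set vs' = set ?ws'" "length vs' \<ge> 3"
      using ex n3 d' distinct_card unfolding exch_def by metis+
    show "total ?ws' l' (cpairs vs') \<le> sum l' (set ?ws')"
    proof (cases "adj vs' p w")
      case True
      obtain rest where r: "requiv vs' ([p, w] @ rest)"
        using adj_contiguous[of vs' "[p, w]"] True vs' wouts d by auto
      \<comment> \<open>All steps other than the one from \<open>p\<close> to \<open>w\<close>. They
        avoid \<open>q\<close> and the pair \<open>p\<close>, \<open>w\<close>, so they have the
        same weights in both rings.\<close>
      define X where "X = (if rest = [] then [] else ipairs (w # rest)) @ [(last (w # rest), p)]"
      have dr: "distinct (p # w # rest)" and sr: "set (p # w # rest) = set ?ws'"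
        and lr: "rest \<noteq> []"
        using requiv_distinct[OF r] requiv_set[OF r] requiv_length[OF r] vs' by auto
      have c1: "cpairs ([p, w] @ rest) = (p, w) # X"
        using lr cpairs_append[of "[p]" "w # rest"] by (simp add: X_def)
      have c2: "cpairs (p # q # w # rest) = (p, q) # (q, w) # X"
        using lr cpairs_append[of "[p, q]" "w # rest"] by (simp add: X_def)
      have qn: "q \<notin> set ?ws'" using d by auto
      have X: "s \<noteq> q \<and> t \<noteq> q \<and> {s, t} \<noteq> {p, w}" if "(s, t) \<in> set X" for s t
      proof -
        have "(s, t) \<in> set (ipairs (w # rest)) \<or> s = last rest \<and> t = p"
          using that lr by (auto simp: X_def)
        then have "s \<in> set (w # rest) \<and> t \<in> set (w # rest) \<or> s \<in> set rest \<and> t = p"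
          using ipairs_in_set[of s t "w # rest"] lr by (auto dest: in_set_butlastD)
        then show ?thesis using dr sr qn by (auto simp: doubleton_eq_iff)
      qed
      have ex2: "exch ?ws' ([p, w] @ rest)" by (rule exch_requiv[OF r ex])
      have pw: "adj ?ws' p w" "adj ?ws p q" "adj ?ws q w" by (auto simp: adj_def arc_ws' arc_ws)
      have "exch ?ws (p # q # w # rest)"
        unfolding exch_def
      proof (intro conjI)
        show "distinct (p # q # w # rest)" using dr sr qn by auto
        show "set (p # q # w # rest) = set ?ws" using sr by auto
        show "steps_ok ?ws (cpairs (p # q # w # rest))"
          using ex2 steps_ok_cong[of X ?ws ?ws'] adj_eq X pw unfolding exch_def c1 c2 by auto
        have "chord_cols ?ws X = chord_cols ?ws' X"
          by (rule chord_cols_cong) (use adj_eq X in blast)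
        then show "distinct (chord_cols ?ws (cpairs (p # q # w # rest)))"
          using ex2 pw unfolding exch_def c1 c2 by auto
      qed
      from H2[OF this] have "wt ?ws l (p, q) + (wt ?ws l (q, w) + total ?ws l X) \<le> sum l (set ?ws)"
        unfolding c2 by simp
      moreover have "wt ?ws l (p, q) = l p" "wt ?ws l (q, w) = l q" "wt ?ws' l' (p, w) = l' p"
        by (auto intro!: wt_arc simp: arc_ws arc_ws')
      moreover have "total ?ws l X = total ?ws' l' X"
        by (rule total_cong) (use wt_eq X in blast)
      moreover have "total ?ws' l' (cpairs vs') = wt ?ws' l' (p, w) + total ?ws' l' X"
        using total_requiv[OF d' n3 r] unfolding c1 by simp
      ultimately show ?thesis using sum_eq by (simp add: l'_def)
    next
      case False
      obtain rest where r: "requiv vs' ([p] @ rest)"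
        using adj_contiguous[of vs' "[p]"] vs' by auto
      have apw: "adj ?ws' p w" by (auto simp: adj_def arc_ws')
      obtain s t where st: "(s, t) \<in> set (cpairs vs')" "\<not> adj ?ws' s t" "p = s \<or> p = t" "c s = c p"
        using chord_at[OF d' n3 ex apw False] by blast
      \<comment> \<open>The chord may be traversed in either direction; \<open>r\<close> is its end
        other than \<open>p\<close>. The exchange is then turned so that the step from
        \<open>r\<close> to \<open>p\<close> closes it.\<close>
      define r where "r = (if s = p then t else s)"
      have "adj vs' r p" "\<not> adj ?ws' r p" "c r = c p" "r \<in> set vs'"
        using st ex cpairs_in_set[OF st(1)]
        by (auto simp: r_def adj_def arc_def exch_def steps_ok_def)
      note r = this
      have rp: "r \<noteq> p" "r \<noteq> w"
        using r False arc_irrefl[of vs' p] vs' by (auto simp: adj_def)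
      obtain rest where "requiv vs' ([r, p] @ rest)"
        using adj_contiguous[of vs' "[r, p]"] r vs' rp by auto
      then have rq: "requiv vs' (p # rest @ [r])"
        using requiv_swap_Cons[of vs' r "p # rest"] by simp
      define Y where "Y = ipairs (p # rest @ [r])"
      have c1: "cpairs (p # rest @ [r]) = Y @ [(r, p)]"
        by (simp add: cpairs_conv_ipairs Y_def)
      have c2: "cpairs ((p # rest @ [r]) @ [q]) = Y @ [(r, q), (q, p)]"
        by (subst cpairs_append) (auto simp: Y_def)
      have dr: "distinct (p # rest @ [r])" and sr: "set (p # rest @ [r]) = set ?ws'"
        using requiv_distinct[OF rq] requiv_set[OF rq] vs' by auto
      have qn: "q \<notin> set ?ws'" using d by auto
      have nadj: "\<not> adj (p # rest @ [r]) p w" using False adj_requiv[OF rq] by simp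
      have Y: "s \<noteq> q \<and> t \<noteq> q \<and> {s, t} \<noteq> {p, w}" if "(s, t) \<in> set Y" for s t
      proof -
        have st: "(s, t) \<in> set (cpairs (p # rest @ [r]))" using that c1 by simp
        then have "{s, t} \<noteq> {p, w}" using nadj by (auto simp: adj_def arc_def doubleton_eq_iff)
        then show ?thesis using cpairs_in_set[OF st] sr qn by metis
      qed
      have ex2: "exch ?ws' (p # rest @ [r])" by (rule exch_requiv[OF rq ex])
      have ro: "r \<in> set outs" using r vs' rp by auto
      have nrq: "\<not> adj ?ws r q" using d ro rp ipo by (auto simp: adj_def arc_ws)
      have aqp: "adj ?ws q p" by (simp add: adj_def arc_ws)
      have n3': "length ?ws \<ge> 3" using n3 by simp
      have "exch ?ws ((p # rest @ [r]) @ [q])"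
        unfolding exch_def
      proof (intro conjI)
        show "distinct ((p # rest @ [r]) @ [q])" using dr sr qn by auto
        show "set ((p # rest @ [r]) @ [q]) = set ?ws" using sr by auto
        show "steps_ok ?ws (cpairs ((p # rest @ [r]) @ [q]))"
          using ex2 steps_ok_cong[of Y ?ws ?ws'] adj_eq Y aqp r cpq unfolding exch_def c1 c2 by auto
        have "chord_cols ?ws Y = chord_cols ?ws' Y"
          by (rule chord_cols_cong) (use adj_eq Y in blast)
        then show "distinct (chord_cols ?ws (cpairs ((p # rest @ [r]) @ [q])))"
          using ex2 aqp nrq r unfolding exch_def c1 c2 by auto
      qed
      from H2[OF this] have "total ?ws l Y + (wt ?ws l (r, q) + wt ?ws l (q, p)) \<le> sum l (set ?ws)"
        unfolding c2 by simp
      moreover have "wt ?ws l (r, q) = lam {q, r}" "wt ?ws l (q, p) = l p" "wt ?ws' l' (r, p) = lam {p, r}"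
        using wt_chord[OF nrq, of l] wt_arc_rev[OF d n3', of p q] wt_chord[OF r(2), of l'] arc_ws
        by (auto simp: insert_commute)
      moreover have "total ?ws l Y = total ?ws' l' Y"
        by (rule total_cong) (use wt_eq Y in blast)
      moreover have "total ?ws' l' (cpairs vs') = total ?ws' l' Y + wt ?ws' l' (r, p)"
        using total_requiv[OF d' n3 rq] unfolding c1 by simp
      ultimately show ?thesis using sum_eq tri[OF ro r(3)] by linarith
    qed
  qed
  then show ?thesis by (simp add: l'_def)
qed

end

section \<open>Replacing a segment of the ring by its points of one colour\<close>

context weighted_colours
begin

text \<open>An exchange of the new ring keeps \<open>as\<close> in one piece, because two chords of colour \<open>A\<close> are
  not allowed. It is turned into one of the old ring by putting \<open>seg\<close> in place of \<open>as\<close> if it uses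
  the arcs at both ends of \<open>as\<close>, and \<open>s1\<close> or \<open>s2\<close> if it avoids the first or the last one.\<close>
lemma ring_ok_replace_segment:
  fixes seg outs as s1 s2 l l'
  defines "ws \<equiv> seg @ outs" and "ws' \<equiv> as @ outs"
  assumes ok: "ring_ok ws l" and n3: "length ws \<ge> 3"
    and proper: "\<And>p q. arc ws p q \<Longrightarrow> c p \<noteq> c q"
    and ne: "seg \<noteq> []" "outs \<noteq> []" "as \<noteq> []"
    and das: "distinct as" "set as \<subseteq> set seg"
    and colA: "\<And>x. x \<in> set as \<Longrightarrow> c x = A" and AB: "A \<noteq> B"
    and colB: "\<And>x. x \<in> set outs \<Longrightarrow> c x \<noteq> B"
    and l': "\<And>x. x \<in> set (butlast outs) \<Longrightarrow> l' x = l x"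
    and s1: "distinct s1" "set s1 = set seg" "hd s1 = hd as" "last s1 = last seg"
      "steps_ok ws (ipairs s1)" "chord_cols ws (ipairs s1) = [B]"
      "total ws l (ipairs s1) + l (last seg) + l' (last outs) = l (last outs) + sum l (set seg)"
    and s2: "distinct s2" "set s2 = set seg" "hd s2 = hd seg" "last s2 = last as"
      "steps_ok ws (ipairs s2)" "chord_cols ws (ipairs s2) = [B]"
      "total ws l (ipairs s2) + l' (last as) = sum l (set seg)"
    and inner: "\<And>p q. (p, q) \<in> set (ipairs as) \<Longrightarrow> lam {p, q} \<le> l' p"
  shows "ring_ok ws' l'"
proof -
  define x where "x = last outs"
  define w where "w = hd outs"
  have d: "distinct ws"
    and H2: "\<And>vs. exch ws vs \<Longrightarrow> total ws l (cpairs vs) \<le> sum l (set ws)"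
    using ok n3 by (auto simp: ring_ok_def)
  have disj: "set seg \<inter> set outs = {}" "distinct seg" "distinct outs" using d by (auto simp: ws_def)
  have d': "distinct ws'" using d das by (auto simp: ws'_def ws_def)
  have xo: "x \<in> set outs" using ne by (auto simp: x_def)
  have arc_ws: "arc ws s t \<longleftrightarrow> (s, t) \<in> set (ipairs seg) \<or> s = last seg \<and> t = w
      \<or> (s, t) \<in> set (ipairs outs) \<or> s = x \<and> t = hd seg" for s t
    unfolding ws_def x_def w_def using ne by (simp add: arc_append_iff)
  have arc_ws': "arc ws' s t \<longleftrightarrow> (s, t) \<in> set (ipairs as) \<or> s = last as \<and> t = w
      \<or> (s, t) \<in> set (ipairs outs) \<or> s = x \<and> t = hd as" for s t
    unfolding ws'_def x_def w_def using ne by (simp add: arc_append_iff)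
  have ip: "s \<in> set xs \<and> t \<in> set xs" if "(s, t) \<in> set (ipairs xs)" for s t and xs :: "'p list"
    using ipairs_in_set[OF that] list.set_sel(2)[of xs t] in_set_butlastD[of s xs] by (cases "xs = []") auto
  have lasts: "last seg \<in> set seg" "hd seg \<in> set seg" "last as \<in> set as" "hd as \<in> set as"
    using ne by auto
  have arc_out: "arc ws s t \<longleftrightarrow> (s, t) \<in> set (ipairs outs)"
     "arc ws' s t \<longleftrightarrow> (s, t) \<in> set (ipairs outs)" if "s \<in> set outs" "t \<in> set outs" for s t
    using that disj ip[of s t seg] ip[of s t as] lasts das by (auto simp: arc_ws arc_ws')
  have adj_out: "adj ws s t = adj ws' s t" if "s \<in> set outs" "t \<in> set outs" for s t
    using that arc_out by (simp add: adj_def)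
  have butx: "s \<in> set (butlast outs)" if "(s, t) \<in> set (ipairs outs)" for s t
    using ipairs_in_set[OF that] by simp
  have wt_out: "wt ws l (s, t) = wt ws' l' (s, t)" if "s \<in> set outs" "t \<in> set outs" for s t
    using that arc_out[of s t] arc_out[of t s] l' butx by (auto simp: wt_def)
  have sum_outs: "sum f (set outs) = sum f (set (butlast outs)) + f x" for f :: "'p \<Rightarrow> int"
    unfolding x_def using disj(3) ne(2) by (rule sum_set_butlast_last)
  define bo where "bo = sum l (set (butlast outs))"
  have bo': "sum l' (set (butlast outs)) = bo" using l' by (simp add: bo_def)
  have T: "sum l (set ws) = sum l (set seg) + bo + l x"
    using disj by (simp add: ws_def sum.union_disjoint sum_outs bo_def)
  have T': "sum l' (set ws') = sum l' (set as) + bo + l' x"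
    using disj das by (subst ws'_def, subst set_append, subst sum.union_disjoint)
      (auto simp: sum_outs bo')
  have nadj: "\<not> adj ws s t" if "c s = c t" for s t
    using that proper[of s t] proper[of t s] by (auto simp: adj_def)
  have "arcs_on ws outs" by (auto simp: arcs_on_def arc_ws)
  then have ipo: "total ws l (ipairs outs) = bo"
    using disj by (simp add: total_arcs_on bo_def sum_list_distinct_conv_sum_set distinct_butlast)
  have ipo_adj: "chord_cols ws (ipairs outs) = []" "steps_ok ws (ipairs outs)"
    by (auto simp: chord_cols_def steps_ok_def filter_empty_conv adj_def arc_ws)
  \<comment> \<open>All exchanges of the old ring used below have this shape: an order
    \<open>s\<close> of the segment followed by an order \<open>rest\<close> of the outside
    points.\<close>
  have lift: "exch ws (s @ rest) \<and> total ws l (cpairs (s @ rest)) =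
      total ws l (ipairs s) + wt ws l (last s, hd rest) + total ws l (ipairs rest)
      + wt ws l (last rest, hd s)"
    if "distinct s" "set s = set seg" "distinct rest" "set rest = set outs"
      "steps_ok ws (ipairs s)" "steps_ok ws (ipairs rest)"
      "adj ws (last s) (hd rest) \<or> c (last s) = c (hd rest)"
      "adj ws (last rest) (hd s) \<or> c (last rest) = c (hd s)"
      "distinct (chord_cols ws (ipairs s) @ chord_cols ws [(last s, hd rest)]
         @ chord_cols ws (ipairs rest) @ chord_cols ws [(last rest, hd s)])"
    for s rest
  proof -
    have "s \<noteq> []" "rest \<noteq> []" using that ne by auto
    then show ?thesis unfolding exch_def using that disj
      by (simp add: cpairs_append ws_def split: if_splits)
  qed
  have "ring_ok ws' l'"
    unfolding ring_ok_def
  proof (intro conjI allI impI)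
    show "distinct ws'" by (rule d')
  next
    fix s t assume a: "arc ws' s t" "s \<noteq> t" "c s = c t"
    consider "(s, t) \<in> set (ipairs as)" | "s = last as" "t = w"
      | "(s, t) \<in> set (ipairs outs)" | "s = x" "t = hd as"
      using a(1) arc_ws' by blast
    then show "lam {s, t} \<le> l' s"
    proof cases
      case 1 then show ?thesis by (rule inner)
    next
      case 2
      \<comment> \<open>A new arc with both ends of colour \<open>A\<close> is a chord of the old
        ring. Inserting it after \<open>s2\<close>, with all outer arcs kept, gives the required
        bound on its tree distance.\<close>
      have ca: "c (last s2) = c w" "c w = A" using a 2 s2 colA lasts by auto
      have adj2: "adj ws x (hd s2)" using s2 by (simp add: adj_def arc_ws)
      have "exch ws (s2 @ outs) \<and> total ws l (cpairs (s2 @ outs)) =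
        total ws l (ipairs s2) + wt ws l (last s2, hd outs) + total ws l (ipairs outs)
          + wt ws l (last outs, hd s2)"
        by (rule lift) (use s2 disj ca adj2 nadj ipo_adj AB in \<open>auto simp: w_def x_def\<close>)
      then have "total ws l (ipairs s2) + wt ws l (last s2, w) + bo + wt ws l (x, hd s2)
          \<le> sum l (set ws)"
        using H2 ipo by (metis w_def x_def)
      moreover have "wt ws l (last s2, w) = lam {s, t}"
        using wt_chord nadj[OF ca(1)] s2 2 by simp
      moreover have "wt ws l (x, hd s2) = l x" using s2 by (simp add: wt_arc arc_ws)
      ultimately show ?thesis using T s2 2 by simp
    next
      case 3
      then have "arc ws s t" by (simp add: arc_ws)
      then show ?thesis using proper a by blast
    next
      case 4
      have ca: "c x = c (hd s1)" "c x = A" using a 4 s1 colA lasts by auto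
      have adj2: "adj ws (last s1) w" using s1 by (simp add: adj_def arc_ws)
      have "exch ws (s1 @ outs) \<and> total ws l (cpairs (s1 @ outs)) =
        total ws l (ipairs s1) + wt ws l (last s1, hd outs) + total ws l (ipairs outs)
          + wt ws l (last outs, hd s1)"
        by (rule lift) (use s1 disj ca adj2 nadj ipo_adj AB in \<open>auto simp: w_def x_def\<close>)
      then have "total ws l (ipairs s1) + wt ws l (last s1, w) + bo + wt ws l (x, hd s1)
          \<le> sum l (set ws)"
        using H2 ipo by (metis w_def x_def)
      moreover have "wt ws l (x, hd s1) = lam {s, t}"
        using wt_chord nadj[OF ca(1)] s1 4 by simp
      moreover have "wt ws l (last s1, w) = l (last seg)" using s1 by (simp add: wt_arc arc_ws)
      ultimately show ?thesis using T s1 4 x_def by simp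
    qed
  next
    fix vs' assume n3': "length ws' \<ge> 3" and ex: "exch ws' vs'"
    have vs': "distinct vs'" "set vs' = set ws'" "length vs' \<ge> 3"
      using ex n3' d' distinct_card unfolding exch_def by metis+
    \<comment> \<open>If the exchange dropped the arc between \<open>p\<close> and \<open>q\<close>,
      there would be a chord at each of them. Both chords have colour \<open>A\<close>, so they
      coincide and join \<open>p\<close> to \<open>q\<close> after all.\<close>
    have cont: "adj vs' p q" if pq: "(p, q) \<in> set (ipairs as)" for p q
    proof (rule ccontr)
      assume na: "\<not> adj vs' p q"
      have a: "adj ws' p q" using pq by (simp add: adj_def arc_ws')
      have cc: "c p = A" "c q = A" using colA ip[OF pq] by auto
      obtain s t where st: "(s, t) \<in> set (cpairs vs')" "\<not> adj ws' s t" "p = s \<or> p = t" "c s = A"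
        using chord_at[OF d' n3' ex a na] cc by metis
      obtain s' t' where st': "(s', t') \<in> set (cpairs vs')" "\<not> adj ws' s' t'" "q = s' \<or> q = t'" "c s' = A"
        using chord_at[OF d' n3' ex, of q p] a na cc adj_sym by metis
      have "s = s' \<and> t = t'" using chord_unique[OF ex st(1,2) st'(1,2)] st st' by simp
      moreover have "p \<noteq> q" using pq a na st st' arc_irrefl[OF d', of p] n3' by (auto simp: arc_ws')
      ultimately show False using st st' na by (auto simp: adj_def arc_def)
    qed
    obtain rest where r: "requiv vs' (as @ rest)"
      using adj_contiguous[of vs' as] vs' ne das cont by (auto simp: ws'_def)
    have restp: "distinct (as @ rest) \<and> set rest = set outs \<and> length (as @ rest) \<ge> 3"
      if "requiv vs' (as @ rest)" for rest
    proof -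
      have "distinct (as @ rest)" "set (as @ rest) = set ws'" "length (as @ rest) \<ge> 3"
        using requiv_distinct[OF that] requiv_set[OF that] requiv_length[OF that] vs' by auto
      then show ?thesis using disj das by (auto simp: ws'_def)
    qed
    \<comment> \<open>The two joints cannot both be chords, as both would have colour
      \<open>A\<close>. A joint that is no chord is the expected end arc, unless \<open>as\<close>
      is a single point: then both its neighbours lie outside, and \<open>rest\<close> may have to
      be reversed.\<close>
    have key: "\<exists>rest. requiv vs' (as @ rest) \<and>
       (last rest = x \<and> hd rest = w \<or> \<not> adj ws' (last rest) (hd as) \<and> hd rest = w
        \<or> last rest = x \<and> \<not> adj ws' (last as) (hd rest))"
    proof -
      have rp: "distinct (as @ rest)" "set rest = set outs" "length (as @ rest) \<ge> 3"
        using restp[OF r] by auto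
      have rne: "rest \<noteq> []" using rp(2) ne(2) by (metis set_empty)
      have in_o: "last rest \<in> set outs" "hd rest \<in> set outs" using rne unfolding rp(2)[symmetric] by auto
      have nas: "last rest \<notin> set as" "hd rest \<notin> set as" using in_o disj das by auto
      have c1: "cpairs (as @ rest) = ipairs as @ (last as, hd rest) # ipairs rest @ [(last rest, hd as)]"
        using ne rne by (simp add: cpairs_append)
      have ex': "exch ws' (as @ rest)" by (rule exch_requiv[OF r ex])
      have not_both: "adj ws' (last as) (hd rest) \<or> adj ws' (last rest) (hd as)"
      proof (rule ccontr)
        assume n: "\<not> ?thesis"
        then have "c (last rest) = c (hd as)" using ex' unfolding exch_def c1 by auto
        then have "c (last as) = c (last rest)" using colA lasts by simp
        then have "last as = last rest"
          using chord_unique[OF ex', of "last as" "hd rest" "last rest" "hd as"] n c1 by auto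
        then show False using nas lasts by auto
      qed
      have e1: "last rest = x \<or> (length as = 1 \<and> last rest = w)" if "adj ws' (last rest) (hd as)"
      proof -
        have "(hd as, last rest) \<notin> set (ipairs as)" "(last rest, hd as) \<notin> set (ipairs as)"
          "(last rest, hd as) \<notin> set (ipairs outs)" "(hd as, last rest) \<notin> set (ipairs outs)"
          using nas disj das lasts ip by blast+
        moreover have "length as = 1" if "hd as = last as"
          using das that ne by (cases as) (auto split: if_splits)
        moreover have "last rest \<noteq> last as" "hd as \<noteq> x" using nas lasts xo disj das by auto
        ultimately show ?thesis using that by (auto simp: adj_def arc_ws')
      qed
      have e2: "hd rest = w \<or> (length as = 1 \<and> hd rest = x)" if "adj ws' (last as) (hd rest)"
      proof -
        have "(last as, hd rest) \<notin> set (ipairs as)" "(hd rest, last as) \<notin> set (ipairs as)"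
          "(last as, hd rest) \<notin> set (ipairs outs)" "(hd rest, last as) \<notin> set (ipairs outs)"
          using nas disj das lasts ip by blast+
        moreover have "length as = 1" if "hd as = last as"
          using das that ne by (cases as) (auto split: if_splits)
        moreover have "hd rest \<noteq> hd as" "last as \<noteq> x" using nas lasts xo disj das by auto
        ultimately show ?thesis using that by (auto simp: adj_def arc_ws')
      qed
      show ?thesis
      proof (cases "length as = 1")
        case False
        then show ?thesis using r e1 e2 not_both by blast
      next
        case True
        then obtain a where as: "as = [a]" by (cases as) auto
        have len2: "length rest \<ge> 2" using rp as by simp
        then have hl: "hd rest \<noteq> last rest" using rp(1)
          by (cases rest rule: remdups_adj.cases) (auto split: if_splits)
        have rv: "requiv vs' (as @ rev rest)"
          using requiv_swap[of vs' "rev rest" "[a]"] requiv_rev[OF r] as by simp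
        show ?thesis
          using r rv e1 e2 not_both hl as rne
          by (metis adj_sym hd_rev last_rev last_ConsL list.sel(1))
      qed
    qed
    then obtain rest where r: "requiv vs' (as @ rest)" and
      cs: "last rest = x \<and> hd rest = w \<or> \<not> adj ws' (last rest) (hd as) \<and> hd rest = w
        \<or> last rest = x \<and> \<not> adj ws' (last as) (hd rest)" by blast
    have rp: "distinct (as @ rest)" "set rest = set outs" using restp[OF r] by auto
    have rne: "rest \<noteq> []" using rp(2) ne(2) by (metis set_empty)
    have in_o: "last rest \<in> set outs" "hd rest \<in> set outs" using rne unfolding rp(2)[symmetric] by auto
    have c1: "cpairs (as @ rest) = ipairs as @ (last as, hd rest) # ipairs rest @ [(last rest, hd as)]"
      using ne rne by (simp add: cpairs_append)
    have ex': "exch ws' (as @ rest)" by (rule exch_requiv[OF r ex])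
    have asadj: "chord_cols ws' (ipairs as) = []"
      by (auto simp: chord_cols_def filter_empty_conv adj_def arc_ws')
    have "arcs_on ws' as" by (auto simp: arcs_on_def arc_ws')
    then have totas: "total ws' l' (ipairs as) = sum l' (set (butlast as))"
      using das by (simp add: total_arcs_on sum_list_distinct_conv_sum_set distinct_butlast)
    have sumas: "sum l' (set as) = sum l' (set (butlast as)) + l' (last as)"
      using das(1) ne(3) by (rule sum_set_butlast_last)
    have R1: "total ws l (ipairs rest) = total ws' l' (ipairs rest)"
      by (rule total_cong) (use wt_out ip rp in blast)
    have R2: "chord_cols ws (ipairs rest) = chord_cols ws' (ipairs rest)"
      by (rule chord_cols_cong) (use adj_out ip rp in blast)
    have R3: "steps_ok ws (ipairs rest) = steps_ok ws' (ipairs rest)"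
      by (rule steps_ok_cong) (use adj_out ip rp in blast)
    \<comment> \<open>No point outside the segment has colour \<open>B\<close>, so the chord inside
      \<open>s1\<close> or \<open>s2\<close> is the only one of that colour.\<close>
    have noB: "B \<notin> set (chord_cols ws' (ipairs rest))"
      using colB ip rp(2) by (fastforce simp: chord_cols_def)
    have tot': "total ws' l' (cpairs vs') = sum l' (set (butlast as)) + wt ws' l' (last as, hd rest)
       + total ws l (ipairs rest) + wt ws' l' (last rest, hd as)"
      using total_requiv[OF d' n3' r, of l'] unfolding c1 by (simp add: totas R1)
    have exs: "steps_ok ws' (ipairs rest)"
      "adj ws' (last as) (hd rest) \<or> c (last as) = c (hd rest)"
      "adj ws' (last rest) (hd as) \<or> c (last rest) = c (hd as)"
      "distinct (chord_cols ws' [(last as, hd rest)] @ chord_cols ws' (ipairs rest)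
         @ chord_cols ws' [(last rest, hd as)])"
      using ex' unfolding exch_def c1 by (simp_all add: asadj)
    from cs consider "last rest = x" "hd rest = w"
      | "\<not> adj ws' (last rest) (hd as)" "hd rest = w" "last rest \<noteq> x"
      | "last rest = x" "\<not> adj ws' (last as) (hd rest)" by blast
    then show "total ws' l' (cpairs vs') \<le> sum l' (set ws')"
    proof cases
      case 1
      have a1: "arc ws (last seg) (hd rest)" "arc ws (last rest) (hd seg)"
        "arc ws' (last as) (hd rest)" "arc ws' (last rest) (hd as)"
        using 1 by (auto simp: arc_ws arc_ws')
      have segc: "chord_cols ws (ipairs seg) = []" "steps_ok ws (ipairs seg)"
        by (auto simp: chord_cols_def steps_ok_def filter_empty_conv adj_def arc_ws)
      have "arcs_on ws seg" by (auto simp: arcs_on_def arc_ws)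
      then have totseg: "total ws l (ipairs seg) = sum l (set (butlast seg))"
        using disj by (simp add: total_arcs_on sum_list_distinct_conv_sum_set distinct_butlast)
      have sumseg: "sum l (set seg) = sum l (set (butlast seg)) + l (last seg)"
        using disj(2) ne(1) by (rule sum_set_butlast_last)
      have "exch ws (seg @ rest) \<and> total ws l (cpairs (seg @ rest)) =
        total ws l (ipairs seg) + wt ws l (last seg, hd rest) + total ws l (ipairs rest)
        + wt ws l (last rest, hd seg)"
        by (rule lift) (use rp disj a1 segc R2 R3 exs in \<open>auto simp: adj_def\<close>)
      then show ?thesis
        using H2[of "seg @ rest"] T T' tot' a1 totseg sumseg sumas 1
        by (simp add: wt_arc)
    next
      case 2
      have ca: "c (last rest) = A" using exs(3) 2 colA lasts by auto
      have e2: "arc ws (last s1) (hd rest)" "arc ws' (last as) (hd rest)"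
        using 2 s1 by (auto simp: arc_ws arc_ws')
      have n1: "\<not> adj ws (last rest) (hd s1)" using nadj ca s1 colA lasts by auto
      have "exch ws (s1 @ rest) \<and> total ws l (cpairs (s1 @ rest)) =
        total ws l (ipairs s1) + wt ws l (last s1, hd rest) + total ws l (ipairs rest)
        + wt ws l (last rest, hd s1)"
        by (rule lift) (use rp disj e2 s1 R2 R3 exs noB n1 ca AB 2 colA lasts in
          \<open>auto simp: adj_def split: if_splits\<close>)
      moreover have "wt ws l (last rest, hd s1) = lam {last rest, hd as}"
        "wt ws' l' (last rest, hd as) = lam {last rest, hd as}"
        using wt_chord[OF n1] wt_chord[OF 2(1)] s1 by auto
      ultimately show ?thesis
        using H2[of "s1 @ rest"] T T' tot' e2 sumas s1 by (simp add: wt_arc x_def)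
    next
      case 3
      have ca: "c (hd rest) = A" using exs(2) 3 colA lasts by auto
      have e1: "arc ws (last rest) (hd s2)" "arc ws' (last rest) (hd as)"
        using 3 s2 by (auto simp: arc_ws arc_ws')
      have n1: "\<not> adj ws (last s2) (hd rest)" using nadj ca s2 colA lasts by auto
      have "exch ws (s2 @ rest) \<and> total ws l (cpairs (s2 @ rest)) =
        total ws l (ipairs s2) + wt ws l (last s2, hd rest) + total ws l (ipairs rest)
        + wt ws l (last rest, hd s2)"
        by (rule lift) (use rp disj e1 s2 R2 R3 exs noB n1 ca AB 3 colA lasts in
          \<open>auto simp: adj_def split: if_splits\<close>)
      moreover have "wt ws l (last s2, hd rest) = lam {last as, hd rest}"
        "wt ws' l' (last as, hd rest) = lam {last as, hd rest}"
        using wt_chord[OF n1] wt_chord[OF 3(2)] s2 by auto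
      ultimately show ?thesis
        using H2[of "s2 @ rest"] T T' tot' e1 sumas s2 3(1) by (simp add: wt_arc)
    qed
  qed
  then show ?thesis .
qed

end

section \<open>Alternating segments and the elimination of a leaf colour\<close>

fun weave :: "'a \<Rightarrow> ('a \<times> 'a) list \<Rightarrow> 'a list" where
  "weave b [] = [b]"
| "weave b ((a, b') # ps) = b # a # weave b' ps"

lemma weave_neq_Nil [simp]: "weave b ps \<noteq> []"
  by (cases "(b, ps)" rule: weave.cases) auto

lemma weave_append: "weave b (ps @ (a, b') # qs) = weave b ps @ a # weave b' qs"
  by (induction b ps rule: weave.induct) auto

lemma hd_weave [simp]: "hd (weave b ps) = b"
  by (cases "(b, ps)" rule: weave.cases) auto

lemma last_weave [simp]: "last (weave b ps) = last (b # map snd ps)"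
  by (induction b ps rule: weave.induct) auto

lemma mset_weave: "mset (weave b ps) = add_mset b (mset (map fst ps) + mset (map snd ps))"
  by (induction b ps rule: weave.induct) auto

lemma set_weave: "set (weave b ps) = insert b (fst ` set ps \<union> snd ` set ps)"
  by (induction b ps rule: weave.induct) auto

text \<open>Serves to define the new arc lengths by their index along the segment, with
  \<open>h\<close> giving the values elsewhere.\<close>

lemma prescribed_values:
  assumes "distinct as"
  shows "\<exists>g. (\<forall>i<length as. g (as ! i) = f i) \<and> (\<forall>p. p \<notin> set as \<longrightarrow> g p = h p)"
proof -
  define g where "g = (\<lambda>p. if p \<in> set as then f (THE i. i < length as \<and> as ! i = p) else h p)"
  have "(THE j. j < length as \<and> as ! j = as ! i) = i" if "i < length as" for i
    using assms that by (intro the_equality) (auto simp: nth_eq_iff_index_eq)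
  then have "\<forall>i<length as. g (as ! i) = f i" by (simp add: g_def)
  moreover have "\<forall>p. p \<notin> set as \<longrightarrow> g p = h p" by (simp add: g_def)
  ultimately show ?thesis by blast
qed

lemma ipairs_nth:
  "(p, q) \<in> set (ipairs xs) \<longleftrightarrow> (\<exists>i. Suc i < length xs \<and> p = xs ! i \<and> q = xs ! Suc i)"
proof (induction xs rule: induct_list012)
  case (3 x y zs)
  show ?case
  proof
    assume "(p, q) \<in> set (ipairs (x # y # zs))"
    then consider "p = x" "q = y" | "(p, q) \<in> set (ipairs (y # zs))" by auto
    then show "\<exists>i. Suc i < length (x # y # zs) \<and> p = (x # y # zs) ! i \<and> q = (x # y # zs) ! Suc i"
    proof cases
      case 2
      then obtain i where "Suc i < length (y # zs)" "p = (y # zs) ! i" "q = (y # zs) ! Suc i"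
        using 3 by blast
      then show ?thesis by (intro exI[of _ "Suc i"]) auto
    qed auto
  next
    assume "\<exists>i. Suc i < length (x # y # zs) \<and> p = (x # y # zs) ! i \<and> q = (x # y # zs) ! Suc i"
    then obtain i where i: "Suc i < length (x # y # zs)" "p = (x # y # zs) ! i"
      "q = (x # y # zs) ! Suc i" by blast
    show "(p, q) \<in> set (ipairs (x # y # zs))"
    proof (cases i)
      case 0 then show ?thesis using i by simp
    next
      case (Suc j)
      then have "(p, q) \<in> set (ipairs (y # zs))" using i 3 by auto
      then show ?thesis by simp
    qed
  qed
qed auto

lemma sum_list_map_nth: "sum_list (map f xs) = (\<Sum>i<length xs. f (xs ! i))"
  by (simp add: sum_list_sum_nth atLeast0LessThan)

context weighted_colours
begin

definition cyc_len :: "'p list \<Rightarrow> int" where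
  "cyc_len xs = sum_list (map (\<lambda>(p, q). lam {p, q}) (cpairs xs))"

text \<open>Taking the first point \<open>q\<close> out of the closed walk shortens it by
  \<open>lam {z, q} + lam {q, p} - lam {z, p}\<close>, where \<open>z\<close> and \<open>p\<close>
  are its neighbours on the walk. By \<open>lam_delete\<close> this is at least twice the loss of
  tree length. A walk on two points goes to and fro.\<close>

lemma cyc_len_lower:
  assumes "distinct xs" "length xs \<ge> 2" "\<And>x. x \<in> set xs \<Longrightarrow> c x = C"
  shows "2 * lam (set xs) \<le> cyc_len xs"
  using assms
proof (induction xs rule: induct_list012)
  case (3 q p zs)
  show ?case
  proof (cases zs)
    case Nil
    then show ?thesis by (simp add: cyc_len_def cpairs_def insert_commute)
  next
    case (Cons r rs)
    define z where "z = last zs"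
    have z: "z \<in> set zs" by (simp add: z_def Cons)
    have del: "set (q # p # zs) - {q} = set (p # zs)" using 3 by auto
    have "2 * (lam (set (q # p # zs)) - lam (set (q # p # zs) - {q})) + lam {p, z}
        \<le> lam {p, q} + lam {q, z}"
    proof (rule lam_delete[where C = C])
      show "3 \<le> card (set (q # p # zs))" using 3(3) Cons by (simp add: card_insert_if)
    qed (use 3 z in auto)
    moreover have "2 * lam (set (p # zs)) \<le> cyc_len (p # zs)"
      using 3 Cons by auto
    moreover have "cyc_len (q # p # zs) = lam {q, p} + cyc_len (p # zs) - lam {z, p} + lam {z, q}"
      using Cons by (simp add: cyc_len_def cpairs_conv_ipairs z_def)
    ultimately show ?thesis unfolding del by (simp add: insert_commute)
  qed
qed auto

text \<open>The outside arcs occur on both sides of the exchange inequality and cancel. What remains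
  is a local inequality for reordering a segment with its two ends fixed.\<close>

lemma exch_inside_segment:
  assumes ok: "ring_ok (seg @ outs) l" and n3: "length (seg @ outs) \<ge> 3"
    and ne: "seg \<noteq> []" "outs \<noteq> []"
    and s: "distinct s" "set s = set seg" "hd s = hd seg" "last s = last seg"
      "steps_ok (seg @ outs) (ipairs s)" "distinct (chord_cols (seg @ outs) (ipairs s))"
  shows "total (seg @ outs) l (ipairs s) + l (last seg) \<le> sum l (set seg)"
proof -
  let ?ws = "seg @ outs"
  have d: "distinct ?ws" using ok by (simp add: ring_ok_def)
  have sne: "s \<noteq> []" using s ne by auto
  have ao: "arcs_on ?ws outs"
    using ne by (auto simp: arcs_on_def arc_append_iff)
  have e: "arc ?ws (last seg) (hd outs)" "arc ?ws (last outs) (hd seg)"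
    using ne by (auto simp: arc_append_iff)
  have "exch ?ws (s @ outs)"
    using d s e ne sne ao unfolding exch_def
    by (auto simp: cpairs_append adj_def chord_cols_arcs_on steps_ok_arcs_on)
  then have "total ?ws l (cpairs (s @ outs)) \<le> sum l (set ?ws)"
    using ok n3 by (simp add: ring_ok_def)
  moreover have "total ?ws l (cpairs (s @ outs)) = total ?ws l (ipairs s) + l (last seg)
      + sum l (set (butlast outs)) + l (last outs)"
    using ne sne s e ao d
    by (simp add: cpairs_append wt_arc total_arcs_on sum_list_distinct_conv_sum_set distinct_butlast)
  moreover have "sum l (set ?ws) = sum l (set seg) + (sum l (set (butlast outs)) + l (last outs))"
    using d ne sum_set_butlast_last[of outs l] by (simp add: sum.union_disjoint)
  ultimately show ?thesis by simp
qed

text \<open>A left link consists of the arcs that enter two cyclically consecutive points \<open>bi\<close>, \<open>bj\<close>, less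
  the distance of \<open>bi\<close> and \<open>bj\<close>; a right link uses the leaving arcs instead. Each new arc in \<open>l1\<close>
  and \<open>l2\<close> is a link, and every left and right link occurs exactly once in the two rings.\<close>
lemma ring_ok_eliminate:
  assumes ok: "ring_ok (weave b ps @ outs) l" and ne: "ps \<noteq> []" "outs \<noteq> []"
    and proper: "\<And>p q. arc (weave b ps @ outs) p q \<Longrightarrow> c p \<noteq> c q"
    and cb: "c b = B" and cps: "\<And>a b'. (a, b') \<in> set ps \<Longrightarrow> c a = A \<and> c b' = B" and AB: "A \<noteq> B"
    and colB: "\<And>x. x \<in> set outs \<Longrightarrow> c x \<noteq> B"
  shows "\<exists>l1 l2. ring_ok (map fst ps @ outs) l1 \<and> ring_ok (rev (map fst ps) @ outs) l2 \<and>
    sum l1 (set (map fst ps @ outs)) + sum l2 (set (map fst ps @ outs)) =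
      2 * sum l (set (weave b ps @ outs)) - 2 * cyc_len (b # map snd ps)"
proof -
  define seg where "seg = weave b ps"
  define ws where "ws = seg @ outs"
  define as where "as = map fst ps"
  define bs where "bs = b # map snd ps"
  define n where "n = length ps"
  define x where "x = last outs"
  \<comment> \<open>\<open>dd i\<close> is a step of the walk along the points of colour
    \<open>B\<close>, and \<open>D\<close> is the step that closes it.\<close>
  define D where "D = lam {bs ! 0, bs ! n}"
  define dd where "dd i = lam {bs ! i, bs ! Suc i}" for i
  have n0: "n > 0" using ne by (simp add: n_def)
  have len: "length as = n" "length bs = Suc n" by (auto simp: as_def bs_def n_def)
  have d: "distinct ws" using ok by (simp add: ws_def seg_def ring_ok_def)
  have okw: "ring_ok (seg @ outs) l" using ok by (simp add: seg_def)
  have dseg: "distinct seg" "set seg \<inter> set outs = {}" "distinct outs" using d by (auto simp: ws_def)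
  have mseg: "mset seg = mset as + mset bs" by (simp add: seg_def as_def bs_def mset_weave)
  then have dab: "distinct (as @ bs)"
    using dseg(1) by (metis mset_append mset_eq_imp_distinct_iff)
  have setseg: "set seg = set as \<union> set bs" by (metis mseg set_mset_mset set_mset_union)
  have das: "distinct as" "distinct bs" "set as \<inter> set bs = {}" using dab by auto
  have colas: "c (as ! i) = A" if "i < n" for i
    using cps[of "fst (ps ! i)" "snd (ps ! i)"] that by (simp add: as_def n_def)
  have colbs: "c (bs ! i) = B" if "i \<le> n" for i
    using cps[of "fst (ps ! (i - 1))" "snd (ps ! (i - 1))"] that cb
    by (cases i) (auto simp: bs_def n_def)
  have asA: "c p = A" if "p \<in> set as" for p using that colas len by (metis in_set_conv_nth)
  have n3: "length ws \<ge> 3"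
  proof -
    have "length seg = length as + length bs" by (metis mseg size_mset size_union)
    then show ?thesis using len n0 by (simp add: ws_def)
  qed
  have nadj: "\<not> adj ws s t" if "c s = c t" for s t
    using that proper[of s t] proper[of t s] by (auto simp: adj_def ws_def seg_def)
  have aseg: "arcs_on ws seg"
    using ne by (auto simp: arcs_on_def ws_def seg_def arc_append_iff)
  have xo: "x \<in> set outs" using ne by (simp add: x_def)
  have xas: "x \<notin> set as" using xo dseg setseg by auto
  have sumseg: "sum l (set seg) = sum_list (map l seg)"
    using dseg by (simp add: sum_list_distinct_conv_sum_set)
  have bo: "x' \<notin> set as \<and> x' \<noteq> x" if "x' \<in> set (butlast outs)" for x'
  proof -
    have "outs = butlast outs @ [x]" using ne by (simp add: x_def)
    then have "x \<notin> set (butlast outs)" using dseg(3)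
      by (metis distinct_append disjoint_iff list.set_intros(1))
    then show ?thesis using that dseg setseg in_set_butlastD[OF that] by auto
  qed
  note chordwt = wt_chord[OF nadj]
  obtain a0 b1 ps' where ps1: "ps = (a0, b1) # ps'" using ne by (metis list.exhaust surj_pair)
  obtain ps'' ae be where ps2: "ps = ps'' @ [(ae, be)]" using ne by (metis rev_exhaust surj_pair)
  define bp where "bp = last (b # map snd ps'')"
  have seg1: "seg = b # a0 # weave b1 ps'" by (simp add: seg_def ps1)
  have seg2: "seg = weave b ps'' @ [ae, be]" by (simp add: seg_def ps2 weave_append)
  have nth: "a0 = as ! 0" "b = bs ! 0" "b1 = bs ! 1" "ae = as ! (n - 1)" "be = bs ! n" "bp = bs ! (n - 1)"
    "last (weave b1 ps') = bs ! n"
  proof -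
    show "a0 = as ! 0" "b = bs ! 0" "b1 = bs ! 1" by (auto simp: as_def bs_def ps1)
    show "ae = as ! (n - 1)" "be = bs ! n" by (auto simp: as_def bs_def ps2 n_def nth_append)
    show "bp = bs ! (n - 1)"
      unfolding bp_def bs_def ps2 n_def by (subst last_conv_nth) (auto simp: nth_Cons nth_append split: nat.splits)
    have "last seg = last bs" by (simp add: seg_def bs_def)
    then show "last (weave b1 ps') = bs ! n" using seg1 len last_conv_nth[of bs] by (auto simp: bs_def)
  qed
  have "last as = ae" by (simp add: as_def ps2)
  moreover have "as \<noteq> []" "hd as = a0" by (auto simp: as_def ps1)
  ultimately have asne: "as \<noteq> []" "hd as = a0" "last as = ae" by auto
  have "last seg = be" by (simp add: seg2)
  moreover have "hd seg = b" by (simp add: seg1)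
  ultimately have lseg: "last seg = be" "hd seg = b" by auto
  have colb: "c a0 = A" "c b1 = B" "c ae = A" "c be = B" "c bp = B"
    using colas colbs n0 nth(1-6) by auto
  have arc1: "arcs_on ws (weave b1 ps')" "arc ws b a0" "arc ws a0 b1"
    using aseg unfolding seg1 arcs_on_def by (auto simp: ipairs_Cons)
  have arc2: "arcs_on ws (weave b ps'')" "arc ws bp ae" "arc ws ae be"
    using aseg unfolding seg2 arcs_on_def by (auto simp: ipairs_append bp_def)
  note arcs_on_simps = steps_ok_arcs_on chord_cols_arcs_on total_arcs_on
     steps_ok_rev_arcs_on chord_cols_rev_arcs_on total_rev_arcs_on[OF _ d n3]
  have sl1: "sum_list (map l (weave b1 ps')) = sum_list (map l (butlast (weave b1 ps'))) + l be"
    using sum_list_butlast_last[of "weave b1 ps'" l] lseg seg1 by simp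
  have sl2: "sum_list (map l (weave b ps'')) = sum_list (map l (butlast (weave b ps''))) + l bp"
    using sum_list_butlast_last[of "weave b ps''" l] by (simp add: bp_def)
  have dist1: "distinct (b # a0 # weave b1 ps')" using dseg(1) seg1 by simp
  have dist2: "distinct (weave b ps'' @ [ae, be])" using dseg(1) seg2 by simp
  have split: "\<exists>p1 p3. seg = weave b p1 @ [as ! i, bs ! Suc i, as ! Suc i] @ weave (bs ! Suc (Suc i)) p3
      \<and> last (weave b p1) = bs ! i" if "Suc i < n" for i
  proof -
    define p1 where "p1 = take i ps"
    define p3 where "p3 = drop (Suc (Suc i)) ps"
    have "ps = p1 @ ps ! i # ps ! Suc i # p3"
      using that by (simp add: p1_def p3_def n_def Cons_nth_drop_Suc)
    then have e: "ps = p1 @ (as ! i, bs ! Suc i) # (as ! Suc i, bs ! Suc (Suc i)) # p3"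
      using that by (simp add: as_def bs_def n_def)
    have "b # map snd p1 = take (Suc i) bs" by (simp add: bs_def p1_def take_map)
    then have "last (b # map snd p1) = bs ! i"
      using that len by (subst last_conv_nth) auto
    moreover have "seg = weave b p1 @ [as ! i, bs ! Suc i, as ! Suc i] @ weave (bs ! Suc (Suc i)) p3"
      using e by (simp only: seg_def weave_append weave.simps append.simps append_assoc)
    ultimately show ?thesis by (metis last_weave)
  qed
  have inner: "lam {as ! i, as ! Suc i} + dd (Suc i) \<le> l (as ! i) + l (as ! Suc i) \<and>
     lam {as ! i, as ! Suc i} + dd i \<le> l (bs ! i) + l (bs ! Suc i)" if i: "Suc i < n" for i
  proof -
    obtain p1 p3 where sg: "seg = weave b p1 @ [as ! i, bs ! Suc i, as ! Suc i] @ weave (bs ! Suc (Suc i)) p3"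
      and lp: "last (weave b p1) = bs ! i" using split[OF i] by blast
    let ?a = "as ! i" and ?a' = "as ! Suc i" and ?b = "bs ! Suc i" and ?b' = "bs ! Suc (Suc i)"
      and ?bb = "bs ! i"
    have cc: "c ?a = A" "c ?a' = A" "c ?b = B" "c ?b' = B" "c ?bb = B" using colas colbs i by auto
    have arcs: "arcs_on ws (weave b p1)" "arcs_on ws (weave ?b' p3)" "arc ws ?a ?b" "arc ws ?b ?a'"
       "arc ws ?a' ?b'" "arc ws ?bb ?a"
      using aseg lp unfolding sg arcs_on_def by (auto simp: ipairs_append ipairs_Cons)
    have lst: "last (weave ?b' p3) = be" using lseg sg by simp
    have ss: "sum l (set seg) = sum_list (map l (butlast (weave b p1))) + l ?bb + l ?a + l ?b + l ?a'
        + sum_list (map l (butlast (weave ?b' p3))) + l be"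
      using sum_list_butlast_last[of "weave b p1" l]
        sum_list_butlast_last[of "weave ?b' p3" l] lp lst unfolding sumseg by (subst sg) simp
    have ds: "distinct (weave b p1 @ [?a, ?b, ?a'] @ weave ?b' p3)" using dseg(1) sg by simp
    \<comment> \<open>Both reorderings use the chord between \<open>?a\<close> and
      \<open>?a'\<close> and one chord of colour \<open>B\<close>. \<open>s3\<close> gives up the
      arcs leaving \<open>?a\<close> and \<open>?a'\<close>, \<open>s4\<close> those leaving
      \<open>?bb\<close> and \<open>?b\<close>. The outcomes are the chord clauses for the inner
      arcs of the two new rings.\<close>
    define s3 where "s3 = weave b p1 @ [?a, ?a', ?b] @ weave ?b' p3"
    define s4 where "s4 = weave b p1 @ [?b, ?a, ?a'] @ weave ?b' p3"
    have i3: "ipairs s3 = ipairs (weave b p1) @ (?bb, ?a) # (?a, ?a') # (?a', ?b) # (?b, ?b') # ipairs (weave ?b' p3)"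
      unfolding s3_def using lp by (simp add: ipairs_append ipairs_Cons)
    have i4: "ipairs s4 = ipairs (weave b p1) @ (?bb, ?b) # (?b, ?a) # (?a, ?a') # (?a', ?b') # ipairs (weave ?b' p3)"
      unfolding s4_def using lp by (simp add: ipairs_append ipairs_Cons)
    have adjs: "adj ws ?bb ?a" "adj ws ?a' ?b" "adj ws ?b ?a" "adj ws ?a' ?b'"
      using arcs by (auto simp: adj_def)
    have nadjs: "\<not> adj ws ?a ?a'" "\<not> adj ws ?b ?b'" "\<not> adj ws ?bb ?b" using nadj cc by auto
    have "total (seg @ outs) l (ipairs s3) + l (last seg) \<le> sum l (set seg)"
    proof (rule exch_inside_segment[OF okw])
      show "set s3 = set seg" unfolding s3_def sg by auto
      show "distinct s3" unfolding s3_def using ds by auto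
      show "hd s3 = hd seg" "last s3 = last seg" unfolding s3_def sg by simp_all
      show "steps_ok (seg @ outs) (ipairs s3)" "distinct (chord_cols (seg @ outs) (ipairs s3))"
        unfolding i3 ws_def[symmetric] using arcs adjs nadjs cc AB by (simp_all add: arcs_on_simps)
    qed (use n3 ne in \<open>auto simp: ws_def sg\<close>)
    moreover have "total ws l (ipairs s3) = sum_list (map l (butlast (weave b p1))) + l ?bb + lam {?a, ?a'}
       + l ?b + dd (Suc i) + sum_list (map l (butlast (weave ?b' p3)))"
      unfolding i3 using arcs nadjs chordwt cc
      by (simp add: arcs_on_simps wt_arc wt_arc_rev[OF d n3] dd_def)
    ultimately have r1: "lam {?a, ?a'} + dd (Suc i) \<le> l ?a + l ?a'"
      using ss lseg unfolding ws_def by simp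
    have "total (seg @ outs) l (ipairs s4) + l (last seg) \<le> sum l (set seg)"
    proof (rule exch_inside_segment[OF okw])
      show "set s4 = set seg" unfolding s4_def sg by auto
      show "distinct s4" unfolding s4_def using ds by auto
      show "hd s4 = hd seg" "last s4 = last seg" unfolding s4_def sg by simp_all
      show "steps_ok (seg @ outs) (ipairs s4)" "distinct (chord_cols (seg @ outs) (ipairs s4))"
        unfolding i4 ws_def[symmetric] using arcs adjs nadjs cc AB by (simp_all add: arcs_on_simps)
    qed (use n3 ne in \<open>auto simp: ws_def sg\<close>)
    moreover have "total ws l (ipairs s4) = sum_list (map l (butlast (weave b p1))) + dd i + l ?a + lam {?a, ?a'}
       + l ?a' + sum_list (map l (butlast (weave ?b' p3)))"
      unfolding i4 using arcs nadjs chordwt cc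
      by (simp add: arcs_on_simps wt_arc wt_arc_rev[OF d n3] dd_def)
    ultimately have r2: "lam {?a, ?a'} + dd i \<le> l ?bb + l ?b"
      using ss lseg unfolding ws_def by simp
    show ?thesis using r1 r2 by simp
  qed
  \<comment> \<open>Inner arcs become left links: the arcs leaving \<open>as ! i\<close> and
    \<open>as ! Suc i\<close> enter two consecutive points of colour \<open>B\<close>. The arc into
    the segment, whose length is stored at \<open>x\<close>, is a left link too; only the arc out of
    the segment is a right link.\<close>
  obtain l1 where l1: "\<And>i. i < n \<Longrightarrow> l1 (as ! i) =
      (if Suc i < n then l (as ! i) + l (as ! Suc i) - dd (Suc i) else l bp + l be - dd (n - 1))"
    "\<And>p. p \<notin> set as \<Longrightarrow> l1 p = (l(x := l x + l a0 - dd 0)) p"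
    using prescribed_values[OF das(1), where f = "\<lambda>i. if Suc i < n then l (as ! i) + l (as ! Suc i) - dd (Suc i)
        else l bp + l be - dd (n - 1)" and h = "l(x := l x + l a0 - dd 0)"] unfolding len by blast
  \<comment> \<open>In the reversed order the inner arcs become right links. The arcs into and out
    of the segment are the left and the right link of the two end points \<open>b\<close> and
    \<open>be\<close>, at distance \<open>D\<close>.\<close>
  obtain l2 where l2: "\<And>i. i < n \<Longrightarrow> l2 (as ! i) =
      (if i = 0 then l b + l be - D else l (bs ! (i - 1)) + l (bs ! i) - dd (i - 1))"
    "\<And>p. p \<notin> set as \<Longrightarrow> l2 p = (l(x := l x + l ae - D)) p"
    using prescribed_values[OF das(1), where f = "\<lambda>i. if i = 0 then l b + l be - D
        else l (bs ! (i - 1)) + l (bs ! i) - dd (i - 1)" and h = "l(x := l x + l ae - D)"]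
    unfolding len by blast
  have dd0: "dd 0 = lam {b, b1}" and ddn: "dd (n - 1) = lam {bp, be}" and Db: "D = lam {b, be}"
    using n0 nth(2,3,5,6) by (auto simp: dd_def D_def)
  have l1x: "l1 x = l x + l a0 - dd 0" and l2x: "l2 x = l x + l ae - D" using l1 l2 xas by auto
  have l1ae: "l1 ae = l bp + l be - dd (n - 1)" using l1(1)[of "n - 1"] n0 nth by simp
  have l2a0: "l2 a0 = l b + l be - D" using l2(1)[of 0] n0 nth by simp
  have adjs: "adj ws a0 b" "adj ws bp ae" "adj ws ae bp" "adj ws be ae" "adj ws b1 a0"
    using arc1 arc2 by (auto simp: adj_def)
  have nadjs: "\<not> adj ws b b1" "\<not> adj ws bp be" "\<not> adj ws b be"
    using nadj colb cb by auto
  \<comment> \<open>Swapping two neighbours suffices here: \<open>s1\<close> swaps the first two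
    points of the segment and \<open>s2\<close> the last two, each using the chord between the two
    outermost points of colour \<open>B\<close> at that end.\<close>
  have "ring_ok (as @ outs) l1"
  proof (rule ring_ok_replace_segment[where seg = seg and l = l and A = A and B = B and
        ?s1.0 = "a0 # b # weave b1 ps'" and ?s2.0 = "weave b ps'' @ [be, ae]"])
    show "ring_ok (seg @ outs) l" by (rule okw)
    have i1: "ipairs (a0 # b # weave b1 ps') = (a0, b) # (b, b1) # ipairs (weave b1 ps')"
      by (simp add: ipairs_Cons)
    have i2: "ipairs (weave b ps'' @ [be, ae]) = ipairs (weave b ps'') @ [(bp, be), (be, ae)]"
      by (simp add: ipairs_append bp_def)
    show "distinct (a0 # b # weave b1 ps')" "set (a0 # b # weave b1 ps') = set seg"
      using dist1 by (auto simp: seg1)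
    show "hd (a0 # b # weave b1 ps') = hd as" "last (a0 # b # weave b1 ps') = last seg"
      using asne by (auto simp: seg1)
    show "steps_ok (seg @ outs) (ipairs (a0 # b # weave b1 ps'))"
      "chord_cols (seg @ outs) (ipairs (a0 # b # weave b1 ps')) = [B]"
      unfolding i1 ws_def[symmetric] using arc1 adjs nadjs colb cb by (simp_all add: arcs_on_simps)
    have "total ws l (ipairs (a0 # b # weave b1 ps')) = l b + dd 0 + sum_list (map l (butlast (weave b1 ps')))"
      unfolding i1 using arc1 chordwt[of b b1] colb cb
      by (simp add: arcs_on_simps wt_arc_rev[OF d n3] dd0)
    then show "total (seg @ outs) l (ipairs (a0 # b # weave b1 ps')) + l (last seg) + l1 (last outs) =
      l (last outs) + sum l (set seg)"
      unfolding ws_def[symmetric] sumseg using l1x sl1 lseg by (simp add: seg1 x_def)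
    show "distinct (weave b ps'' @ [be, ae])" "set (weave b ps'' @ [be, ae]) = set seg"
      using dist2 by (auto simp: seg2)
    show "hd (weave b ps'' @ [be, ae]) = hd seg" "last (weave b ps'' @ [be, ae]) = last as"
      using asne by (auto simp: seg2)
    show "steps_ok (seg @ outs) (ipairs (weave b ps'' @ [be, ae]))"
      "chord_cols (seg @ outs) (ipairs (weave b ps'' @ [be, ae])) = [B]"
      unfolding i2 ws_def[symmetric] using arc2 adjs nadjs colb by (simp_all add: arcs_on_simps)
    have "total ws l (ipairs (weave b ps'' @ [be, ae])) = sum_list (map l (butlast (weave b ps''))) + dd (n - 1) + l ae"
      unfolding i2 using arc2 chordwt[of bp be] colb ddn
      by (simp add: arcs_on_simps wt_arc_rev[OF d n3])
    then show "total (seg @ outs) l (ipairs (weave b ps'' @ [be, ae])) + l1 (last as) = sum l (set seg)"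
      unfolding ws_def[symmetric] sumseg using l1ae sl2 asne by (simp add: seg2)
    show "lam {p, q} \<le> l1 p" if "(p, q) \<in> set (ipairs as)" for p q
    proof -
      obtain i where i: "Suc i < n" "p = as ! i" "q = as ! Suc i"
        using \<open>(p, q) \<in> set (ipairs as)\<close> ipairs_nth[of p q as] len by auto
      then show ?thesis using inner[OF i(1)] l1(1)[of i] by simp
    qed
    show "l1 x' = l x'" if "x' \<in> set (butlast outs)" for x'
      using bo[OF that] l1(2)[of x'] by simp
  qed (use n3 proper ne asne das AB colB asA setseg in \<open>auto simp: ws_def seg_def\<close>)
  \<comment> \<open>For the reversed order the segment is run through backwards except for one of
    its end points, and the chord between \<open>b\<close> and \<open>be\<close> attaches that
    point.\<close>
  moreover have "ring_ok (rev as @ outs) l2"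
  proof (rule ring_ok_replace_segment[where seg = seg and l = l and A = A and B = B and
        ?s1.0 = "ae # rev (weave b ps'') @ [be]" and ?s2.0 = "b # rev (weave b1 ps') @ [a0]"])
    show "ring_ok (seg @ outs) l" by (rule okw)
    have i1: "ipairs (ae # rev (weave b ps'') @ [be]) = (ae, bp) # ipairs (rev (weave b ps'')) @ [(b, be)]"
      by (simp add: ipairs_append ipairs_Cons bp_def hd_rev last_rev)
    have i2: "ipairs (b # rev (weave b1 ps') @ [a0]) = (b, be) # ipairs (rev (weave b1 ps')) @ [(b1, a0)]"
      using lseg seg1 by (simp add: ipairs_append ipairs_Cons hd_rev last_rev)
    show "distinct (ae # rev (weave b ps'') @ [be])" "set (ae # rev (weave b ps'') @ [be]) = set seg"
      using dist2 by (auto simp: seg2)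
    show "hd (ae # rev (weave b ps'') @ [be]) = hd (rev as)" "last (ae # rev (weave b ps'') @ [be]) = last seg"
      using asne by (auto simp: seg2 hd_rev)
    show "steps_ok (seg @ outs) (ipairs (ae # rev (weave b ps'') @ [be]))"
      "chord_cols (seg @ outs) (ipairs (ae # rev (weave b ps'') @ [be])) = [B]"
      unfolding i1 ws_def[symmetric] using arc2 adjs nadjs colb cb by (simp_all add: arcs_on_simps)
    have "total ws l (ipairs (ae # rev (weave b ps'') @ [be])) = l bp + sum_list (map l (butlast (weave b ps''))) + D"
      unfolding i1 using arc2 chordwt[of b be] colb cb
      by (simp add: arcs_on_simps wt_arc_rev[OF d n3] Db)
    then show "total (seg @ outs) l (ipairs (ae # rev (weave b ps'') @ [be])) + l (last seg) + l2 (last outs) =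
      l (last outs) + sum l (set seg)"
      unfolding ws_def[symmetric] sumseg using l2x sl2 lseg by (simp add: seg2 x_def)
    show "distinct (b # rev (weave b1 ps') @ [a0])" "set (b # rev (weave b1 ps') @ [a0]) = set seg"
      using dist1 by (auto simp: seg1)
    show "hd (b # rev (weave b1 ps') @ [a0]) = hd seg" "last (b # rev (weave b1 ps') @ [a0]) = last (rev as)"
      using asne by (auto simp: seg1 last_rev)
    show "steps_ok (seg @ outs) (ipairs (b # rev (weave b1 ps') @ [a0]))"
      "chord_cols (seg @ outs) (ipairs (b # rev (weave b1 ps') @ [a0])) = [B]"
      unfolding i2 ws_def[symmetric] using arc1 adjs nadjs colb cb by (simp_all add: arcs_on_simps)
    have "total ws l (ipairs (b # rev (weave b1 ps') @ [a0])) = D + sum_list (map l (butlast (weave b1 ps'))) + l a0"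
      unfolding i2 using arc1 chordwt[of b be] colb cb
      by (simp add: arcs_on_simps wt_arc_rev[OF d n3] Db)
    then show "total (seg @ outs) l (ipairs (b # rev (weave b1 ps') @ [a0])) + l2 (last (rev as)) = sum l (set seg)"
      unfolding ws_def[symmetric] sumseg using l2a0 sl1 asne by (simp add: seg1 last_rev)
    show "lam {p, q} \<le> l2 p" if "(p, q) \<in> set (ipairs (rev as))" for p q
    proof -
      obtain i where i: "Suc i < n" "q = as ! i" "p = as ! Suc i"
        using \<open>(p, q) \<in> set (ipairs (rev as))\<close> ipairs_nth[of q p as] len
        by (auto simp: set_ipairs_rev)
      then show ?thesis using inner[OF i(1)] l2(1)[of "Suc i"] by (simp add: insert_commute)
    qed
    show "l2 x' = l x'" if "x' \<in> set (butlast outs)" for x'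
      using bo[OF that] l2(2)[of x'] by simp
  qed (use n3 proper ne asne das AB colB asA setseg in \<open>auto simp: ws_def seg_def\<close>)
  moreover have "sum l1 (set (as @ outs)) + sum l2 (set (as @ outs)) =
      2 * sum l (set (seg @ outs)) - 2 * cyc_len bs"
  proof -
    have so: "sum f (set (butlast outs)) = sum l (set (butlast outs))"
      if "\<And>p. p \<notin> set as \<Longrightarrow> f p = (l(x := v)) p" for f v
      using that bo by (intro sum.cong) auto
    have disj: "set as \<inter> set outs = {}" using dseg setseg by auto
    have S: "sum f (set (as @ outs)) = (\<Sum>i<n. f (as ! i)) + sum f (set (butlast outs)) + f x" for f :: "'p \<Rightarrow> int"
    proof -
      have "sum f (set as) = (\<Sum>i<n. f (as ! i))"
        using das(1) len by (simp add: sum_list_map_nth flip: sum_list_distinct_conv_sum_set)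
      then show ?thesis
        using disj sum_set_butlast_last[OF dseg(3) ne(2), of f]
        by (simp add: sum.union_disjoint x_def)
    qed
    obtain k where k: "n = Suc k" using n0 by (cases n) auto
    have e1: "(\<Sum>i<n. l1 (as ! i)) = (\<Sum>i<k. l (as ! i) + l (as ! Suc i) - dd (Suc i)) + (l bp + l be - dd k)"
      using l1(1) by (simp add: k)
    have e2: "(\<Sum>i<n. l2 (as ! i)) = (l b + l be - D) + (\<Sum>i<k. l (bs ! i) + l (bs ! Suc i) - dd i)"
      unfolding k sum.lessThan_Suc_shift using l2(1) by (simp add: k)
    \<comment> \<open>The index ranges in the two rings are shifted against each other, so each sum
      is written both with its first and with its last terms split off.\<close>
    have A1: "(\<Sum>i<n. l (as ! i)) = (\<Sum>i<k. l (as ! i)) + l ae"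
      "(\<Sum>i<n. l (as ! i)) = l a0 + (\<Sum>i<k. l (as ! Suc i))"
      using nth(1,4) by (simp add: k, simp add: k sum.lessThan_Suc_shift del: sum.lessThan_Suc)
    have B1: "(\<Sum>i<Suc n. l (bs ! i)) = (\<Sum>i<k. l (bs ! i)) + l bp + l be"
      "(\<Sum>i<Suc n. l (bs ! i)) = l b + (\<Sum>i<k. l (bs ! Suc i)) + l be"
      using nth(2,5,6) by (simp add: k,
        subst sum.lessThan_Suc_shift, simp add: k)
    have D1: "(\<Sum>i<n. dd i) = (\<Sum>i<k. dd i) + dd k" "(\<Sum>i<n. dd i) = dd 0 + (\<Sum>i<k. dd (Suc i))"
      by (simp add: k, simp add: k sum.lessThan_Suc_shift del: sum.lessThan_Suc)
    have cl: "cyc_len bs = (\<Sum>i<n. dd i) + D"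
    proof -
      have bne: "bs \<noteq> []" by (simp add: bs_def)
      have "sum_list (map (\<lambda>(p, q). lam {p, q}) (ipairs bs)) = (\<Sum>i<n. dd i)"
        by (simp add: ipairs_def sum_list_map_nth len dd_def nth_tl)
      moreover have "last bs = bs ! n" "hd bs = bs ! 0"
        using bne len by (auto simp: last_conv_nth hd_conv_nth)
      ultimately show ?thesis
        using bne by (simp add: cyc_len_def cpairs_conv_ipairs D_def insert_commute)
    qed
    have sg: "sum l (set seg) = (\<Sum>i<n. l (as ! i)) + (\<Sum>i<Suc n. l (bs ! i))"
    proof -
      have "sum l (set seg) = sum l (set as) + sum l (set bs)"
        unfolding setseg using das by (simp add: sum.union_disjoint)
      also have "\<dots> = (\<Sum>i<n. l (as ! i)) + (\<Sum>i<Suc n. l (bs ! i))"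
        using das(1,2) len
        by (simp add: sum_list_map_nth del: sum.lessThan_Suc flip: sum_list_distinct_conv_sum_set)
      finally show ?thesis .
    qed
    have T: "sum l (set (seg @ outs)) = sum l (set seg) + sum l (set (butlast outs)) + l x"
      using dseg sum_set_butlast_last[OF dseg(3) ne(2), of l]
      by (simp add: sum.union_disjoint x_def)
    have e1': "(\<Sum>i<k. l (as ! i) + l (as ! Suc i) - dd (Suc i)) =
      (\<Sum>i<k. l (as ! i)) + (\<Sum>i<k. l (as ! Suc i)) - (\<Sum>i<k. dd (Suc i))"
      by (simp add: sum.distrib sum_subtractf)
    have e2': "(\<Sum>i<k. l (bs ! i) + l (bs ! Suc i) - dd i) =
      (\<Sum>i<k. l (bs ! i)) + (\<Sum>i<k. l (bs ! Suc i)) - (\<Sum>i<k. dd i)"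
      by (simp add: sum.distrib sum_subtractf)
    have "sum l1 (set (butlast outs)) = sum l (set (butlast outs))"
      "sum l2 (set (butlast outs)) = sum l (set (butlast outs))"
      using so[of l1, OF l1(2)] so[of l2, OF l2(2)] by blast+
    note out = this
    have arith: "SA0 + SA1 - SD1 + (bp + be - dk) + o1 + (lx + a0 - d0)
        + (b + be - D + (SB0 + SB1 - SD0) + o2 + (lx + ae - D)) =
      2 * (SA + SB + ou + lx) - 2 * (SD + D)"
      if "o1 = ou" "o2 = ou" "SA = SA0 + ae" "SA = a0 + SA1" "SB = SB0 + bp + be" "SB = b + SB1 + be"
        "SD = SD0 + dk" "SD = d0 + SD1"
      for SA0 SA1 SD1 bp be dk o1 lx a0 d0 b D SB0 SB1 SD0 o2 ae SA SB ou SD :: int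
    proof -
      have "2 * SA = SA0 + ae + (a0 + SA1)" "2 * SB = SB0 + bp + be + (b + SB1 + be)"
        "2 * SD = SD0 + dk + (d0 + SD1)" using that by linarith+
      then show ?thesis using that(1,2) by (simp add: algebra_simps)
    qed
    show ?thesis
      unfolding S T sg cl e1 e2 e1' e2' l1x l2x
      by (rule arith[OF out A1 B1 D1])
  qed
  ultimately show ?thesis unfolding as_def bs_def seg_def by auto
qed

end

section \<open>Colour words with a crossing tree\<close>

text \<open>Two cuts of the cyclic word put all occurrences of \<open>C\<close> into one part and
  all those of \<open>D\<close> into the other. For the colours of attachments this is the negation
  of overlapping.\<close>

definition uncrossed :: "'c list \<Rightarrow> 'c \<Rightarrow> 'c \<Rightarrow> bool" where
  "uncrossed u C D \<longleftrightarrow> (\<exists>n us vs. rotate n u = us @ vs \<and> C \<notin> set vs \<and> D \<notin> set us)"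

lemma rotate_split: "\<exists>x y. u = x @ y \<and> rotate n u = y @ x"
  by (metis append_take_drop_id rotate_drop_take)

lemma rotate_back: "\<exists>k. rotate k (rotate n u) = u"
  by (metis rotate_append rotate_split)

lemma uncrossed_rotate [simp]: "uncrossed (rotate m u) C D \<longleftrightarrow> uncrossed u C D"
  unfolding uncrossed_def by (metis rotate_back rotate_rotate)

lemma uncrossed_sym: "uncrossed u C D \<Longrightarrow> uncrossed u D C"
  unfolding uncrossed_def by (metis rotate_append rotate_rotate)

text \<open>A cut of the list restricts to every sublist. With the map \<open>f\<close>, positions
  rather than letters can be selected, as is needed to drop one of two equal letters.\<close>

lemma uncrossed_map_filter:
  assumes "uncrossed (map f ws) C D" shows "uncrossed (map f (filter P ws)) C D"
proof -
  obtain n us vs where r: "map f (rotate n ws) = us @ vs" "C \<notin> set vs" "D \<notin> set us"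
    using assms by (auto simp: uncrossed_def rotate_map)
  obtain us0 vs0 where w: "rotate n ws = us0 @ vs0" "map f us0 = us" "map f vs0 = vs"
    using r(1) by (auto simp: map_eq_append_conv)
  obtain x y where xy: "ws = x @ y" "rotate n ws = y @ x" using rotate_split by blast
  have "rotate (length (filter P x)) (filter P ws) = filter P (rotate n ws)"
    using xy by (metis filter_append rotate_append)
  then have "rotate (length (filter P x)) (map f (filter P ws)) = map f (filter P us0) @ map f (filter P vs0)"
    using w by (simp add: rotate_map)
  moreover have "C \<notin> set (map f (filter P vs0))" "D \<notin> set (map f (filter P us0))" using r w by auto
  ultimately show ?thesis unfolding uncrossed_def by blast
qed

lemma filter_eq_append:
  "filter P u = x @ y \<Longrightarrow> \<exists>x0 y0. u = x0 @ y0 \<and> filter P x0 = x \<and> filter P y0 = y"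
proof (induction x arbitrary: u)
  case Nil
  then show ?case by (intro exI[of _ "[]"] exI[of _ u]) simp
next
  case (Cons a x)
  then obtain us vs where u: "u = us @ a # vs" "\<forall>u\<in>set us. \<not> P u" "P a" "x @ y = filter P vs"
    using filter_eq_ConsD[of P u a "x @ y"] by auto
  obtain x0 y0 where "vs = x0 @ y0" "filter P x0 = x" "filter P y0 = y"
    using Cons.IH[of vs] u(4) by auto
  then show ?case using u by (intro exI[of _ "us @ a # x0"] exI[of _ y0]) simp
qed

text \<open>Letters other than \<open>C\<close> and \<open>D\<close> impose no condition, so a cut
  of the filtered word extends to the full word wherever they fall.\<close>

lemma uncrossed_filter:
  assumes "P C" "P D" shows "uncrossed (filter P u) C D \<longleftrightarrow> uncrossed u C D"
proof
  assume "uncrossed u C D"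
  then show "uncrossed (filter P u) C D" using uncrossed_map_filter[of "\<lambda>x. x" u C D P] by simp
next
  assume "uncrossed (filter P u) C D"
  then obtain n us vs where r: "rotate n (filter P u) = us @ vs" "C \<notin> set vs" "D \<notin> set us"
    by (auto simp: uncrossed_def)
  obtain x y where xy: "filter P u = x @ y" "rotate n (filter P u) = y @ x" using rotate_split by blast
  obtain x0 y0 where u: "u = x0 @ y0" "filter P x0 = x" "filter P y0 = y"
    using filter_eq_append[OF xy(1)] by blast
  have "filter P (y0 @ x0) = us @ vs" using u r xy by simp
  then obtain us0 vs0 where w: "y0 @ x0 = us0 @ vs0" "filter P us0 = us" "filter P vs0 = vs"
    using filter_eq_append by blast
  have "rotate (length x0) u = us0 @ vs0" using u w by (simp add: rotate_append)
  moreover have "C \<notin> set vs0" "D \<notin> set us0" using w r(2,3) assms by auto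
  ultimately show "uncrossed u C D" unfolding uncrossed_def by blast
qed

lemma uncrossed_dup: "uncrossed (E # E # r) C D \<longleftrightarrow> uncrossed (E # r) C D"
proof
  assume a: "uncrossed (E # E # r) C D"
  \<comment> \<open>The tags tell the two copies of \<open>E\<close> apart, so that exactly one of
    them is filtered out.\<close>
  define ws where "ws = (E, True) # (E, False) # map (\<lambda>x. (x, True)) r"
  have "map fst ws = E # E # r" "map fst (filter snd ws) = E # r"
    by (auto simp: ws_def o_def filter_map)
  then show "uncrossed (E # r) C D" using a uncrossed_map_filter[of fst ws C D snd] by simp
next
  assume "uncrossed (E # r) C D"
  then obtain n us vs where r: "rotate n (E # r) = us @ vs" "C \<notin> set vs" "D \<notin> set us"
    by (auto simp: uncrossed_def)
  obtain x y where xy: "E # r = x @ y" "us @ vs = y @ x" using rotate_split r(1) by metis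
  \<comment> \<open>The additional copy of \<open>E\<close> goes into the part that holds the other
    one, which leaves the letter sets of both parts unchanged.\<close>
  have "\<exists>us' vs'. (\<exists>m. rotate m (E # E # r) = us' @ vs') \<and> set us' = set us \<and> set vs' = set vs"
  proof (cases x)
    case Nil
    then have e: "E # r = us @ vs" using xy by simp
    show ?thesis
    proof (cases us)
      case Nil
      then show ?thesis using e by (intro exI[of _ "[]"] exI[of _ "E # E # r"]) (auto intro: exI[of _ 0])
    next
      case (Cons z us1)
      then show ?thesis using e by (intro exI[of _ "E # us"] exI[of _ vs]) (auto intro: exI[of _ 0])
    qed
  next
    case (Cons z x1)
    then have z: "z = E" "r = x1 @ y" using xy by auto
    have rot: "rotate (length (E # E # x1)) (E # E # r) = y @ E # E # x1"
      unfolding z using rotate_append[of "E # E # x1" y] by simp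
    consider us1 where "us = y @ us1" "us1 @ vs = E # x1" | vs1 where "y = us @ vs1" "vs = vs1 @ E # x1"
      using xy(2) Cons z by (auto simp: append_eq_append_conv2)
    then show ?thesis
    proof cases
      case 1
      show ?thesis
      proof (cases us1)
        case Nil
        then have "rotate (length (E # E # x1)) (E # E # r) = us @ (E # vs)" using 1 rot by simp
        then show ?thesis using 1 Nil by (metis list.set_intros(1) insert_absorb list.simps(15) self_append_conv2)
      next
        case (Cons e us2)
        then have "rotate (length (E # E # x1)) (E # E # r) = (y @ E # us1) @ vs" using 1 rot by simp
        moreover have "set (y @ E # us1) = set us" using 1 Cons by auto
        ultimately show ?thesis by blast
      qed
    next
      case 2
      have "rotate (length (E # E # x1)) (E # E # r) = us @ (vs1 @ E # E # x1)" using 2 rot by simp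
      moreover have "set (vs1 @ E # E # x1) = set vs" using 2 by auto
      ultimately show ?thesis by blast
    qed
  qed
  then show "uncrossed (E # E # r) C D" using r unfolding uncrossed_def by metis
qed

definition crossed :: "'c list \<Rightarrow> 'c \<Rightarrow> 'c \<Rightarrow> bool" where
  "crossed u C D \<longleftrightarrow> C \<in> set u \<and> D \<in> set u \<and> C \<noteq> D \<and> \<not> uncrossed u C D"

lemma crossed_sym: "crossed u C D \<Longrightarrow> crossed u D C"
  by (auto simp: crossed_def dest: uncrossed_sym)

definition acyclic_rel :: "('c \<Rightarrow> 'c \<Rightarrow> bool) \<Rightarrow> bool" where
  "acyclic_rel R \<longleftrightarrow> \<not> (\<exists>cs. length cs \<ge> 3 \<and> distinct cs \<and> (\<forall>(x, y)\<in>set (cpairs cs). R x y))"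

text \<open>Connectedness of the crossing graph is stated through cuts, a form that passes easily to
  the word without a leaf. The lower bound on the counts reflects that a bridge has at least two
  attachments.\<close>

definition tree_word :: "'c list \<Rightarrow> bool" where
  "tree_word u \<longleftrightarrow>
     (\<forall>S. S \<subset> set u \<longrightarrow> S \<noteq> {} \<longrightarrow> (\<exists>C\<in>S. \<exists>D\<in>set u - S. crossed u C D)) \<and>
     acyclic_rel (crossed u) \<and> (\<forall>C\<in>set u. count_list u C \<ge> 2)"

text \<open>The last vertex of a longest path that starts in \<open>A\<close> and then stays in \<open>K\<close>.\<close>
lemma acyclic_rel_leaf:
  assumes fin: "finite K" "K \<noteq> {}" and sym: "\<And>x y. R x y \<Longrightarrow> R y x" and irr: "\<And>x. \<not> R x x"
    and acyc: "acyclic_rel R" and nb: "\<And>v w. v \<in> K \<Longrightarrow> R v w \<Longrightarrow> w \<in> insert A K"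
  shows "\<exists>v\<in>K. \<forall>w w'. R v w \<longrightarrow> R v w' \<longrightarrow> w = w'"
proof -
  obtain k where k: "k \<in> K" using fin by blast
  \<comment> \<open>The path starts in \<open>A\<close> only if it can step from there into
    \<open>K\<close>. In that case an end vertex related to \<open>A\<close> finds \<open>A\<close>
    already on the path.\<close>
  define h where "h = (if \<exists>v\<in>K. R A v then A else k)"
  define Q where "Q p \<longleftrightarrow> p \<noteq> [] \<and> distinct p \<and> hd p = h \<and> set p \<subseteq> insert A K \<and> last p \<in> K \<and>
    (\<forall>(x, y)\<in>set (ipairs p). R x y)" for p
  have ex: "\<exists>p. Q p"
  proof (cases "\<exists>v\<in>K. R A v")
    case True
    then obtain v where "v \<in> K" "R A v" by blast
    then have "Q [A, v]" using True irr by (auto simp: Q_def h_def)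
    then show ?thesis ..
  next
    case False
    then have "Q [k]" using k by (auto simp: Q_def h_def)
    then show ?thesis ..
  qed
  have bound: "length p \<le> card (insert A K)" if "Q p" for p
    using that fin card_mono[of "insert A K" "set p"] by (simp add: Q_def distinct_card)
  obtain p where p: "Q p" and mx: "\<And>p'. Q p' \<Longrightarrow> length p' \<le> length p"
  proof -
    obtain p1 where "Q p1" using ex ..
    then show ?thesis
      using ex_has_greatest_nat[of Q p1 length "Suc (card (insert A K))"] bound that by (auto simp: less_Suc_eq_le)
  qed
  define v where "v = last p"
  obtain p0 where p0: "p = p0 @ [v]" using p by (metis Q_def append_butlast_last_id v_def)
  have vK: "v \<in> K" using p by (simp add: Q_def v_def)
  have "w = last p0 \<and> p0 \<noteq> []" if w: "R v w" for w
  proof -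
    have "w \<in> set p"
    proof (rule ccontr)
      assume n: "w \<notin> set p"
      have "w \<noteq> A"
      proof
        assume "w = A"
        then have "h = A" using sym w vK by (auto simp: h_def)
        then show False using n p \<open>w = A\<close> by (metis Q_def hd_in_set)
      qed
      then have "w \<in> K" using nb[OF vK w] by simp
      then have "Q (p @ [w])" using p w n by (auto simp: Q_def ipairs_append v_def)
      then show False using mx by fastforce
    qed
    then have "w \<in> set p0" using p0 w irr by auto
    then obtain p1 q where q: "p0 = p1 @ w # q" by (metis split_list)
    \<comment> \<open>A neighbour of \<open>v\<close> further back on the path would close a cycle
      of length at least three.\<close>
    have "q = []"
    proof (rule ccontr)
      assume qn: "q \<noteq> []"
      have all: "R x y" if "(x, y) \<in> set (ipairs (w # q @ [v]))" for x y
      proof -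
        have "(x, y) \<in> set (ipairs (p1 @ w # q @ [v]))"
          using that by (cases "p1 = []") (auto simp: ipairs_append)
        then show ?thesis using p p0 q by (auto simp: Q_def)
      qed
      have "cpairs (w # q @ [v]) = ipairs (w # q @ [v]) @ [(v, w)]" by (simp add: cpairs_conv_ipairs)
      then have "\<forall>(x, y)\<in>set (cpairs (w # q @ [v])). R x y" using all w by auto
      moreover have "distinct (w # q @ [v])" using p p0 q by (simp add: Q_def)
      moreover have "length (w # q @ [v]) \<ge> 3" using qn by (cases q) auto
      ultimately show False using acyc unfolding acyclic_rel_def by blast
    qed
    then show ?thesis using q by simp
  qed
  then show ?thesis using vK by metis
qed

text \<open>The part \<open>vs\<close> is a cyclic interval without \<open>B\<close> that contains
  all occurrences of \<open>D\<close>. The two displayed letters \<open>B\<close> separate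
  \<open>h\<close> from \<open>r\<close>, so \<open>vs\<close> cannot meet both.\<close>

lemma uncrossed_gap:
  assumes r: "rotate n (B # h @ B # r) = us @ vs" "B \<notin> set vs" "D \<notin> set us" and D: "D \<in> set h"
  shows "D \<notin> set r"
proof
  assume Dr: "D \<in> set r"
  obtain x y where xy: "(B # h) @ (B # r) = x @ y" "y @ x = us @ vs"
    using rotate_split[of "B # h @ B # r" n] r(1) by auto
  consider x0 where "x = x0 @ vs" "us = y @ x0" | v1 where "y = us @ v1" "vs = v1 @ x"
    using xy(2) by (auto simp: append_eq_append_conv2)
  then show False
  proof cases
    case 1
    have eq: "(B # h) @ (B # r) = (x0 @ vs) @ y" using xy 1 by simp
    consider z where "x0 @ vs = (B # h) @ z" "B # r = z @ y" | z where "B # h = (x0 @ vs) @ z" "y = z @ B # r"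
      using append_eq_append_conv2[THEN iffD1, OF eq] by metis
    then show False
    proof cases
      case one: 1
      have Bz: "B \<in> set z"
        using one Dr r(3) 1 by (cases z) auto
      from one(1) consider e where "x0 = (B # h) @ e" | e where "vs = e @ z"
        using append_eq_append_conv2[THEN iffD1, OF one(1)] by metis
      then show False using Bz r(2,3) D 1 by cases auto
    next
      case 2
      then show False using r(3) Dr 1 by auto
    qed
  next
    case 2
    then have "x = []" using xy(1) r(2) by (cases x) auto
    then have e: "us @ vs = (B # h) @ (B # r)" using xy 2 by auto
    from e consider e where "us = (B # h) @ e" | e where "vs = e @ B # r"
      using append_eq_append_conv2[THEN iffD1, OF e] by metis
    then show False using r D by cases auto
  qed
qed

lemma alternating_weave:
  assumes "xs \<noteq> []" "set xs \<subseteq> {A, B}" "hd xs = B" "last xs = B" "A \<noteq> B"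
    "\<And>x y. (x, y) \<in> set (ipairs xs) \<Longrightarrow> x \<noteq> y"
  shows "\<exists>k. xs = weave B (replicate k (A, B))"
  using assms
proof (induction xs rule: induct_list012)
  case (2 x)
  then show ?case by (intro exI[of _ 0]) auto
next
  case (3 x y zs)
  note pr = "3.prems"
  have xB: "x = B" using pr(3) by simp
  moreover have "x \<noteq> y" using pr(6)[of x y] by simp
  ultimately have yA: "y = A" using pr(2) by simp
  have "zs \<noteq> []" using pr(4,5) yA by auto
  then obtain z zs' where zs: "zs = z # zs'" by (cases zs) auto
  have "y \<noteq> z" using pr(6)[of y z] zs by simp
  then have "z = B" using pr(2) yA zs by simp
  then have "\<exists>k. zs = weave B (replicate k (A, B))"
  proof (intro "3.IH"(1))
    show "v \<noteq> w" if "(v, w) \<in> set (ipairs zs)" for v w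
      using pr(6)[of v w] that zs by simp
  qed (use pr(2,4,5) zs in auto)
  then obtain k where "zs = weave B (replicate k (A, B))" ..
  then show ?case using xB yA by (intro exI[of _ "Suc k"]) simp
qed simp

lemma set_cpairs_rotate [simp]: "set (cpairs (rotate n xs)) = set (cpairs xs)"
  by (induction n) auto

lemma crossed_rotate [simp]: "crossed (rotate n u) = crossed u"
  by (auto simp: crossed_def fun_eq_iff)

lemma mset_rotate [simp]: "mset (rotate n u) = mset u"
  using rotate_split[of u n] by auto

lemma count_list_rotate [simp]: "count_list (rotate n u) C = count_list u C"
  by (metis count_mset mset_rotate)

lemma tree_word_rotate: "tree_word (rotate n u) \<longleftrightarrow> tree_word u"
  by (simp add: tree_word_def)

text \<open>\<open>B\<close> is a leaf that fits into a shortest interval. A colour other than \<open>A\<close> in a gap of \<open>B\<close>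
  inside this interval would lie in that gap entirely, and so would then another leaf.\<close>
lemma tree_word_pattern:
  assumes tw: "tree_word u" and two: "card (set u) \<ge> 2"
    and proper: "\<And>C D. (C, D) \<in> set (cpairs u) \<Longrightarrow> C \<noteq> D"
  shows "\<exists>n k vs A B. rotate n u = weave B (replicate k (A, B)) @ vs \<and> k > 0 \<and> A \<noteq> B \<and>
     B \<notin> set vs \<and> vs \<noteq> [] \<and> (\<forall>C. crossed u B C \<longrightarrow> C = A)"
proof -
  have acyc: "acyclic_rel (crossed u)" using tw by (simp add: tree_word_def)
  have irr: "\<not> crossed u x x" for x by (simp add: crossed_def)
  define leaf where "leaf v \<longleftrightarrow> v \<in> set u \<and> (\<forall>w w'. crossed u v w \<longrightarrow> crossed u v w' \<longrightarrow> w = w')" for v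
  \<comment> \<open>The lengths of the cyclic intervals that contain every occurrence of some leaf;
    the least one is taken.\<close>
  define M where "M m \<longleftrightarrow> (\<exists>n B us vs. leaf B \<and> rotate n u = us @ vs \<and> B \<notin> set vs \<and> length us = m)" for m
  have "set u \<noteq> {}" using two by auto
  then have "\<exists>v\<in>set u. \<forall>w w'. crossed u v w \<longrightarrow> crossed u v w' \<longrightarrow> w = w'"
  proof (rule acyclic_rel_leaf[rotated])
    show "w \<in> insert undefined (set u)" if "crossed u v w" for v w
      using that by (simp add: crossed_def)
  qed (use acyc irr crossed_sym in auto)
  then obtain B0 where "leaf B0" unfolding leaf_def by blast
  then have "M (length u)"
    unfolding M_def by (intro exI[of _ 0] exI[of _ B0] exI[of _ u] exI[of _ "[]"]) auto
  define m where "m = (LEAST m. M m)"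
  have Mm: "M m" and least: "\<And>m'. M m' \<Longrightarrow> m \<le> m'"
    using \<open>M (length u)\<close> by (auto simp: m_def intro: LeastI Least_le)
  then obtain n B us vs where B: "leaf B" and rot: "rotate n u = us @ vs" and Bvs: "B \<notin> set vs"
    and lus: "length us = m" by (auto simp: M_def)
  have Bu: "B \<in> set u" using B by (simp add: leaf_def)
  have set_u: "set u = set us \<union> set vs" by (metis rot set_append set_rotate)
  have Bus: "B \<in> set us" using Bu set_u Bvs by blast
  then have usne: "us \<noteq> []" by auto
  have shorter: False if "leaf E" "rotate j u = us' @ vs'" "E \<notin> set vs'" "length us' < m" for E j us' vs'
    using least[of "length us'"] that unfolding M_def by force
  have rot2: "\<exists>j. rotate j u = ys @ zs" if "us @ vs = zs @ ys" for ys zs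
    using that rot by (metis rotate_append rotate_rotate)
  have hdB: "hd us = B"
  proof (rule ccontr)
    assume "hd us \<noteq> B"
    then obtain x us' where x: "us = x # us'" "x \<noteq> B" using usne by (cases us) auto
    have "us @ vs = [x] @ (us' @ vs)" using x by simp
    then obtain j where "rotate j u = (us' @ vs) @ [x]" using rot2 by blast
    then have "rotate j u = us' @ (vs @ [x])" by simp
    from shorter[OF B this] show False using x Bvs lus by auto
  qed
  have lastB: "last us = B"
  proof (rule ccontr)
    assume "last us \<noteq> B"
    then obtain x us' where x: "us = us' @ [x]" "x \<noteq> B" using usne by (metis append_butlast_last_id)
    have "rotate n u = us' @ (x # vs)" using rot x by simp
    from shorter[OF B this] show False using x Bvs lus by auto
  qed
  have "{B} \<subset> set u" using Bu two by (metis card.empty card.insert_remove empty_Diff empty_subsetI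
        finite.emptyI insert_subset not_less_eq_eq numeral_2_eq_2 order_refl psubsetI card_1_singleton_iff One_nat_def)
  then obtain A where A: "A \<in> set u" "crossed u B A"
    using tw unfolding tree_word_def by (metis DiffE insert_not_empty singletonD)
  have only: "C = A" if "crossed u B C" for C using B A that by (simp add: leaf_def)
  have AB: "A \<noteq> B" using A by (auto simp: crossed_def)
  have cp: "set (cpairs (us @ vs)) = set (cpairs u)" by (metis rot set_cpairs_rotate)
  have len2: "length us \<ge> 2"
  proof (rule ccontr)
    assume "\<not> ?thesis"
    then have "us = [B]" using usne hdB by (cases us rule: remdups_adj.cases) auto
    then have "count_list (us @ vs) B = 1" using Bvs by simp
    then have "count_list u B = 1" by (metis count_list_rotate rot)
    then show False using tw Bu unfolding tree_word_def by fastforce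
  qed
  have vsne: "vs \<noteq> []"
  proof
    assume "vs = []"
    then have "(B, B) \<in> set (cpairs u)" using cp usne hdB lastB by (simp add: cpairs_conv_ipairs flip: cp)
    then show False using proper by blast
  qed
  have sub: "set us \<subseteq> {A, B}"
  proof (rule ccontr)
    assume "\<not> ?thesis"
    then obtain D where D: "D \<in> set us" "D \<noteq> A" "D \<noteq> B" by blast
    obtain q1 q2 where q: "us = q1 @ D # q2" using D split_list by metis
    have "B \<in> set q1" using hdB q D by (cases q1) auto
    then obtain p1 h1 where h1: "q1 = p1 @ B # h1" "B \<notin> set h1" by (metis split_list_last)
    have "B \<in> set q2" using lastB q D by (cases q2 rule: rev_cases) auto
    then obtain h2 p2 where h2: "q2 = h2 @ B # p2" "B \<notin> set h2" by (metis split_list_first)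
    \<comment> \<open>The gap of \<open>B\<close> around the offending colour \<open>D\<close>;
      \<open>r\<close> is the rest of the cyclic word beyond the two letters \<open>B\<close> that
      bound this gap.\<close>
    define h where "h = h1 @ D # h2"
    define r where "r = p2 @ vs @ p1"
    have "us @ vs = p1 @ (B # h @ B # p2 @ vs)" using q h1 h2 by (simp add: h_def)
    then obtain j where j: "rotate j u = B # h @ B # r"
      using rot2[of p1 "B # h @ B # p2 @ vs"] by (auto simp: r_def)
    have "rotate j u = [B] @ (h @ B # r)" using j by simp
    then obtain j' where j': "rotate j' u = h @ (B # r @ [B])"
      by (metis rotate_append rotate_rotate append.assoc append_Cons)
    have Bh: "B \<notin> set h" using h1 h2 D by (auto simp: h_def)
    have set_u': "set u = insert B (set h \<union> set r)" 
    proof -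
      have "set u = set (rotate j u)" by simp
      then show ?thesis unfolding j by auto
    qed
    have lh: "length h < m" using lus q h1 h2 by (simp add: h_def)
    have gap: "F \<notin> set r" if "F \<in> set h" "F \<noteq> A" for F
    proof -
      have "F \<noteq> B" using that Bh by auto
      then have "uncrossed u B F" using only[of F] that Bu set_u' by (auto simp: crossed_def)
      then have "uncrossed (rotate j u) B F" by simp
      then obtain n' us' vs' where "rotate n' (B # h @ B # r) = us' @ vs'" "B \<notin> set vs'" "F \<notin> set us'"
        unfolding uncrossed_def j by blast
      then show ?thesis by (rule uncrossed_gap) (rule that(1))
    qed
    have sep: "uncrossed u E F" if "E \<notin> set r" "E \<noteq> B" "F \<notin> set h" for E F
      unfolding uncrossed_def by (rule exI[of _ j'], rule exI[of _ h], rule exI[of _ "B # r @ [B]"])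
        (use j' that in simp)
    \<comment> \<open>The colours confined to the gap. By \<open>sep\<close> they cross only colours
      that occur in \<open>h\<close>, hence only \<open>A\<close> or one another, which is the
      closure condition of \<open>acyclic_rel_leaf\<close>. A leaf found in \<open>K\<close> fits
      into \<open>h\<close>, an interval shorter than \<open>us\<close>.\<close>
    define K where "K = {E \<in> set u. E \<in> set h \<and> E \<notin> set r}"
    have KB: "E \<noteq> B" if "E \<in> K" for E using that Bh by (auto simp: K_def)
    have AK: "A \<notin> K"
    proof
      assume "A \<in> K"
      then have "uncrossed u A B" using sep[of A B] AB Bh by (auto simp: K_def)
      then show False using A uncrossed_sym[of u A B] by (simp add: crossed_def)
    qed
    have "\<exists>v\<in>K. \<forall>w w'. crossed u v w \<longrightarrow> crossed u v w' \<longrightarrow> w = w'"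
    proof (rule acyclic_rel_leaf[where A = A])
      show "finite K" by (simp add: K_def)
      have "D \<in> set h" by (simp add: h_def)
      then have "D \<in> K" using gap[of D] D set_u' by (auto simp: K_def)
      then show "K \<noteq> {}" by blast
      fix v w assume vw: "v \<in> K" "crossed u v w"
      have "w \<noteq> B" using only[of v] crossed_sym[OF vw(2)] vw(1) AK by auto
      moreover have "w \<in> set h" using sep[of v w] vw KB by (auto simp: K_def crossed_def)
      ultimately show "w \<in> insert A K" using gap[of w] vw by (auto simp: K_def crossed_def)
    qed (use acyc irr crossed_sym in auto)
    then obtain E where E: "E \<in> K" "leaf E" by (auto simp: leaf_def K_def)
    show False using shorter[OF E(2) j'] E KB[OF E(1)] lh by (auto simp: K_def)
  qed
  have "\<exists>k. us = weave B (replicate k (A, B))"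
  proof (rule alternating_weave)
    fix x y assume "(x, y) \<in> set (ipairs us)"
    then have "(x, y) \<in> set (cpairs (us @ vs))" using usne vsne by (simp add: cpairs_append)
    then show "x \<noteq> y" using cp proper by blast
  qed (use usne sub hdB lastB AB in auto)
  then obtain k where k: "us = weave B (replicate k (A, B))" ..
  have "k > 0" using k len2 by (cases k) auto
  then show ?thesis using k rot AB Bvs vsne only by blast
qed

lemma tree_word_filter:
  assumes tw: "tree_word u" and leaf: "\<And>C. crossed u B C \<Longrightarrow> C = A"
  shows "tree_word (filter (\<lambda>x. x \<noteq> B) u)"
proof -
  let ?u = "filter (\<lambda>x. x \<noteq> B) u"
  have cr: "crossed ?u C D \<longleftrightarrow> crossed u C D \<and> C \<noteq> B \<and> D \<noteq> B" for C D
    by (auto simp: crossed_def uncrossed_filter)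
  have "\<exists>C\<in>S. \<exists>D\<in>set ?u - S. crossed ?u C D" if S: "S \<subset> set ?u" "S \<noteq> {}" for S
  proof -
    \<comment> \<open>\<open>B\<close> is put on the side of its only neighbour \<open>A\<close>, so
      the crossing that leaves \<open>S'\<close> does not involve \<open>B\<close>.\<close>
    define S' where "S' = (if A \<in> S then insert B S \<inter> set u else S)"
    have "S' \<subset> set u" "S' \<noteq> {}" using S by (auto simp: S'_def)
    then obtain C D where CD: "C \<in> S'" "D \<in> set u - S'" "crossed u C D"
      using tw unfolding tree_word_def by meson
    have "C \<noteq> B" using leaf[of D] CD S by (auto simp: S'_def split: if_splits)
    moreover have "D \<noteq> B" using leaf[of C] crossed_sym[OF CD(3)] CD S by (auto simp: S'_def split: if_splits)
    ultimately show ?thesis using CD S by (auto simp: cr S'_def split: if_splits)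
  qed
  moreover have "acyclic_rel (crossed ?u)"
    using tw unfolding tree_word_def acyclic_rel_def cr by fast
  moreover have "count_list ?u C = count_list u C" if "C \<noteq> B" for C
    using that by (induction u) auto
  ultimately show ?thesis using tw unfolding tree_word_def by auto
qed

text \<open>Crossings do not see doubled letters; only the count of \<open>E\<close> drops, and the
  second hypothesis keeps it at least two.\<close>

lemma tree_word_dup:
  assumes "tree_word (E # E # r)" "count_list r E \<ge> 1"
  shows "tree_word (E # r)"
proof -
  have "crossed (E # E # r) = crossed (E # r)"
    by (auto simp: crossed_def uncrossed_dup fun_eq_iff)
  moreover have "set (E # E # r) = set (E # r)" by auto
  ultimately show ?thesis using assms unfolding tree_word_def by auto
qed

lemma map_eq_weave:
  assumes "map f xs = weave B qs"
  shows "\<exists>b ps. xs = weave b ps \<and> f b = B \<and> map (\<lambda>(x, y). (f x, f y)) ps = qs"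
  using assms
proof (induction B qs arbitrary: xs rule: weave.induct)
  case (1 b)
  then obtain x where "xs = [x]" "f x = b" by auto
  then show ?case by (intro exI[of _ x] exI[of _ "[]"]) auto
next
  case (2 b a b' ps)
  then obtain x y ys where xs: "xs = x # y # ys" "f x = b" "f y = a" "map f ys = weave b' ps"
    by (auto simp: map_eq_Cons_conv)
  then obtain z qs where "ys = weave z qs" "f z = b'" "map (\<lambda>(x, y). (f x, f y)) qs = ps"
    using 2(1) by blast
  then show ?case using xs by (intro exI[of _ x] exI[of _ "(y, z) # qs"]) auto
qed

section \<open>The induction on the number of points\<close>

context weighted_colours
begin

lemma class_card: "distinct ws \<Longrightarrow> card {x \<in> set ws. c x = C} = count_list (map c ws) C"
proof (induction ws)
  case (Cons a ws)
  have "{x \<in> set (a # ws). c x = C} = (if c a = C then insert a {x \<in> set ws. c x = C} else {x \<in> set ws. c x = C})"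
    by auto
  then show ?case using Cons by auto
qed simp

text \<open>The abstract counterpart of the sum of the bridge lengths.\<close>

definition lam_sum :: "'p set \<Rightarrow> int" where
  "lam_sum X = (\<Sum>C\<in>c ` X. lam {x \<in> X. c x = C})"

lemma lam_sum_remove_class:
  assumes "finite X" "Y = X - {x \<in> X. c x = B}" "B \<in> c ` X"
  shows "lam_sum X = lam_sum Y + lam {x \<in> X. c x = B}"
proof -
  have im: "c ` X = insert B (c ` Y)" "B \<notin> c ` Y" using assms by auto
  have "lam_sum X = lam {x \<in> X. c x = B} + (\<Sum>C\<in>c ` Y. lam {x \<in> X. c x = C})"
    unfolding lam_sum_def im(1) using im(2) assms by simp
  also have "(\<Sum>C\<in>c ` Y. lam {x \<in> X. c x = C}) = lam_sum Y"
    unfolding lam_sum_def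
    by (intro sum.cong refl arg_cong[where f = lam]) (use im assms in auto)
  finally show ?thesis by simp
qed

theorem ring_lower_bound:
  assumes "ring_ok ws l" "tree_word (map c ws)" "ws \<noteq> []"
  shows "2 * lam_sum (set ws) \<le> sum l (set ws)"
  using assms
proof (induction "length ws" arbitrary: ws l rule: less_induct)
  case less
  define u where "u = map c ws"
  have d: "distinct ws" using less.prems by (simp add: ring_ok_def)
  have tw: "tree_word u" using less.prems by (simp add: u_def)
  show ?case
  proof (cases "\<exists>(C, D)\<in>set (cpairs u). C = D")
    case True
    have "cpairs u = map (\<lambda>(p, q). (c p, c q)) (cpairs ws)"
      by (simp add: u_def cpairs_def rotate1_map zip_map_map)
    then obtain p q where pq: "arc ws p q" "c p = c q" using True by (auto simp: arc_def)
    have two: "length ws \<ge> 2"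
    proof -
      have "2 \<le> count_list u (c p)" using tw arc_in_set[OF pq(1)] by (auto simp: tree_word_def u_def)
      also have "\<dots> \<le> length ws" using count_le_length[of u] by (simp add: u_def)
      finally show ?thesis .
    qed
    have "p \<noteq> q" using arc_irrefl[OF d two] pq by blast
    obtain n where n: "hd (rotate n ws) = p"
    proof -
      obtain xs ys where "ws = xs @ p # ys" using arc_in_set[OF pq(1)] by (metis split_list)
      then have "hd (rotate (length xs) ws) = p" by (simp add: rotate_append)
      then show ?thesis using that by blast
    qed
    define ws0 where "ws0 = rotate n ws"
    have arc0: "arc ws0 = arc ws" by (auto simp: ws0_def arc_def fun_eq_iff)
    have ws0: "set ws0 = set ws" "length ws0 = length ws" "distinct ws0"
      using d by (auto simp: ws0_def)
    have ok0: "ring_ok ws0 l" using less.prems(1) ring_ok_arc_cong[of ws0 ws l] arc0 ws0 d by simp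
    have tw0: "tree_word (map c ws0)" using tw tree_word_rotate[of n u] by (simp add: ws0_def u_def rotate_map)
    obtain r where r: "ws0 = p # r" using n two by (cases ws0) (auto simp: ws0_def)
    have "r \<noteq> []" using two ws0 r by auto
    then have "hd r = q" using arc_Cons_iff(1)[of p r q] ws0 r arc0 pq by auto
    then obtain outs where w0: "ws0 = p # q # outs" using r \<open>r \<noteq> []\<close> by (cases r) auto
    define S where "S = {x \<in> set ws0. c x = c p}"
    have cS: "card S = count_list (map c ws0) (c p)" unfolding S_def by (rule class_card[OF ws0(3)])
    show ?thesis
    proof (cases "card S \<ge> 3")
      case True
      then have cnt: "count_list (map c outs) (c p) \<ge> 1" using cS w0 pq by simp
      then have on: "outs \<noteq> []" by auto
      define l' where "l' = l(p := l p + l q - 2 * (lam S - lam (S - {q})))"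
      have "ring_ok (p # outs) l'"
        unfolding l'_def using ring_ok_delete[of p q outs l S] ok0 w0 pq on True by (simp add: S_def)
      moreover have "tree_word (map c (p # outs))"
        using tree_word_dup[of "c p" "map c outs"] tw0 w0 pq cnt by simp
      ultimately have ih: "2 * lam_sum (set (p # outs)) \<le> sum l' (set (p # outs))"
        using less.hyps[of "p # outs" l'] ws0 w0 by simp
      have dd: "distinct (p # q # outs)" using ws0 w0 by simp
      have "sum l' (set outs) = sum l (set outs)"
        using dd by (intro sum.cong) (auto simp: l'_def)
      then have s: "sum l' (set (p # outs)) = sum l (set ws0) - 2 * (lam S - lam (S - {q}))"
        using dd w0 by (simp add: l'_def)
      have "lam_sum (set ws0) = lam_sum (set ws0 - S) + lam S"
        unfolding S_def by (rule lam_sum_remove_class) (auto simp: w0)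
      moreover have "lam_sum (set (p # outs)) = lam_sum (set ws0 - S) + lam (S - {q})"
      proof -
        have 1: "{x \<in> set (p # outs). c x = c p} = S - {q}"
          using dd w0 by (auto simp: S_def)
        have 2: "set ws0 - S = set (p # outs) - {x \<in> set (p # outs). c x = c p}"
          using dd w0 pq by (auto simp: S_def)
        show ?thesis
          using lam_sum_remove_class[of "set (p # outs)" _ "c p", OF _ 2] unfolding 1 by auto
      qed
      ultimately show ?thesis using ih s ws0 by simp
    next
      case False
      \<comment> \<open>The colour of \<open>p\<close> now occurs at \<open>p\<close> and
        \<open>q\<close> only. As these are consecutive, it crosses no other colour, so by
        connectedness the ring is just \<open>p\<close>, \<open>q\<close>, and each of its two arcs
        is at least \<open>lam {p, q}\<close> long.\<close>
      have zero: "c p \<notin> c ` set outs"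
      proof -
        have "count_list (map c outs) (c p) = 0" using False cS w0 pq by simp
        then show ?thesis by (simp add: count_list_0_iff)
      qed
      have "outs = []"
      proof (rule ccontr)
        assume on: "outs \<noteq> []"
        have "{c p} \<subset> set (map c ws0)" using w0 on zero pq by (cases outs) auto
        then obtain D where D: "D \<in> set (map c ws0) - {c p}" "crossed (map c ws0) (c p) D"
          using tw0 unfolding tree_word_def by (metis insert_not_empty singletonD)
        have "uncrossed (map c ws0) (c p) D"
          unfolding uncrossed_def
          by (intro exI[of _ 0] exI[of _ "[c p, c p]"] exI[of _ "map c outs"])
            (use D zero w0 pq in auto)
        then show False using D by (simp add: crossed_def)
      qed
      then have w: "ws0 = [p, q]" using w0 by simp
      have "arc ws0 p q" "arc ws0 q p" by (auto simp: w arc_def cpairs_def)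
      then have "lam {p, q} \<le> l p" "lam {q, p} \<le> l q"
        using ok0 pq \<open>p \<noteq> q\<close> unfolding ring_ok_def by metis+
      moreover have "lam_sum (set ws0) = lam {p, q}"
      proof -
        have "{x \<in> {p, q}. c x = c q} = {p, q}" "c ` {p, q} = {c q}" using pq by auto
        then show ?thesis by (simp only: lam_sum_def w list.set sum.insert) simp
      qed
      ultimately show ?thesis using ws0(1) w \<open>p \<noteq> q\<close> by (simp add: insert_commute flip: ws0(1))
    qed
  next
    case False
    then have proper: "\<And>C D. (C, D) \<in> set (cpairs u) \<Longrightarrow> C \<noteq> D" by auto
    have une: "u \<noteq> []" using less.prems by (simp add: u_def)
    have two: "card (set u) \<ge> 2"
    proof (rule ccontr)
      assume n: "\<not> ?thesis"
      have "card (set u) \<noteq> 0" using une by simp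
      then have "card (set u) = 1" using n by linarith
      then obtain C where C: "set u = {C}" by (auto simp: card_1_singleton_iff)
      have "(last u, hd u) \<in> set (cpairs u)" using une by (simp add: cpairs_conv_ipairs)
      moreover have "last u = C" "hd u = C" using C une last_in_set hd_in_set by blast+
      ultimately show False using proper[of C C] by simp
    qed
    obtain n k vs A B where pat: "rotate n u = weave B (replicate k (A, B)) @ vs" "k > 0" "A \<noteq> B"
      "B \<notin> set vs" "vs \<noteq> []" "\<And>C. crossed u B C \<Longrightarrow> C = A"
      using tree_word_pattern[OF tw two proper] by blast
    define ws0 where "ws0 = rotate n ws"
    have arc0: "arc ws0 = arc ws" by (auto simp: ws0_def arc_def fun_eq_iff)
    have ws0: "set ws0 = set ws" "length ws0 = length ws" "distinct ws0"
      using d by (auto simp: ws0_def)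
    have ok0: "ring_ok ws0 l" using less.prems(1) ring_ok_arc_cong[of ws0 ws l] arc0 ws0 d by simp
    have u0: "map c ws0 = rotate n u" by (simp add: ws0_def u_def rotate_map)
    obtain seg outs where so: "ws0 = seg @ outs" "map c seg = weave B (replicate k (A, B))" "map c outs = vs"
      using u0 pat(1) by (auto simp: map_eq_append_conv)
    obtain b ps where bp: "seg = weave b ps" "c b = B" "map (\<lambda>(x, y). (c x, c y)) ps = replicate k (A, B)"
      using map_eq_weave[OF so(2)] by blast
    have psk: "length ps = k" using bp(3) by (metis length_map length_replicate)
    then have psne: "ps \<noteq> []" using pat by auto
    have cps: "c a = A \<and> c b' = B" if "(a, b') \<in> set ps" for a b'
    proof -
      have "(c a, c b') \<in> set (map (\<lambda>(x, y). (c x, c y)) ps)" using that by force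
      then show ?thesis using bp(3) by auto
    qed
    have on: "outs \<noteq> []" using so pat by auto
    have colB: "c x \<noteq> B" if "x \<in> set outs" for x using that so(3) pat(4) by auto
    define as where "as = map fst ps"
    define bs where "bs = b # map snd ps"
    have prop0: "c p \<noteq> c q" if "arc (weave b ps @ outs) p q" for p q
    proof -
      have "cpairs u = map (\<lambda>(p, q). (c p, c q)) (cpairs ws)"
        by (simp add: u_def cpairs_def rotate1_map zip_map_map)
      moreover have "arc ws p q" using that arc0 so bp by simp
      ultimately show ?thesis using proper by (force simp: arc_def)
    qed
    obtain l1 l2 where l12: "ring_ok (as @ outs) l1" "ring_ok (rev as @ outs) l2"
      "sum l1 (set (as @ outs)) + sum l2 (set (as @ outs)) =
        2 * sum l (set ws0) - 2 * cyc_len bs"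
      using ring_ok_eliminate[of b ps outs l B A] ok0 so(1) bp psne on prop0 cps pat(3) colB
      by (auto simp: as_def bs_def)
    have mas: "map c as = replicate k A"
      using cps psk by (auto simp: as_def intro!: nth_equalityI) (metis nth_mem prod.collapse)
    have word: "map c (as @ outs) = filter (\<lambda>x. x \<noteq> B) (rotate n u)"
    proof -
      have "filter (\<lambda>x. x \<noteq> B) (weave B (replicate k (A, B))) = replicate k A" for k
        using pat(3) by (induction k) auto
      moreover have "filter (\<lambda>x. x \<noteq> B) vs = vs" using pat(4) by (auto simp: filter_id_conv)
      ultimately show ?thesis using mas so(3) pat(1) by simp
    qed
    have "tree_word (filter (\<lambda>x. x \<noteq> B) (rotate n u))"
      by (rule tree_word_filter[where A = A]) (use tw tree_word_rotate pat(6) in auto)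
    then have t1: "tree_word (map c (as @ outs))" using word by simp
    then have t2: "tree_word (map c (rev as @ outs))" using mas by (simp add: rev_map[symmetric])
    have ln: "length (as @ outs) < length ws"
    proof -
      have "size (mset seg) = length as + length bs" unfolding bp(1) mset_weave by (simp add: as_def bs_def)
      then show ?thesis using ws0 so(1) by (simp add: bs_def)
    qed
    \<comment> \<open>Both new rings have the same point set, hence the same tree sum. Adding the
      two bounds and halving leaves the closed walk \<open>cyc_len bs\<close> to pay for the tree of
      \<open>B\<close>.\<close>
    have i1: "2 * lam_sum (set (as @ outs)) \<le> sum l1 (set (as @ outs))"
      using less.hyps[OF ln l12(1) t1] on by simp
    have i2: "2 * lam_sum (set (as @ outs)) \<le> sum l2 (set (as @ outs))"
      using less.hyps[of "rev as @ outs", OF _ l12(2) t2] ln on by simp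
    have setseg: "set seg = set as \<union> set bs" unfolding bp(1) by (auto simp: set_weave as_def bs_def)
    have cas: "c x = A" if "x \<in> set as" for x using that cps by (auto simp: as_def)
    have cbs: "c x = B" if "x \<in> set bs" for x using that cps bp(2) by (auto simp: bs_def)
    have cls: "{x \<in> set ws0. c x = B} = set bs"
      using so(1) setseg cas cbs colB pat(3) by auto
    have "lam_sum (set ws0) = lam_sum (set (as @ outs)) + lam (set bs)"
      unfolding cls[symmetric]
    proof (rule lam_sum_remove_class)
      show "set (as @ outs) = set ws0 - {x \<in> set ws0. c x = B}"
        using so(1) setseg cas cbs colB pat(3) by auto
      show "B \<in> c ` set ws0" using cls bs_def by force
    qed simp
    moreover have "2 * lam (set bs) \<le> cyc_len bs"
    proof (rule cyc_len_lower)
      have "mset seg = mset as + mset bs" unfolding bp(1) mset_weave by (simp add: as_def bs_def)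
      then have "mset (as @ bs) = mset seg" by simp
      moreover have "distinct seg" using ws0 so by simp
      ultimately have "distinct (as @ bs)" by (metis mset_eq_imp_distinct_iff)
      then show "distinct bs" by simp
      show "2 \<le> length bs" using psne by (cases ps) (auto simp: bs_def)
    qed (rule cbs)
    ultimately show ?thesis using i1 i2 l12(3) ws0(1) by simp
  qed
qed

end

section \<open>Trees\<close>

definition link :: "'a set set \<Rightarrow> ('a \<times> 'a) set" where
  "link E = {(x, y). {x, y} \<in> E}"

lemma link_sym: "sym ((link E)\<^sup>*)"
  by (rule sym_rtrancl) (auto simp: link_def sym_def insert_commute)

lemma link_rtrancl_sym: "(x, y) \<in> (link E)\<^sup>* \<Longrightarrow> (y, x) \<in> (link E)\<^sup>*"
  using link_sym by (rule symD)

lemma link_mono: "E \<subseteq> E' \<Longrightarrow> (link E)\<^sup>* \<subseteq> (link E')\<^sup>*"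
  by (rule rtrancl_mono) (auto simp: link_def)

definition gpath :: "'a set set \<Rightarrow> 'a list \<Rightarrow> bool" where
  "gpath E xs \<longleftrightarrow> xs \<noteq> [] \<and> distinct xs \<and> (\<forall>(x, y)\<in>set (ipairs xs). {x, y} \<in> E)"

text \<open>The path is extended along the walk and cut back whenever the walk returns to
  it.\<close>

lemma gpath_exists:
  assumes "(u, v) \<in> (link E)\<^sup>*"
  shows "\<exists>xs. gpath E xs \<and> hd xs = u \<and> last xs = v"
  using assms
proof (induction rule: rtrancl_induct)
  case base
  show ?case by (intro exI[of _ "[u]"]) (simp add: gpath_def)
next
  case (step y z)
  then obtain xs where xs: "gpath E xs" "hd xs = u" "last xs = y" by blast
  show ?case
  proof (cases "z \<in> set xs")
    case True
    then obtain as bs where ab: "xs = as @ z # bs" by (metis split_list)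
    have "gpath E (as @ [z])"
      using xs(1) unfolding gpath_def ab by (cases "as = []") (auto simp: ipairs_append)
    moreover have "hd (as @ [z]) = u" using xs(2) ab by (cases as) auto
    ultimately show ?thesis by (intro exI[of _ "as @ [z]"]) auto
  next
    case False
    then have "gpath E (xs @ [z])"
      using xs step(2) by (auto simp: gpath_def ipairs_append link_def)
    moreover have "hd (xs @ [z]) = u" using xs by (simp add: gpath_def)
    ultimately show ?thesis by (intro exI[of _ "xs @ [z]"]) auto
  qed
qed

lemma gpath_link: "gpath E xs \<Longrightarrow> (hd xs, last xs) \<in> (link E)\<^sup>*"
proof (induction xs rule: induct_list012)
  case (3 x y zs)
  then have "gpath E (y # zs)" "(x, y) \<in> link E" by (auto simp: gpath_def link_def)
  then show ?case using 3 by (auto intro: converse_rtrancl_into_rtrancl)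
qed (auto simp: gpath_def)

lemma doubleton_edge: "card e = 2 \<Longrightarrow> u \<in> e \<Longrightarrow> \<exists>v. v \<noteq> u \<and> e = {u, v}"
  by (metis card_2_iff insert_commute insertE singletonD)

definition cycle_graph :: "'a list \<Rightarrow> 'a ugraph" where
  "cycle_graph cs = Graph (set cs) ((\<lambda>(x, y). {x, y}) ` set (cpairs cs))"

lemma nth_rotate1: "i < length xs \<Longrightarrow> rotate1 xs ! i = xs ! (Suc i mod length xs)"
  using nth_rotate[of i xs 1] by simp

lemma is_cycle_conv: "is_cycle C \<longleftrightarrow> (\<exists>cs. length cs \<ge> 3 \<and> distinct cs \<and> C = cycle_graph cs)"
proof -
  have "(\<lambda>(x, y). {x, y}) ` set (cpairs vs) = {{vs ! i, vs ! (Suc i mod length vs)} | i. i < length vs}"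
    for vs :: "'a list"
  proof -
    have "set (cpairs vs) = {(vs ! i, vs ! (Suc i mod length vs)) | i. i < length vs}"
      by (auto simp: cpairs_def set_zip nth_rotate1)
    then show ?thesis by auto
  qed
  then show ?thesis unfolding is_cycle_def cycle_graph_def by simp
qed

lemma inj_on_edge:
  assumes "distinct zs" "length zs \<ge> 3"
  shows "inj_on (\<lambda>(x, y). {x, y}) (set (cpairs zs))"
proof (rule inj_onI, clarify)
  fix a b a' b' assume "(a, b) \<in> set (cpairs zs)" "(a', b') \<in> set (cpairs zs)" "{a, b} = {a', b'}"
  then show "a = a' \<and> b = b'"
    using arc_antisym[OF assms, of a b] by (auto simp: doubleton_eq_iff arc_def)
qed

lemma distinct_cpairs: "distinct xs \<Longrightarrow> distinct (cpairs xs)"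
  using distinct_zipI1 unfolding cpairs_def by fastforce

lemma card_edges_cycle_graph:
  assumes "distinct cs" "length cs \<ge> 3"
  shows "card (edges (cycle_graph cs)) = length cs"
  using inj_on_edge[OF assms] distinct_card[OF distinct_cpairs[OF assms(1)]]
  by (simp add: cycle_graph_def card_image)

lemma cycle_graph_subgraph:
  assumes "distinct cs" "length cs \<ge> 3" "\<And>x y. (x, y) \<in> set (cpairs cs) \<Longrightarrow> {x, y} \<in> edges G"
    "set cs \<subseteq> verts G"
  shows "is_cycle (cycle_graph cs) \<and> subgraph (cycle_graph cs) G"
proof -
  have "card {x, y} = 2 \<and> {x, y} \<subseteq> set cs" if "(x, y) \<in> set (cpairs cs)" for x y
    using that arc_irrefl[of cs x] assms cpairs_in_set[OF that] by (auto simp: arc_def card_2_iff)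
  then have "simple_graph (cycle_graph cs)" by (force simp: simple_graph_def cycle_graph_def)
  then show ?thesis
    using assms by (auto simp: is_cycle_conv subgraph_def cycle_graph_def)
qed

text \<open>The form in which the absence of cycles is used, both for the trees in the bridges and
  for the overlap tree.\<close>

lemma tree_acyclic_rel:
  assumes "is_tree T" shows "acyclic_rel (\<lambda>x y. {x, y} \<in> edges T)"
  unfolding acyclic_rel_def
proof
  assume "\<exists>cs. 3 \<le> length cs \<and> distinct cs \<and> (\<forall>(x, y)\<in>set (cpairs cs). {x, y} \<in> edges T)"
  then obtain cs where cs: "3 \<le> length cs" "distinct cs"
    "\<And>x y. (x, y) \<in> set (cpairs cs) \<Longrightarrow> {x, y} \<in> edges T" by auto
  have "set cs \<subseteq> verts T"
  proof
    fix x assume "x \<in> set cs"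
    then have "x \<in> fst ` set (cpairs cs)" by (metis map_fst_cpairs set_map)
    then show "x \<in> verts T" using cs(3) assms by (force simp: is_tree_def simple_graph_def)
  qed
  then show False using cycle_graph_subgraph[OF cs(2,1,3)] assms by (auto simp: is_tree_def)
qed

definition separates :: "'a set set \<Rightarrow> 'a set \<Rightarrow> 'a set \<Rightarrow> bool" where
  "separates F e S \<longleftrightarrow> (\<exists>x\<in>S. \<exists>y\<in>S. (x, y) \<notin> (link (F - {e}))\<^sup>*)"

text \<open>For the edge set of a tree this is the number of edges of the subtree spanned by \<open>S\<close>.\<close>
definition span_len :: "'a set set \<Rightarrow> 'a set \<Rightarrow> int" where
  "span_len F S = (\<Sum>e\<in>F. of_bool (separates F e S))"

text \<open>The inequality holds for each edge \<open>e\<close> separately. If \<open>e\<close>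
  separates \<open>S\<close> but not \<open>S - {q}\<close>, it cuts \<open>q\<close> off from all
  other points, so it counts for \<open>{p, q}\<close> and \<open>{q, r}\<close> but not for
  \<open>{p, r}\<close>. Otherwise only transitivity of being connected without \<open>e\<close> is
  needed.\<close>

lemma span_len_delete:
  assumes "p \<in> S" "q \<in> S" "r \<in> S" "p \<noteq> q" "r \<noteq> q"
  shows "2 * (span_len F S - span_len F (S - {q})) + span_len F {p, r} \<le> span_len F {p, q} + span_len F {q, r}"
proof -
  have "2 * (of_bool (separates F e S) - of_bool (separates F e (S - {q}))) + of_bool (separates F e {p, r})
      \<le> of_bool (separates F e {p, q}) + (of_bool (separates F e {q, r}) :: int)" for e
  proof -
    define R where "R = (link (F - {e}))\<^sup>*"
    have refl: "(x, x) \<in> R" and sym: "(x, y) \<in> R \<Longrightarrow> (y, x) \<in> R"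
      and trans: "(x, y) \<in> R \<Longrightarrow> (y, z) \<in> R \<Longrightarrow> (x, z) \<in> R" for x y z
      unfolding R_def by (auto intro: link_rtrancl_sym)
    have pair: "separates F e {x, y} \<longleftrightarrow> (x, y) \<notin> R" for x y
      using refl sym by (auto simp: separates_def R_def)
    have sub: "separates F e (S - {q}) \<Longrightarrow> separates F e S" by (auto simp: separates_def)
    show ?thesis
    proof (cases "separates F e S \<and> \<not> separates F e (S - {q})")
      case True
      have all: "(x, y) \<in> R" if "x \<in> S - {q}" "y \<in> S - {q}" for x y
        using True that by (auto simp: separates_def R_def)
      obtain x y where xy: "x \<in> S" "y \<in> S" "(x, y) \<notin> R" using True by (auto simp: separates_def R_def)
      obtain z where z: "z \<in> S - {q}" "(q, z) \<notin> R"
        using xy all sym refl by (metis insert_Diff insert_iff assms(2))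
      have "(p, q) \<notin> R" "(q, r) \<notin> R" using z all[of p z] all[of r z] assms sym trans by blast+
      moreover have "(p, r) \<in> R" using all assms by auto
      ultimately show ?thesis using True by (simp add: pair)
    next
      case False
      then have "separates F e S = separates F e (S - {q})" using sub by blast
      moreover have "(p, r) \<in> R" if "(p, q) \<in> R" "(q, r) \<in> R" using that trans by blast
      ultimately show ?thesis by (auto simp: pair)
    qed
  qed
  then have "(\<Sum>e\<in>F. 2 * (of_bool (separates F e S) - of_bool (separates F e (S - {q}))) + of_bool (separates F e {p, r}))
     \<le> (\<Sum>e\<in>F. of_bool (separates F e {p, q}) + (of_bool (separates F e {q, r}) :: int))"
    by (rule sum_mono)
  then show ?thesis
    unfolding span_len_def by (simp add: sum.distrib sum_subtractf sum_distrib_left)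
qed

text \<open>Every edge that separates \<open>p\<close> from \<open>q\<close> lies on every path
  between them.\<close>

lemma span_len_path:
  assumes "gpath F xs" "hd xs = p" "last xs = q" "finite F"
  shows "span_len F {p, q} \<le> int (length xs) - 1"
proof -
  let ?P = "(\<lambda>(x, y). {x, y}) ` set (ipairs xs)"
  have sub: "{e \<in> F. separates F e {p, q}} \<subseteq> ?P"
  proof
    fix e assume e: "e \<in> {e \<in> F. separates F e {p, q}}"
    show "e \<in> ?P"
    proof (rule ccontr)
      assume n: "e \<notin> ?P"
      have "{x, y} \<in> F - {e}" if "(x, y) \<in> set (ipairs xs)" for x y
        using that n assms by (force simp: gpath_def)
      then have "gpath (F - {e}) xs" using assms by (auto simp: gpath_def)
      then have "(p, q) \<in> (link (F - {e}))\<^sup>*" using gpath_link assms by blast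
      then show False using e link_rtrancl_sym by (fastforce simp: separates_def)
    qed
  qed
  have "card {e \<in> F. separates F e {p, q}} \<le> card ?P" by (rule card_mono[OF _ sub]) simp
  also have "\<dots> \<le> card (set (ipairs xs))" by (rule card_image_le) simp
  also have "\<dots> \<le> length (ipairs xs)" by (rule card_length)
  also have "length (ipairs xs) = length xs - 1" by (simp add: ipairs_def)
  finally have "card {e \<in> F. separates F e {p, q}} \<le> length xs - 1" .
  moreover have "xs \<noteq> []" using assms by (simp add: gpath_def)
  ultimately show ?thesis
    using assms(4) by (cases xs) (auto simp: span_len_def of_bool_def sum.If_cases Int_def)
qed

text \<open>Another path between \<open>u\<close> and \<open>v\<close> would form a cycle together
  with the edge.\<close>

lemma tree_edge_disconnects:
  assumes T: "is_tree T" and e: "{u, v} \<in> edges T" "u \<noteq> v"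
  shows "(u, v) \<notin> (link (edges T - {{u, v}}))\<^sup>*"
proof
  assume r: "(u, v) \<in> (link (edges T - {{u, v}}))\<^sup>*"
  obtain xs where xs: "gpath (edges T - {{u, v}}) xs" "hd xs = u" "last xs = v"
    using gpath_exists[OF r] by blast
  have ne: "xs \<noteq> []" "distinct xs" using xs by (auto simp: gpath_def)
  have "length xs \<ge> 3"
  proof (rule ccontr)
    assume "\<not> ?thesis"
    moreover have "length xs \<noteq> 0" using ne by simp
    ultimately have "length xs = 1 \<or> length xs = 2" by linarith
    then consider a where "xs = [a]" | a b where "xs = [a, b]"
      by (auto simp: length_Suc_conv numeral_2_eq_2)
    then show False using xs e by cases (auto simp: gpath_def)
  qed
  moreover have "\<forall>(x, y)\<in>set (cpairs xs). {x, y} \<in> edges T"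
    using xs e ne by (auto simp: gpath_def cpairs_conv_ipairs insert_commute)
  ultimately show False using tree_acyclic_rel[OF T] ne unfolding acyclic_rel_def by blast
qed

text \<open>\<open>acyclic_rel_leaf\<close> is applied to the side \<open>K\<close> of
  \<open>v\<close>, with \<open>u\<close> as the only vertex reachable outside. The vertex found has
  at most one neighbour; it has one because \<open>K\<close> is connected and \<open>v\<close> is
  joined to \<open>u\<close>.\<close>

lemma tree_leaf_beyond:
  assumes T: "is_tree T" and e: "{u, v} \<in> edges T" "u \<noteq> v"
  shows "\<exists>a\<in>leaves T. (v, a) \<in> (link (edges T - {{u, v}}))\<^sup>*"
proof -
  define E where "E = edges T - {{u, v}}"
  define K where "K = {w. (v, w) \<in> (link E)\<^sup>*}"
  have sg: "simple_graph T" using T by (simp add: is_tree_def)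
  have inV: "x \<in> verts T \<and> y \<in> verts T \<and> x \<noteq> y" if "{x, y} \<in> edges T" for x y
    using that sg by (fastforce simp: simple_graph_def)
  have vK: "v \<in> K" by (simp add: K_def)
  have uK: "u \<notin> K"
    using tree_edge_disconnects[OF T e] link_rtrancl_sym[of v u] by (auto simp: K_def E_def)
  have "w \<in> verts T" if "(v, w) \<in> (link E)\<^sup>*" for w
    using that by (induction rule: rtrancl_induct) (use e inV in \<open>auto simp: link_def E_def\<close>)
  then have KV: "K \<subseteq> verts T" by (auto simp: K_def)
  have "\<exists>z\<in>K. \<forall>w w'. {z, w} \<in> edges T \<longrightarrow> {z, w'} \<in> edges T \<longrightarrow> w = w'"
  proof (rule acyclic_rel_leaf[where A = u])
    show "finite K" using KV sg finite_subset by (auto simp: simple_graph_def)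
    show "K \<noteq> {}" using vK by blast
    show "acyclic_rel (\<lambda>x y. {x, y} \<in> edges T)" by (rule tree_acyclic_rel[OF T])
    show "{x, x} \<notin> edges T" for x using inV by blast
    fix z w assume z: "z \<in> K" "{z, w} \<in> edges T"
    show "w \<in> insert u K"
    proof (cases "{z, w} = {u, v}")
      case True
      then show ?thesis using z uK vK by (auto simp: doubleton_eq_iff)
    next
      case False
      then have "(z, w) \<in> link E" using z by (simp add: link_def E_def)
      then show ?thesis using z by (auto simp: K_def intro: rtrancl_into_rtrancl)
    qed
  qed (simp add: insert_commute)
  then obtain z where z: "z \<in> K" and uniq: "\<And>w w'. {z, w} \<in> edges T \<Longrightarrow> {z, w'} \<in> edges T \<Longrightarrow> w = w'"
    by blast
  have "\<exists>w. {z, w} \<in> edges T"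
  proof (cases "z = v")
    case True then show ?thesis using e by (auto simp: insert_commute)
  next
    case False
    then have "(v, z) \<in> (link E)\<^sup>+" using z by (auto simp: K_def rtrancl_eq_or_trancl)
    then obtain y where "(y, z) \<in> link E" by (metis tranclD2)
    then show ?thesis by (auto simp: link_def E_def insert_commute)
  qed
  then obtain w where w: "{z, w} \<in> edges T" ..
  have "{e \<in> edges T. z \<in> e} = {{z, w}}"
  proof -
    have "e = {z, w}" if ez: "e \<in> edges T" "z \<in> e" for e
    proof -
      have "card e = 2" using ez sg by (simp add: simple_graph_def)
      then obtain y where y: "e = {z, y}" using doubleton_edge[of e z] ez by blast
      then have "y = w" using uniq[of y w] w ez by simp
      then show ?thesis using y by simp
    qed
    moreover have "{z, w} \<in> {e \<in> edges T. z \<in> e}" using w by simp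
    ultimately show ?thesis by blast
  qed
  then have "card {e \<in> edges T. z \<in> e} = 1" by simp
  then have "z \<in> leaves T" using z KV unfolding leaves_def degree_def by blast
  then show ?thesis using z by (auto simp: K_def E_def)
qed

text \<open>Each edge has a leaf on either side, so every edge is counted.\<close>

lemma span_len_leaves:
  assumes T: "is_tree T" shows "span_len (edges T) (leaves T) = int (card (edges T))"
proof -
  have "separates (edges T) e (leaves T)" if e: "e \<in> edges T" for e
  proof -
    obtain u v where uv: "e = {u, v}" "u \<noteq> v"
      using e T by (auto simp: is_tree_def simple_graph_def card_2_iff)
    obtain a where a: "a \<in> leaves T" "(v, a) \<in> (link (edges T - {e}))\<^sup>*"
      using tree_leaf_beyond[OF T, of u v] e uv by blast
    obtain a' where a': "a' \<in> leaves T" "(u, a') \<in> (link (edges T - {e}))\<^sup>*"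
      using tree_leaf_beyond[OF T, of v u] e uv by (metis insert_commute)
    have "(a', a) \<notin> (link (edges T - {e}))\<^sup>*"
      using tree_edge_disconnects[OF T, of u v] e uv a a' link_rtrancl_sym rtrancl_trans by metis
    then show ?thesis using a a' by (auto simp: separates_def)
  qed
  then show ?thesis by (simp add: span_len_def)
qed

section \<open>Bridges\<close>

text \<open>A minimal set of edges with this property is a tree with leaf set \<open>N\<close>.\<close>
definition pendant_connected :: "'a set set \<Rightarrow> 'a set \<Rightarrow> bool" where
  "pendant_connected F N \<longleftrightarrow> N \<subseteq> \<Union>F \<and> (\<forall>x\<in>\<Union>F. \<forall>y\<in>\<Union>F. (x, y) \<in> (link F)\<^sup>*) \<and>
     (\<forall>x\<in>N. card {e \<in> F. x \<in> e} = 1)"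

text \<open>The rest of the cycle preserves connectedness. Both ends of the removed edge have degree
  at least two, so neither belongs to \<open>N\<close>.\<close>

lemma pendant_connected_remove_cycle_edge:
  assumes F: "pendant_connected F N" and fin: "finite F"
    and cs: "length cs \<ge> 3" "distinct cs" "\<And>x y. (x, y) \<in> set (cpairs cs) \<Longrightarrow> {x, y} \<in> F"
  shows "\<exists>e\<in>F. pendant_connected (F - {e}) N"
proof -
  obtain a r where ar: "cs = a # r" using cs by (cases cs) auto
  obtain b r' where r: "r = b # r'" "r' \<noteq> []" using cs ar by (cases r; cases "tl r") auto
  define e where "e = {a, b}"
  have cp: "cpairs cs = (a, b) # ipairs (b # r') @ [(last r', a)]"
    using r ar by (simp add: cpairs_conv_ipairs)
  have eF: "e \<in> F" using cs(3)[of a b] cp by (simp add: e_def)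
  have dist: "a \<noteq> b" "a \<notin> set r'" "b \<notin> set r'" "distinct r'" using cs ar r by auto
  have lr: "last r' \<in> set r'" using r by simp
  have inner: "{x, y} \<in> F - {e}" if "(x, y) \<in> set (ipairs (b # r'))" for x y
  proof -
    have "x \<noteq> a" "y \<noteq> a" using ipairs_in_set[OF that] dist by (auto dest: in_set_butlastD split: if_splits)
    then show ?thesis using that cs(3)[of x y] cp by (auto simp: e_def doubleton_eq_iff)
  qed
  have la: "{last r', a} \<in> F - {e}"
    using cs(3)[of "last r'" a] cp dist lr by (auto simp: e_def doubleton_eq_iff)
  have "gpath (F - {e}) (b # r')" using inner dist by (auto simp: gpath_def)
  then have "(b, last r') \<in> (link (F - {e}))\<^sup>*" using gpath_link r by fastforce
  moreover have "(last r', a) \<in> link (F - {e})" using la by (simp add: link_def)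
  ultimately have ba: "(b, a) \<in> (link (F - {e}))\<^sup>*" by (rule rtrancl_into_rtrancl)
  have "link F \<subseteq> (link (F - {e}))\<^sup>*"
  proof clarify
    fix x y assume xy: "(x, y) \<in> link F"
    show "(x, y) \<in> (link (F - {e}))\<^sup>*"
    proof (cases "{x, y} = {a, b}")
      case True
      then show ?thesis using ba link_rtrancl_sym[OF ba] by (auto simp: doubleton_eq_iff)
    next
      case False
      then show ?thesis using xy by (auto simp: link_def e_def)
    qed
  qed
  then have conn: "(link F)\<^sup>* \<subseteq> (link (F - {e}))\<^sup>*" by (rule rtrancl_subset_rtrancl)
  have notN: "a \<notin> N \<and> b \<notin> N"
  proof -
    obtain y where y: "{b, y} \<in> F - {e}"
    proof -
      have "(b, hd r') \<in> set (ipairs (b # r'))" using r by (simp add: ipairs_Cons)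
      then show ?thesis using inner that by blast
    qed
    have "card {e' \<in> F. a \<in> e'} \<noteq> 1" "card {e' \<in> F. b \<in> e'} \<noteq> 1"
    proof -
      have "{e, {last r', a}} \<subseteq> {e' \<in> F. a \<in> e'}" using la eF by (auto simp: e_def)
      then have "card {e, {last r', a}} \<le> card {e' \<in> F. a \<in> e'}" using fin by (intro card_mono) auto
      moreover have "e \<noteq> {last r', a}" using la by blast
      ultimately show "card {e' \<in> F. a \<in> e'} \<noteq> 1" by simp
      have "{e, {b, y}} \<subseteq> {e' \<in> F. b \<in> e'}" using y eF by (auto simp: e_def)
      then have "card {e, {b, y}} \<le> card {e' \<in> F. b \<in> e'}" using fin by (intro card_mono) auto
      moreover have "e \<noteq> {b, y}" using y by blast
      ultimately show "card {e' \<in> F. b \<in> e'} \<noteq> 1" by simp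
    qed
    then show ?thesis using F by (auto simp: pendant_connected_def)
  qed
  have N: "N \<subseteq> \<Union>(F - {e})"
    using F notN unfolding pendant_connected_def e_def by fastforce
  have "pendant_connected (F - {e}) N"
    unfolding pendant_connected_def
  proof (intro conjI ballI)
    fix x assume x: "x \<in> N"
    have "{e' \<in> F - {e}. x \<in> e'} = {e' \<in> F. x \<in> e'}" using x notN by (auto simp: e_def)
    then show "card {e' \<in> F - {e}. x \<in> e'} = 1" using F x by (simp add: pendant_connected_def)
  next
    fix x y assume "x \<in> \<Union>(F - {e})" "y \<in> \<Union>(F - {e})"
    then have "(x, y) \<in> (link F)\<^sup>*" using F by (auto simp: pendant_connected_def)
    then show "(x, y) \<in> (link (F - {e}))\<^sup>*" using conn by blast
  qed (rule N)
  then show ?thesis using eF by blast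
qed

text \<open>The danger is that the other end \<open>w\<close> of the edge loses its only edge or
  lies in \<open>N\<close>. Two different members of \<open>N\<close> exclude this: they force a
  second edge at \<open>w\<close>, and then \<open>w\<close> is not in \<open>N\<close>
  either.\<close>

lemma pendant_connected_remove_leaf_edge:
  assumes F: "pendant_connected F N" and two: "\<And>e. e \<in> F \<Longrightarrow> card e = 2"
    and N: "a \<in> N" "b \<in> N" "a \<noteq> b"
    and v: "v \<notin> N" "{e \<in> F. v \<in> e} = {e}"
  shows "pendant_connected (F - {e}) N"
proof -
  have eF: "e \<in> F" "v \<in> e" using v by auto
  then obtain w where w: "w \<noteq> v" "e = {v, w}" using two doubleton_edge[of e v] by blast
  have uniq: "e' = e" if "e' \<in> F" "v \<in> e'" for e' using v that by blast
  \<comment> \<open>Without a second edge at \<open>w\<close> the whole graph would be the edge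
    \<open>{v, w}\<close>, which contains at most one member of \<open>N\<close>.\<close>
  have w2: "\<exists>e'\<in>F - {e}. w \<in> e'"
  proof (rule ccontr)
    assume n: "\<not> ?thesis"
    have "y \<in> {v, w}" if "(v, y) \<in> (link F)\<^sup>*" for y
      using that
    proof (induction rule: rtrancl_induct)
      case (step y z)
      then have "{y, z} \<in> F" by (simp add: link_def)
      then have "{y, z} = e" using step n uniq by blast
      then show ?case using w by auto
    qed simp
    moreover have "(v, a) \<in> (link F)\<^sup>*" "(v, b) \<in> (link F)\<^sup>*"
      using F N eF unfolding pendant_connected_def by blast+
    ultimately have "a \<in> {v, w}" "b \<in> {v, w}" by blast+
    then show False using N v by auto
  qed
  have wN: "w \<notin> N"
  proof
    assume "w \<in> N"
    then have "card {e \<in> F. w \<in> e} = 1" using F by (simp add: pendant_connected_def)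
    then obtain e0 where e0: "{e \<in> F. w \<in> e} = {e0}" by (rule card_1_singletonE)
    obtain e1 where "e1 \<in> F" "e1 \<noteq> e" "w \<in> e1" using w2 by blast
    then have "e1 \<in> {e0}" "e \<in> {e0}" using eF w unfolding e0[symmetric] by simp_all
    then show False using \<open>e1 \<noteq> e\<close> by simp
  qed
  have UF: "\<Union>(F - {e}) = \<Union>F - {v}"
  proof
    show "\<Union>(F - {e}) \<subseteq> \<Union>F - {v}" using uniq by blast
    show "\<Union>F - {v} \<subseteq> \<Union>(F - {e})"
    proof
      fix x assume "x \<in> \<Union>F - {v}"
      then obtain e' where e': "e' \<in> F" "x \<in> e'" "x \<noteq> v" by blast
      show "x \<in> \<Union>(F - {e})"
      proof (cases "e' = e")
        case True
        then have "x = w" using e' w by auto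
        then show ?thesis using w2 by blast
      qed (use e' in blast)
    qed
  qed
  \<comment> \<open>Walks that visit \<open>v\<close> must come from \<open>w\<close> and return to
    it, so \<open>w\<close> can stand in for \<open>v\<close>.\<close>
  have conn: "(x, if y = v then w else y) \<in> (link (F - {e}))\<^sup>*" if "(x, y) \<in> (link F)\<^sup>*" "x \<noteq> v" for x y
    using that
  proof (induction rule: rtrancl_induct)
    case (step y z)
    have yz: "{y, z} \<in> F" using step by (simp add: link_def)
    have yz2: "y \<noteq> z" using two[OF yz] by auto
    consider "z = v" | "y = v" "z \<noteq> v" | "y \<noteq> v" "z \<noteq> v" by blast
    then show ?case
    proof cases
      case 1
      then have "{y, z} = e" using uniq[OF yz] by simp
      then have "y = w" using w 1 yz2 by (auto simp: doubleton_eq_iff)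
      then show ?thesis using step 1 yz2 by auto
    next
      case 2
      then have "{y, z} = e" using uniq[OF yz] by simp
      then have "z = w" using w 2 by (auto simp: doubleton_eq_iff)
      then show ?thesis using step 2 by auto
    next
      case 3
      then have "{y, z} \<noteq> e" using w by (auto simp: doubleton_eq_iff)
      then have "(y, z) \<in> link (F - {e})" using yz by (simp add: link_def)
      then show ?thesis using step 3 by (auto intro: rtrancl_into_rtrancl)
    qed
  qed auto
  show ?thesis
    unfolding pendant_connected_def
  proof (intro conjI ballI)
    show "N \<subseteq> \<Union>(F - {e})" using F v UF by (auto simp: pendant_connected_def)
  next
    fix x y assume "x \<in> \<Union>(F - {e})" "y \<in> \<Union>(F - {e})"
    then have xy: "x \<in> \<Union>F" "y \<in> \<Union>F" "x \<noteq> v" "y \<noteq> v" using UF by auto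
    then have "(x, y) \<in> (link F)\<^sup>*" using F by (auto simp: pendant_connected_def)
    then show "(x, y) \<in> (link (F - {e}))\<^sup>*" using conn[of x y] xy by simp
  next
    fix x assume x: "x \<in> N"
    have "{e' \<in> F - {e}. x \<in> e'} = {e' \<in> F. x \<in> e'}" using x v wN w by auto
    then show "card {e' \<in> F - {e}. x \<in> e'} = 1" using F x by (simp add: pendant_connected_def)
  qed
qed

text \<open>An edge of a cycle or the edge at a leaf outside \<open>N\<close> can be removed as long
  as there is one. When there is none, the graph is a tree, and its leaves are exactly
  \<open>N\<close> because members of \<open>N\<close> keep degree one throughout.\<close>

lemma tree_with_leaves_exists:
  assumes "pendant_connected E N" "finite E" "\<And>e. e \<in> E \<Longrightarrow> card e = 2"
    and N: "a \<in> N" "b \<in> N" "a \<noteq> b"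
  shows "\<exists>F\<subseteq>E. is_tree (Graph (\<Union>F) F) \<and> leaves (Graph (\<Union>F) F) = N"
  using assms(1-3)
proof (induction "card E" arbitrary: E rule: less_induct)
  case less
  have smaller: ?case if e: "e \<in> E" "pendant_connected (E - {e}) N" for e
  proof -
    have "card (E - {e}) < card E" using e less.prems by (intro psubset_card_mono) auto
    then obtain F where "F \<subseteq> E - {e}" "is_tree (Graph (\<Union>F) F) \<and> leaves (Graph (\<Union>F) F) = N"
      using less.hyps[of "E - {e}"] e less.prems by auto
    then show ?thesis by blast
  qed
  let ?T = "Graph (\<Union>E) E"
  show ?case
  proof (cases "\<exists>C. is_cycle C \<and> subgraph C ?T")
    case True
    then obtain cs where cs: "length cs \<ge> 3" "distinct cs" "subgraph (cycle_graph cs) ?T"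
      by (auto simp: is_cycle_conv)
    have "{x, y} \<in> E" if "(x, y) \<in> set (cpairs cs)" for x y
      using cs(3) that by (force simp: subgraph_def cycle_graph_def)
    then show ?thesis
      using pendant_connected_remove_cycle_edge[OF less.prems(1,2) cs(1,2)] smaller by blast
  next
    case False
    have "simple_graph ?T"
      using less.prems unfolding simple_graph_def
      by (auto intro!: finite_Union) (metis card.infinite zero_neq_numeral)
    moreover have "connected_graph ?T"
    proof -
      have "a \<in> \<Union>E" using less.prems(1) N by (auto simp: pendant_connected_def)
      then show ?thesis
        using less.prems(1) unfolding connected_graph_def pendant_connected_def link_def by auto
    qed
    ultimately have T: "is_tree ?T" using False by (simp add: is_tree_def)
    show ?thesis
    proof (cases "leaves ?T \<subseteq> N")
      case True
      moreover have "N \<subseteq> leaves ?T"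
        using less.prems(1) by (auto simp: pendant_connected_def leaves_def degree_def)
      ultimately show ?thesis using T by (intro exI[of _ E]) auto
    next
      case F: False
      then obtain v where "v \<notin> N" "card {e \<in> E. v \<in> e} = 1" by (auto simp: leaves_def degree_def)
      then obtain e where e: "v \<notin> N" "{e \<in> E. v \<in> e} = {e}" by (auto simp: card_1_singleton_iff)
      have "pendant_connected (E - {e}) N"
        by (rule pendant_connected_remove_leaf_edge[OF less.prems(1,3) N e])
      moreover have "e \<in> E" using e by blast
      ultimately show ?thesis using smaller by blast
    qed
  qed
qed

section \<open>Bridges of a cycle in a 2-connected graph\<close>

lemma component_closed:
  assumes D: "component H D" and H: "\<And>e. e \<in> edges H \<Longrightarrow> e \<subseteq> verts H \<and> card e = 2"
    and xy: "x \<in> verts D" "{x, y} \<in> edges H"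
  shows "y \<in> verts D"
proof -
  define D' where "D' = Graph (insert y (verts D)) (insert {x, y} (edges D))"
  have sD: "simple_graph D" "verts D \<subseteq> verts H" "edges D \<subseteq> edges H"
    using D by (auto simp: component_def subgraph_def)
  have cD: "(u, v) \<in> (link (edges D))\<^sup>*" if "u \<in> verts D" "v \<in> verts D" for u v
    using D that by (auto simp: component_def connected_graph_def link_def)
  have s': "simple_graph D'"
    using sD H[OF xy(2)] xy(1) unfolding simple_graph_def D'_def by auto
  have "link (edges D) \<subseteq> link (edges D')" by (auto simp: link_def D'_def)
  then have up: "(u, v) \<in> (link (edges D'))\<^sup>*" if "u \<in> verts D" "v \<in> verts D" for u v
    using cD[OF that] rtrancl_mono by blast
  have toy: "(u, y) \<in> (link (edges D'))\<^sup>*" if "u \<in> verts D" for u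
    using up[OF that xy(1)] by (rule rtrancl_into_rtrancl) (simp add: link_def D'_def)
  have "(u, v) \<in> (link (edges D'))\<^sup>*" if "u \<in> verts D'" "v \<in> verts D'" for u v
  proof -
    have "u = y \<or> u \<in> verts D" "v = y \<or> v \<in> verts D" using that by (auto simp: D'_def)
    then show ?thesis using toy up link_rtrancl_sym[OF toy] by blast
  qed
  then have "connected_graph D'" by (auto simp: connected_graph_def link_def D'_def)
  moreover have "subgraph D' H" using s' sD xy H[OF xy(2)] by (auto simp: subgraph_def D'_def)
  moreover have "subgraph D D'" using sD by (auto simp: subgraph_def D'_def)
  ultimately have "D' = D" using D by (simp add: component_def)
  then have "verts D' = verts D" by simp
  then show ?thesis by (auto simp: D'_def)
qed

lemma bridge_basic:
  assumes G: "simple_graph G" and L: "simple_graph L" "verts L \<subseteq> verts G" and B: "is_bridge G L B"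
  shows "edges B \<subseteq> edges G - edges L" "verts B \<subseteq> verts G" "\<And>e. e \<in> edges B \<Longrightarrow> e \<subseteq> verts B \<and> card e = 2"
    "finite (edges B)" "verts B \<noteq> {}"
proof -
  have GE: "e \<subseteq> verts G \<and> card e = 2" if "e \<in> edges G" for e using G that by (simp add: simple_graph_def)
  have LE: "e \<subseteq> verts L" if "e \<in> edges L" for e using L that by (simp add: simple_graph_def)
  have "edges G \<subseteq> Pow (verts G)" using GE by blast
  then have finG: "finite (edges G)" using G finite_subset by (auto simp: simple_graph_def)
  have "edges B \<subseteq> edges G - edges L \<and> verts B \<subseteq> verts G \<and> (\<forall>e\<in>edges B. e \<subseteq> verts B) \<and> verts B \<noteq> {}"
    using B unfolding is_bridge_def
  proof (elim disjE exE conjE)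
    fix e assume e: "e \<in> edges G - edges L" "e \<subseteq> verts L" "B = Graph e {e}"
    have "e \<noteq> {}" using GE[of e] e by auto
    then show ?thesis using e L by auto
  next
    fix D assume D: "component (delete_verts G (verts L)) D" and Beq: "B = Graph
              (verts D \<union> {v \<in> verts L. \<exists>u\<in>verts D. {u, v} \<in> edges G})
              (edges D \<union> {{u, v} | u v. u \<in> verts D \<and> v \<in> verts L \<and> {u, v} \<in> edges G})"
    have sD: "simple_graph D" "verts D \<subseteq> verts G - verts L" "edges D \<subseteq> edges G" "verts D \<noteq> {}"
      using D by (auto simp: component_def subgraph_def delete_verts_def induced_subgraph_def connected_graph_def)
    have dE: "e \<subseteq> verts D \<and> e \<noteq> {}" if "e \<in> edges D" for e
      using sD(1) that by (auto simp: simple_graph_def)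
    have "e \<notin> edges L" if "e \<in> edges D" for e using dE[OF that] LE[of e] sD(2) by blast
    moreover have "{u, v} \<notin> edges L" if "u \<in> verts D" for u v using LE[of "{u, v}"] that sD by blast
    moreover have "e \<subseteq> verts B" if "e \<in> edges B" for e
      using that dE unfolding Beq by fastforce
    ultimately show ?thesis using sD L(2) unfolding Beq by auto
  qed
  then have 1: "edges B \<subseteq> edges G - edges L" "verts B \<subseteq> verts G" "verts B \<noteq> {}"
    and 2: "\<And>e. e \<in> edges B \<Longrightarrow> e \<subseteq> verts B" by auto
  show "edges B \<subseteq> edges G - edges L" "verts B \<subseteq> verts G" "verts B \<noteq> {}" by (fact 1)+
  show "e \<subseteq> verts B \<and> card e = 2" if "e \<in> edges B" for e using 1(1) 2[OF that] GE[of e] that by auto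
  have "edges B \<subseteq> edges G" using 1(1) by auto
  then show "finite (edges B)" using finG by (rule finite_subset)
qed

lemma bridge_tree_exists:
  assumes G: "two_connected G" and L: "is_cycle L" "subgraph L G" and B: "is_bridge G L B"
  shows "\<exists>T. is_tree T \<and> subgraph T B \<and> leaves T = attachments L B"
    "\<exists>a\<in>attachments L B. \<exists>b\<in>attachments L B. a \<noteq> b"
proof -
  have sG: "simple_graph G" using G by (simp add: two_connected_def)
  have sL: "simple_graph L" "verts L \<subseteq> verts G" using L by (auto simp: subgraph_def)
  note bb = bridge_basic[OF sG sL B]
  have GE: "e \<subseteq> verts G \<and> card e = 2" if "e \<in> edges G" for e using sG that by (simp add: simple_graph_def)
  obtain cs where cs: "length cs \<ge> 3" "distinct cs" "L = cycle_graph cs" using L by (auto simp: is_cycle_conv)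
  have "(\<exists>a\<in>attachments L B. \<exists>b\<in>attachments L B. a \<noteq> b) \<and>
      (\<exists>E\<subseteq>edges B. pendant_connected E (attachments L B))"
    using B unfolding is_bridge_def
  proof (elim disjE exE conjE)
    fix e assume e: "e \<in> edges G - edges L" "e \<subseteq> verts L" "B = Graph e {e}"
    have at: "attachments L B = e" using e by (auto simp: attachments_def)
    obtain a b where ab: "e = {a, b}" "a \<noteq> b" using GE[of e] e by (auto simp: card_2_iff)
    have "{e' \<in> {e}. x \<in> e'} = {e}" if "x \<in> e" for x using that by auto
    moreover have "(a, b) \<in> (link {e})\<^sup>*" "(b, a) \<in> (link {e})\<^sup>*"
      using ab by (auto simp: link_def insert_commute intro!: r_into_rtrancl)
    ultimately have "pendant_connected {e} e" using ab by (auto simp: pendant_connected_def)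
    then show ?thesis using at ab e by auto
  next
    fix D assume D: "component (delete_verts G (verts L)) D" and Beq: "B = Graph
              (verts D \<union> {v \<in> verts L. \<exists>u\<in>verts D. {u, v} \<in> edges G})
              (edges D \<union> {{u, v} | u v. u \<in> verts D \<and> v \<in> verts L \<and> {u, v} \<in> edges G})"
    have sD: "simple_graph D" "verts D \<subseteq> verts G - verts L" "edges D \<subseteq> edges G" "verts D \<noteq> {}"
      using D by (auto simp: component_def subgraph_def delete_verts_def induced_subgraph_def connected_graph_def)
    have cD: "(u, v) \<in> (link (edges D))\<^sup>*" if "u \<in> verts D" "v \<in> verts D" for u v
      using D that by (auto simp: component_def connected_graph_def link_def)
    have dE: "e \<subseteq> verts D" if "e \<in> edges D" for e
      using sD(1) that by (auto simp: simple_graph_def)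
    define N where "N = attachments L B"
    have Nd: "N = {v \<in> verts L. \<exists>u\<in>verts D. {u, v} \<in> edges G}"
      using sD by (auto simp: N_def attachments_def Beq)
    have closed: "y \<in> verts D" if "x \<in> verts D" "{x, y} \<in> edges G" "y \<notin> verts L" for x y
    proof (rule component_closed[OF D])
      show "{x, y} \<in> edges (delete_verts G (verts L))"
        using that sD GE[of "{x, y}"] by (auto simp: delete_verts_def induced_subgraph_def)
    qed (use that GE in \<open>auto simp: delete_verts_def induced_subgraph_def\<close>)
    \<comment> \<open>This is where 2-connectedness enters: if \<open>v\<close> were the only
      possible attachment, \<open>D\<close> could not be left in \<open>G\<close> without
      \<open>v\<close>, although another vertex of the cycle remains there.\<close>
    have exN: "\<exists>x\<in>N. x \<noteq> v" if v: "v \<in> verts L" for v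
    proof (rule ccontr)
      assume n: "\<not> ?thesis"
      define H where "H = delete_verts G {v}"
      have cH: "connected_graph H" using G v sL by (auto simp: two_connected_def H_def)
      have VH: "verts H = verts G - {v}" by (auto simp: H_def delete_verts_def induced_subgraph_def)
      obtain d where d: "d \<in> verts D" using sD by blast
      have "\<exists>w\<in>verts L. w \<noteq> v"
      proof (rule ccontr)
        assume "\<not> ?thesis"
        then have "set cs \<subseteq> {v}" using cs by (auto simp: cycle_graph_def)
        then have "card (set cs) \<le> 1" using card_mono[of "{v}" "set cs"] by simp
        then show False using cs distinct_card[of cs] by simp
      qed
      then obtain w where w: "w \<in> verts L" "w \<noteq> v" by blast
      have "(d, w) \<in> {(x, y). {x, y} \<in> edges H}\<^sup>*"
        using cH d w v sD sL unfolding connected_graph_def VH by blast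
      moreover have "y \<in> verts D" if "(d, y) \<in> {(x, y). {x, y} \<in> edges H}\<^sup>*" for y
        using that
      proof (induction rule: rtrancl_induct)
        case base show ?case by (rule d)
      next
        case (step y z)
        then have e: "{y, z} \<in> edges G" "{y, z} \<subseteq> verts G - {v}"
          by (auto simp: H_def delete_verts_def induced_subgraph_def)
        have "z \<notin> verts L"
        proof
          assume "z \<in> verts L"
          then have "z \<in> N" using step e by (auto simp: Nd)
          then show False using n e by auto
        qed
        then show ?case using closed step e by blast
      qed
      ultimately have "w \<in> verts D" by blast
      then show False using w sD by blast
    qed
    obtain v0 where "v0 \<in> verts L" using cs by (cases cs) (auto simp: cycle_graph_def)
    then obtain a where a: "a \<in> N" using exN by blast
    then have "a \<in> verts L" by (simp add: Nd)
    then obtain b where b: "b \<in> N" "b \<noteq> a" using exN by blast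
    have "\<forall>x\<in>N. \<exists>u\<in>verts D. {u, x} \<in> edges G" by (simp add: Nd)
    then obtain f where f: "\<And>x. x \<in> N \<Longrightarrow> f x \<in> verts D \<and> {f x, x} \<in> edges G" by metis
    \<comment> \<open>One edge into \<open>D\<close> is kept for each attachment, which makes every
      attachment pendant.\<close>
    define E where "E = edges D \<union> (\<lambda>x. {f x, x}) ` N"
    have "E \<subseteq> edges B" using f by (auto simp: E_def Beq Nd)
    have NL: "x \<in> verts L" "x \<notin> verts D" if "x \<in> N" for x using that sD by (auto simp: Nd)
    have lDE: "(u, v) \<in> (link E)\<^sup>*" if "u \<in> verts D" "v \<in> verts D" for u v
      using cD[OF that] link_mono[of "edges D" E] by (auto simp: E_def)
    obtain d where d: "d \<in> verts D" using sD by blast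
    have toD: "(x, d) \<in> (link E)\<^sup>*" if "x \<in> \<Union>E" for x
    proof -
      have "x \<in> verts D \<or> x \<in> N" using that dE f by (auto simp: E_def)
      then show ?thesis
      proof
        assume "x \<in> verts D" then show ?thesis using lDE d by blast
      next
        assume x: "x \<in> N"
        then have "(x, f x) \<in> link E" by (auto simp: link_def E_def insert_commute)
        then show ?thesis using lDE[of "f x" d] f[OF x] d by (auto intro: converse_rtrancl_into_rtrancl)
      qed
    qed
    have "pendant_connected E N"
      unfolding pendant_connected_def
    proof (intro conjI ballI)
      show "N \<subseteq> \<Union>E" by (auto simp: E_def)
      show "(x, y) \<in> (link E)\<^sup>*" if "x \<in> \<Union>E" "y \<in> \<Union>E" for x y
        using toD[OF that(1)] link_rtrancl_sym[OF toD[OF that(2)]] by (rule rtrancl_trans)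
      fix x assume x: "x \<in> N"
      have "{e \<in> E. x \<in> e} = {{f x, x}}"
      proof
        show "{e \<in> E. x \<in> e} \<subseteq> {{f x, x}}"
        proof clarify
          fix e assume e: "e \<in> E" "x \<in> e" "e \<notin> {}"
          then have "e \<notin> edges D" using dE NL[OF x] by blast
          then obtain y where y: "y \<in> N" "e = {f y, y}" using e by (auto simp: E_def)
          have "x \<noteq> f y" using f[OF y(1)] NL[OF x] by auto
          then show "e = {f x, x}" using y e by auto
        qed
        show "{{f x, x}} \<subseteq> {e \<in> E. x \<in> e}" using x by (auto simp: E_def)
      qed
      then show "card {e \<in> E. x \<in> e} = 1" by simp
    qed
    then show ?thesis using a b \<open>E \<subseteq> edges B\<close> unfolding N_def by blast
  qed
  then obtain a b E where ab: "a \<in> attachments L B" "b \<in> attachments L B" "a \<noteq> b" and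
    E: "E \<subseteq> edges B" "pendant_connected E (attachments L B)" by blast
  have finE: "finite E" using E bb(4) finite_subset by blast
  have "\<exists>F\<subseteq>E. is_tree (Graph (\<Union>F) F) \<and> leaves (Graph (\<Union>F) F) = attachments L B"
    by (rule tree_with_leaves_exists[OF E(2) finE _ ab]) (use E bb(3) in blast)
  then obtain F where F: "F \<subseteq> E" "is_tree (Graph (\<Union>F) F)" "leaves (Graph (\<Union>F) F) = attachments L B" by blast
  have "\<Union>F \<subseteq> verts B" "F \<subseteq> edges B" using F E bb(3) by blast+
  then have "subgraph (Graph (\<Union>F) F) B"
    using F by (simp add: subgraph_def is_tree_def)
  then show "\<exists>T. is_tree T \<and> subgraph T B \<and> leaves T = attachments L B" using F by blast
  show "\<exists>a\<in>attachments L B. \<exists>b\<in>attachments L B. a \<noteq> b" using ab by blast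
qed

lemma bridge_length_tree:
  assumes G: "two_connected G" and L: "is_cycle L" "subgraph L G" and B: "is_bridge G L B"
  shows "\<exists>T. is_tree T \<and> subgraph T B \<and> leaves T = attachments L B \<and> bridge_length L B = card (edges T)"
proof -
  define S where "S = {card (edges T) | T. is_tree T \<and> subgraph T B \<and> leaves T = attachments L B}"
  have sG: "simple_graph G" using G by (simp add: two_connected_def)
  have sL: "simple_graph L" "verts L \<subseteq> verts G" using L by (auto simp: subgraph_def)
  have "finite (edges B)" using bridge_basic(4)[OF sG sL B] .
  then have "S \<subseteq> {..card (edges B)}" by (auto simp: S_def subgraph_def intro: card_mono)
  then have "finite S" using finite_subset by blast
  moreover have "S \<noteq> {}" using bridge_tree_exists(1)[OF assms] by (auto simp: S_def)
  ultimately have "Max S \<in> S" by (rule Max_in)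
  then show ?thesis by (auto simp: S_def bridge_length_def)
qed

section \<open>Overlapping bridges\<close>

definition path_graph :: "'a list \<Rightarrow> 'a ugraph" where
  "path_graph ps = Graph (set ps) ((\<lambda>(x, y). {x, y}) ` set (ipairs ps))"

lemma is_path_conv: "is_path P \<longleftrightarrow> (\<exists>ps. ps \<noteq> [] \<and> distinct ps \<and> P = path_graph ps)"
proof -
  have "(\<lambda>(x, y). {x, y}) ` set (ipairs vs) = {{vs ! i, vs ! Suc i} | i. Suc i < length vs}"
    for vs :: "'a list"
    by (force simp: ipairs_nth)
  then show ?thesis unfolding is_path_def path_graph_def by simp
qed

lemma cycle_graph_rotate [simp]: "cycle_graph (rotate n cs) = cycle_graph cs"
  by (simp add: cycle_graph_def)

lemma requiv_rotate_or_rev: "requiv xs ys \<Longrightarrow> (\<exists>n. ys = rotate n xs) \<or> (\<exists>n. ys = rotate n (rev xs))"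
proof (induction rule: requiv.induct)
  case (requiv_refl xs)
  then show ?case by (metis rotate0 id_apply)
next
  case (requiv_rotate1 xs ys)
  then show ?case by (metis rotate_Suc)
next
  case (requiv_rev xs ys)
  have "\<exists>m. rev (rotate n zs) = rotate m (rev zs)" for n and zs :: "'a list"
    by (metis rev_append rotate_append rotate_split)
  then show ?case using requiv_rev by (metis rev_rev_ident)
qed

text \<open>Splits the vertices of the cycle into two intervals, whereas \<open>overlap\<close>
  splits its edges.\<close>

definition splits :: "'a list \<Rightarrow> 'a set \<Rightarrow> 'a set \<Rightarrow> bool" where
  "splits zs X Y \<longleftrightarrow> (\<exists>n us vs. rotate n zs = us @ vs \<and> X \<inter> set vs = {} \<and> Y \<inter> set us = {})"

lemma splits_requiv:
  assumes "requiv zs zs'" "splits zs' X Y" shows "splits zs X Y"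
proof -
  obtain n us vs where s: "rotate n zs' = us @ vs" "X \<inter> set vs = {}" "Y \<inter> set us = {}"
    using assms(2) by (auto simp: splits_def)
  from requiv_rotate_or_rev[OF assms(1)] show ?thesis
  proof
    assume "\<exists>m. zs' = rotate m zs"
    then show ?thesis using s unfolding splits_def by (metis rotate_rotate)
  next
    assume "\<exists>m. zs' = rotate m (rev zs)"
    then obtain m where "rotate (n + m) (rev zs) = us @ vs" using s by (metis rotate_rotate)
    then obtain x y where "rev zs = x @ y" "us @ vs = y @ x" using rotate_split by metis
    then have "zs = rev y @ rev x" "rev x @ rev y = rev vs @ rev us" by (metis rev_append rev_rev_ident)+
    then have "rotate (length (rev y)) zs = rev vs @ rev us" by (simp only: rotate_append)
    then have "rotate (length (rev vs)) (rotate (length (rev y)) zs) = rev us @ rev vs"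
      by (simp only: rotate_append)
    then have "rotate (length (rev vs) + length (rev y)) zs = rev us @ rev vs" by (simp only: rotate_rotate)
    then show ?thesis using s unfolding splits_def by (metis set_rev)
  qed
qed

lemma edge_cycle_graph_iff: "{x, y} \<in> edges (cycle_graph zs) \<longleftrightarrow> adj zs x y"
  by (force simp: cycle_graph_def adj_def arc_def doubleton_eq_iff)

lemma edge_path_graph_iff: "{x, y} \<in> edges (path_graph zs) \<longleftrightarrow> (x, y) \<in> set (ipairs zs) \<or> (y, x) \<in> set (ipairs zs)"
  by (force simp: path_graph_def doubleton_eq_iff)

lemma card_edges_path_graph: "ps \<noteq> [] \<Longrightarrow> card (edges (path_graph ps)) < length ps"
proof -
  assume "ps \<noteq> []"
  have "card (edges (path_graph ps)) \<le> card (set (ipairs ps))"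
    by (simp add: path_graph_def card_image_le)
  also have "\<dots> \<le> length (ipairs ps)" by (rule card_length)
  also have "\<dots> < length ps" using \<open>ps \<noteq> []\<close> by (simp add: ipairs_def)
  finally show ?thesis .
qed

lemma ipairs_member:
  assumes "length qs \<ge> 2" "v \<in> set qs"
  shows "\<exists>y. (v, y) \<in> set (ipairs qs) \<or> (y, v) \<in> set (ipairs qs)"
proof -
  obtain i where i: "i < length qs" "qs ! i = v" using assms by (metis in_set_conv_nth)
  show ?thesis
  proof (cases "Suc i < length qs")
    case True
    then show ?thesis using i by (auto simp: ipairs_nth)
  next
    case False
    then obtain j where "i = Suc j" using i assms by (cases i) auto
    then show ?thesis using i by (auto simp: ipairs_nth)
  qed
qed

text \<open>Two intervals of vertices become edge-disjoint paths when each is extended by the first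
  vertex of the other. Conversely, the two paths can share only ends of the first one; as
  \<open>X\<close> and \<open>Y\<close> are disjoint, a shared end may be given to whichever side
  needs it.\<close>

lemma splits_iff_path_cover:
  assumes zs: "distinct zs" "length zs \<ge> 3" and X: "X \<subseteq> set zs" "X \<noteq> {}" and Y: "Y \<subseteq> set zs" "Y \<noteq> {}"
    and XY: "X \<inter> Y = {}"
  shows "splits zs X Y \<longleftrightarrow> (\<exists>L1 L2. is_path L1 \<and> is_path L2 \<and>
    verts L1 \<union> verts L2 = verts (cycle_graph zs) \<and> edges L1 \<union> edges L2 = edges (cycle_graph zs) \<and>
    edges L1 \<inter> edges L2 = {} \<and> X \<subseteq> verts L1 \<and> Y \<subseteq> verts L2)" (is "_ \<longleftrightarrow> ?P")
proof
  assume "splits zs X Y"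
  then obtain n us vs where s: "rotate n zs = us @ vs" "X \<inter> set vs = {}" "Y \<inter> set us = {}"
    unfolding splits_def by blast
  have sz: "set zs = set us \<union> set vs" by (metis s(1) set_append set_rotate)
  have d: "distinct (us @ vs)" by (metis s(1) zs(1) distinct_rotate)
  have len: "length (us @ vs) \<ge> 3" by (metis s(1) zs(2) length_rotate)
  have ne: "us \<noteq> []" "vs \<noteq> []" using X Y s(2,3) unfolding sz by auto
  define ps where "ps = us @ [hd vs]"
  define qs where "qs = vs @ [hd us]"
  have ip: "ipairs ps = ipairs us @ [(last us, hd vs)]" "ipairs qs = ipairs vs @ [(last vs, hd us)]"
    using ne by (simp_all add: ps_def qs_def ipairs_append)
  have cp: "cpairs (us @ vs) = ipairs ps @ ipairs qs" using ne by (simp add: cpairs_append ip)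
  have C: "cycle_graph zs = cycle_graph (us @ vs)" by (metis s(1) cycle_graph_rotate)
  have dc: "distinct (cpairs (us @ vs))" by (rule distinct_cpairs[OF d])
  have "edges (path_graph ps) \<inter> edges (path_graph qs) = {}"
    using inj_on_edge[OF d len] dc unfolding cp path_graph_def
    by (simp add: inj_on_image_Int[symmetric])
  moreover have "edges (path_graph ps) \<union> edges (path_graph qs) = edges (cycle_graph zs)"
    unfolding C by (simp add: cycle_graph_def path_graph_def cp image_Un)
  moreover have "distinct ps" "distinct qs" "ps \<noteq> []" "qs \<noteq> []"
    using d ne by (auto simp: ps_def qs_def dest: hd_in_set)
  moreover have "verts (path_graph ps) \<union> verts (path_graph qs) = verts (cycle_graph zs)"
    using ne unfolding path_graph_def cycle_graph_def ps_def qs_def ugraph.sel sz by auto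
  moreover have "X \<subseteq> verts (path_graph ps)" "Y \<subseteq> verts (path_graph qs)"
    using X(1) Y(1) s(2,3) unfolding path_graph_def ps_def qs_def ugraph.sel sz by auto
  ultimately show ?P
    by (intro exI[of _ "path_graph ps"] exI[of _ "path_graph qs"]) (auto simp: is_path_conv)
next
  assume ?P
  then obtain ps qs where ps: "ps \<noteq> []" "distinct ps" and qs: "qs \<noteq> []" "distinct qs"
    and V: "set ps \<union> set qs = set zs"
    and E: "edges (path_graph ps) \<union> edges (path_graph qs) = edges (cycle_graph zs)"
    and disj: "edges (path_graph ps) \<inter> edges (path_graph qs) = {}"
    and XP: "X \<subseteq> set ps" and YQ: "Y \<subseteq> set qs"
    by (auto simp: is_path_conv path_graph_def cycle_graph_def)
  \<comment> \<open>A one-vertex path has no edges, and the other path has too few to cover the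
    whole cycle.\<close>
  have two: "length ps' \<ge> 2" if "edges (path_graph ps') \<union> edges (path_graph qs') = edges (cycle_graph zs)"
     "ps' \<noteq> []" "qs' \<noteq> []" "distinct qs'" "set qs' \<subseteq> set zs" for ps' qs' :: "'a list"
  proof (rule ccontr)
    assume "\<not> ?thesis"
    then have "length ps' \<noteq> 0 \<longrightarrow> length ps' = 1" by linarith
    then have "length ps' = 1" using that by simp
    then obtain x where "ps' = [x]" by (auto simp: length_Suc_conv)
    then have "edges (path_graph qs') = edges (cycle_graph zs)" using that(1) by (simp add: path_graph_def)
    then have "length zs < length qs'"
      using card_edges_path_graph[OF that(3)] card_edges_cycle_graph[OF zs] by simp
    moreover have "length qs' \<le> length zs"
      using that(4,5) zs(1) card_mono[of "set zs" "set qs'"] by (simp add: distinct_card)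
    ultimately show False by simp
  qed
  have p2: "length ps \<ge> 2" using two[of ps qs] E ps qs V by blast
  have q2: "length qs \<ge> 2" using two[of qs ps] E ps qs V by blast
  have "adj zs x y" if "(x, y) \<in> set (ipairs ps)" for x y
    using E that by (metis UnI1 edge_cycle_graph_iff edge_path_graph_iff)
  then obtain rest where r: "requiv zs (ps @ rest)"
    using adj_contiguous[OF zs(1) ps] V by blast
  have d': "distinct (ps @ rest)" using requiv_distinct[OF r] zs by simp
  obtain h ps1 where h: "ps = h # ps1" using ps by (cases ps) auto
  obtain mid t where t: "ps1 = mid @ [t]" using h p2 by (cases ps1 rule: rev_cases) auto
  have pse: "ps = h # mid @ [t]" using h t by simp
  \<comment> \<open>Both cycle edges at an interior vertex of \<open>ps\<close> belong to
    \<open>ps\<close>, while a vertex of \<open>qs\<close> lies on an edge of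
    \<open>qs\<close>.\<close>
  have midQ: "v \<notin> set qs" if "v \<in> set mid" for v
  proof
    assume "v \<in> set qs"
    then obtain y where y: "(v, y) \<in> set (ipairs qs) \<or> (y, v) \<in> set (ipairs qs)"
      using ipairs_member[OF q2] by blast
    then have eq: "{v, y} \<in> edges (path_graph qs)" by (simp add: edge_path_graph_iff)
    then have a: "adj (ps @ rest) v y" using E adj_requiv[OF r] by (metis UnI2 edge_cycle_graph_iff)
    obtain m1 m2 where m: "mid = m1 @ v # m2" using \<open>v \<in> set mid\<close> by (metis split_list)
    have e1: "(last (h # m1), v) \<in> set (ipairs ps)" "(v, hd (m2 @ [t])) \<in> set (ipairs ps)"
    proof -
      have "ps = (h # m1) @ v # (m2 @ [t])" using pse m by simp
      then have "ipairs ps = ipairs (h # m1) @ (last (h # m1), v) # ipairs (v # (m2 @ [t]))"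
        by (simp only: ipairs_append list.sel list.simps not_False_eq_True)
      then show "(last (h # m1), v) \<in> set (ipairs ps)" "(v, hd (m2 @ [t])) \<in> set (ipairs ps)"
        by (auto simp: ipairs_Cons)
    qed
    have sub: "arc (ps @ rest) x z" if "(x, z) \<in> set (ipairs ps)" for x z
      using that ps cpairs_append[of ps rest] cpairs_conv_ipairs[of ps]
      by (cases "rest = []") (auto simp: arc_def)
    have "y = last (h # m1) \<or> y = hd (m2 @ [t])"
      using a sub[OF e1(1)] sub[OF e1(2)] arc_fun[OF d'] arc_inj[OF d'] unfolding adj_def by blast
    then have "{v, y} \<in> edges (path_graph ps)" using e1 by (auto simp: edge_path_graph_iff)
    then show False using eq disj by blast
  qed
  have "splits (ps @ rest) X Y"
  proof -
    \<comment> \<open>An end of \<open>ps\<close> is moved to the other part exactly if it lies in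
      \<open>Y\<close>; it is then not in \<open>X\<close>.\<close>
    define us where "us = (if h \<in> Y then [] else [h]) @ mid @ (if t \<in> Y then [] else [t])"
    define vs where "vs = (if t \<in> Y then [t] else []) @ rest @ (if h \<in> Y then [h] else [])"
    have "rotate (if h \<in> Y then 1 else 0) (ps @ rest) = us @ vs"
      by (simp add: us_def vs_def pse)
    moreover have "Y \<inter> set us = {}" using midQ YQ by (auto simp: us_def)
    moreover have "X \<inter> set vs = {}" using XP XY d' by (auto simp: vs_def)
    ultimately show ?thesis unfolding splits_def by blast
  qed
  then show "splits zs X Y" by (rule splits_requiv[OF r])
qed

lemma splits_iff_uncrossed:
  assumes "P i" "P j"
  shows "uncrossed (map c (filter (\<lambda>x. P (c x)) zs)) i j \<longleftrightarrow>
    splits zs {x \<in> set zs. c x = i} {x \<in> set zs. c x = j}"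
proof -
  have "map c (filter (\<lambda>x. P (c x)) zs) = filter P (map c zs)" by (simp add: filter_map o_def)
  then have "uncrossed (map c (filter (\<lambda>x. P (c x)) zs)) i j \<longleftrightarrow> uncrossed (map c zs) i j"
    using uncrossed_filter[of P i j "map c zs"] assms by simp
  also have "\<dots> \<longleftrightarrow> (\<exists>n us vs. rotate n zs = us @ vs \<and> i \<notin> c ` set vs \<and> j \<notin> c ` set us)"
    unfolding uncrossed_def rotate_map map_eq_append_conv by (metis set_map)
  also have "\<dots> \<longleftrightarrow> splits zs {x \<in> set zs. c x = i} {x \<in> set zs. c x = j}"
    unfolding splits_def
  proof (intro iff_exI conj_cong refl)
    fix n us vs assume "rotate n zs = us @ vs"
    then have "set zs = set us \<union> set vs" by (metis set_append set_rotate)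
    then show "i \<notin> c ` set vs \<longleftrightarrow> {x \<in> set zs. c x = i} \<inter> set vs = {}"
      "j \<notin> c ` set us \<longleftrightarrow> {x \<in> set zs. c x = j} \<inter> set us = {}" by auto
  qed
  finally show ?thesis .
qed

section \<open>Exchanges realised as cycles\<close>

definition walk :: "('a \<times> 'a \<Rightarrow> 'a list) \<Rightarrow> 'a list \<Rightarrow> 'a list" where
  "walk f vs = concat (map (\<lambda>e. fst e # f e) (ipairs vs)) @ [last vs]"

text \<open>Each step contributes its first point and the interior \<open>f e\<close> of the path
  put in its place; its second point comes from the next step.\<close>

definition cwalk :: "('a \<times> 'a \<Rightarrow> 'a list) \<Rightarrow> 'a list \<Rightarrow> 'a list" where
  "cwalk f vs = concat (map (\<lambda>e. fst e # f e) (cpairs vs))"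

lemma hd_walk: "vs \<noteq> [] \<Longrightarrow> hd (walk f vs) = hd vs"
  by (cases vs rule: remdups_adj.cases) (auto simp: walk_def)

lemma set_ipairs_walk:
  "vs \<noteq> [] \<Longrightarrow> set (ipairs (walk f vs)) = (\<Union>e\<in>set (ipairs vs). set (ipairs (fst e # f e @ [snd e])))"
proof (induction vs rule: induct_list012)
  case (2 x)
  then show ?case by (simp add: walk_def)
next
  case (3 x y zs)
  have ne: "walk f (y # zs) \<noteq> []" by (simp add: walk_def)
  have "walk f (x # y # zs) = (x # f (x, y)) @ walk f (y # zs)" by (simp add: walk_def)
  then have "ipairs (walk f (x # y # zs)) =
      ipairs (x # f (x, y)) @ (last (x # f (x, y)), y) # ipairs (walk f (y # zs))"
    using ne hd_walk[of "y # zs" f] ipairs_append[of "x # f (x, y)" "walk f (y # zs)"] by simp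
  moreover have "ipairs (x # f (x, y) @ [y]) = ipairs (x # f (x, y)) @ [(last (x # f (x, y)), y)]"
    using ipairs_append[of "x # f (x, y)" "[y]"] by simp
  ultimately show ?case using 3 by auto
qed simp

lemma cpairs_conv_ipairs_snoc: "xs \<noteq> [] \<Longrightarrow> cpairs xs = ipairs (xs @ [hd xs])"
  by (simp add: cpairs_conv_ipairs ipairs_append)

lemma set_cpairs_cwalk:
  assumes "vs \<noteq> []"
  shows "set (cpairs (cwalk f vs)) = (\<Union>e\<in>set (cpairs vs). set (ipairs (fst e # f e @ [snd e])))"
proof -
  have w: "walk f (vs @ [hd vs]) = cwalk f vs @ [hd vs]"
    using assms by (simp add: walk_def cwalk_def cpairs_conv_ipairs_snoc)
  have ne: "cwalk f vs \<noteq> []" using assms by (cases vs) (auto simp: cwalk_def cpairs_conv_ipairs ipairs_def)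
  have "hd (cwalk f vs) = hd (walk f (vs @ [hd vs]))" using ne unfolding w by simp
  then have "hd (cwalk f vs) = hd vs" using assms by (simp add: hd_walk)
  then show ?thesis
    using ne assms set_ipairs_walk[of "vs @ [hd vs]" f] w by (simp add: cpairs_conv_ipairs_snoc)
qed

lemma length_cwalk: "length (cwalk f vs) = (\<Sum>e\<leftarrow>cpairs vs. Suc (length (f e)))"
  by (simp add: cwalk_def length_concat o_def)

lemma int_sum_list_map: "int (sum_list (map g xs)) = sum_list (map (\<lambda>x. int (g x)) xs)"
  by (induction xs) auto

text \<open>Since the head satisfies \<open>P\<close>, no vertices precede the first selected point,
  and every other vertex belongs to the gap after some selected point.\<close>

lemma filter_gaps:
  assumes "distinct zs" "zs \<noteq> []" "P (hd zs)"
  shows "\<exists>gap. zs = concat (map (\<lambda>p. p # gap p) (filter P zs)) \<and>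
    (\<forall>p\<in>set (filter P zs). \<forall>x\<in>set (gap p). \<not> P x)"
  using assms
proof (induction "length zs" arbitrary: zs rule: less_induct)
  case less
  obtain p ys where zs: "zs = p # ys" "P p" using less.prems by (cases zs) auto
  define g where "g = takeWhile (\<lambda>x. \<not> P x) ys"
  define r where "r = dropWhile (\<lambda>x. \<not> P x) ys"
  have ys: "ys = g @ r" by (simp add: g_def r_def)
  have gP: "\<forall>x\<in>set g. \<not> P x" by (auto simp: g_def dest: set_takeWhileD)
  have fz: "filter P zs = p # filter P r"
    using zs gP by (simp add: ys)
  show ?case
  proof (cases "r = []")
    case True
    then show ?thesis using zs gP ys fz by (intro exI[of _ "\<lambda>_. g"]) auto
  next
    case False
    have "P (hd r)" using False hd_dropWhile[of "\<lambda>x. \<not> P x" ys] by (simp add: r_def)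
    moreover have "length r < length zs" "distinct r" using zs ys less.prems by auto
    ultimately obtain gap where gap: "r = concat (map (\<lambda>p. p # gap p) (filter P r))"
      "\<forall>p\<in>set (filter P r). \<forall>x\<in>set (gap p). \<not> P x"
      using less.hyps[of r] False by blast
    have np: "p \<notin> set r" using less.prems zs ys by auto
    have m: "map (\<lambda>q. q # (gap(p := g)) q) (filter P r) = map (\<lambda>q. q # gap q) (filter P r)"
      using np by auto
    have "zs = concat (map (\<lambda>q. q # (gap(p := g)) q) (filter P zs))"
      unfolding fz list.map concat.simps m gap(1)[symmetric] using zs ys by simp
    moreover have "\<forall>q\<in>set (filter P zs). \<forall>x\<in>set ((gap(p := g)) q). \<not> P x"
      unfolding fz using gap(2) gP by auto
    ultimately show ?thesis by blast
  qed
qed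

lemma gpath_between:
  assumes "gpath E xs" "hd xs = p" "last xs = q" "p \<noteq> q"
  shows "\<exists>ys. xs = p # ys @ [q]"
proof -
  obtain r where r: "xs = p # r" using assms by (cases xs) (auto simp: gpath_def)
  then have "r \<noteq> []" using assms by auto
  then have "r = butlast r @ [q]" using assms r by (metis append_butlast_last_id last_ConsR)
  then show ?thesis using r by blast
qed

lemma gpath_interior_not_leaf:
  assumes T: "simple_graph T" and p: "gpath (edges T) (p # ys @ [q])" and y: "y \<in> set ys"
  shows "y \<in> verts T - leaves T"
proof -
  obtain a b where ab: "ys = a @ y # b" using y by (metis split_list)
  have "p # ys @ [q] = (p # a) @ y # (b @ [q])" using ab by simp
  then have "ipairs (p # ys @ [q]) = ipairs (p # a) @ (last (p # a), y) # ipairs (y # (b @ [q]))"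
    by (simp only: ipairs_append list.sel list.simps not_False_eq_True)
  then have e: "(last (p # a), y) \<in> set (ipairs (p # ys @ [q]))" "(y, hd (b @ [q])) \<in> set (ipairs (p # ys @ [q]))"
    by (auto simp: ipairs_Cons)
  let ?e1 = "{last (p # a), y}" and ?e2 = "{y, hd (b @ [q])}"
  have E: "?e1 \<in> edges T" "?e2 \<in> edges T" using e p unfolding gpath_def by blast+
  have d: "distinct ((p # a) @ y # (b @ [q]))" using p ab by (simp add: gpath_def)
  have "last (p # a) \<in> set (p # a)" "hd (b @ [q]) \<in> set (b @ [q])" by (simp, cases b, auto)
  then have "last (p # a) \<noteq> hd (b @ [q])" "last (p # a) \<noteq> y" "hd (b @ [q]) \<noteq> y" using d by auto
  then have ne: "?e1 \<noteq> ?e2" by (auto simp: doubleton_eq_iff)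
  have fin: "finite {e \<in> edges T. y \<in> e}"
  proof -
    have "edges T \<subseteq> Pow (verts T)" using T by (auto simp: simple_graph_def)
    then have "finite (edges T)" using T finite_subset by (auto simp: simple_graph_def)
    then show ?thesis by simp
  qed
  have "card {?e1, ?e2} \<le> card {e \<in> edges T. y \<in> e}"
    by (rule card_mono[OF fin]) (use E in auto)
  then have "degree T y \<noteq> 1" using ne by (simp add: degree_def)
  moreover have "y \<in> verts T" using E T by (auto simp: simple_graph_def)
  ultimately show ?thesis by (simp add: leaves_def)
qed

text \<open>The colour \<open>0\<close> marks the vertices of the cycle that are no attachments.\<close>
locale tree_system =
  fixes G :: "'a ugraph" and zs :: "'a list" and T :: "nat \<Rightarrow> 'a ugraph" and c :: "'a \<Rightarrow> nat"
  assumes zs: "distinct zs" "length zs \<ge> 3" "c (hd zs) \<noteq> 0"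
    and arc_edge: "\<And>x y. arc zs x y \<Longrightarrow> {x, y} \<in> edges G"
    and longest: "\<And>cs. distinct cs \<Longrightarrow> length cs \<ge> 3 \<Longrightarrow>
      (\<And>x y. (x, y) \<in> set (cpairs cs) \<Longrightarrow> {x, y} \<in> edges G) \<Longrightarrow> length cs \<le> length zs"
    and tree: "\<And>x. x \<in> set zs \<Longrightarrow> c x \<noteq> 0 \<Longrightarrow> is_tree (T (c x)) \<and> edges (T (c x)) \<subseteq> edges G \<and>
      leaves (T (c x)) = {y \<in> set zs. c y = c x} \<and> verts (T (c x)) \<inter> set zs = leaves (T (c x))"
    and off_cycle: "\<And>x u v. x \<in> set zs \<Longrightarrow> c x \<noteq> 0 \<Longrightarrow> {u, v} \<in> edges (T (c x)) \<Longrightarrow> \<not> adj zs u v"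
    and disjoint_trees: "\<And>x y. x \<in> set zs \<Longrightarrow> y \<in> set zs \<Longrightarrow> c x \<noteq> 0 \<Longrightarrow> c y \<noteq> 0 \<Longrightarrow> c x \<noteq> c y \<Longrightarrow>
      verts (T (c x)) \<inter> verts (T (c y)) = {}"
begin

definition ws :: "'a list" where "ws = filter (\<lambda>x. c x \<noteq> 0) zs"

text \<open>The colour is read off an arbitrary member, so that \<open>lam\<close> depends on the
  set alone; the value is the intended one for nonempty sets of a single colour.\<close>

definition lam :: "'a set \<Rightarrow> int" where
  "lam S = span_len (edges (T (c (SOME x. x \<in> S)))) S"

lemma lam_eq: "S \<noteq> {} \<Longrightarrow> (\<And>x. x \<in> S \<Longrightarrow> c x = i) \<Longrightarrow> lam S = span_len (edges (T i)) S"
  by (simp add: lam_def some_in_eq)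

sublocale weighted_colours c lam
proof
  fix S :: "'a set" and C p q r
  assume *: "finite S" "3 \<le> card S" "\<And>x. x \<in> S \<Longrightarrow> c x = C" "p \<in> S" "q \<in> S" "r \<in> S"
    "p \<noteq> q" "r \<noteq> q" "p \<noteq> r"
  have "lam S = span_len (edges (T C)) S" "lam (S - {q}) = span_len (edges (T C)) (S - {q})"
    "lam {p, r} = span_len (edges (T C)) {p, r}" "lam {p, q} = span_len (edges (T C)) {p, q}"
    "lam {q, r} = span_len (edges (T C)) {q, r}"
    by (rule lam_eq; use * in auto)+
  then show "2 * (lam S - lam (S - {q})) + lam {p, r} \<le> lam {p, q} + lam {q, r}"
    using span_len_delete[of p S q r "edges (T C)"] * by simp
qed

lemma set_ws: "set ws = {x \<in> set zs. c x \<noteq> 0}"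
  by (auto simp: ws_def)

lemma distinct_ws: "distinct ws"
  using zs by (simp add: ws_def)

lemma finite_tree_edges: "x \<in> set ws \<Longrightarrow> finite (edges (T (c x)))"
proof -
  assume "x \<in> set ws"
  then have "simple_graph (T (c x))" using tree[of x] by (auto simp: set_ws is_tree_def)
  then have "edges (T (c x)) \<subseteq> Pow (verts (T (c x)))" "finite (verts (T (c x)))"
    by (auto simp: simple_graph_def)
  then show ?thesis using finite_subset by blast
qed

definition gap :: "'a \<Rightarrow> 'a list" where
  "gap = (SOME gap. zs = concat (map (\<lambda>p. p # gap p) ws) \<and> (\<forall>p\<in>set ws. \<forall>x\<in>set (gap p). c x = 0))"

lemma gap: "zs = concat (map (\<lambda>p. p # gap p) ws)" "p \<in> set ws \<Longrightarrow> x \<in> set (gap p) \<Longrightarrow> c x = 0"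
proof -
  have "\<exists>gap. zs = concat (map (\<lambda>p. p # gap p) ws) \<and> (\<forall>p\<in>set ws. \<forall>x\<in>set (gap p). c x = 0)"
  proof -
    have "zs \<noteq> []" using zs(2) by auto
    then show ?thesis using filter_gaps[of zs "\<lambda>x. c x \<noteq> 0"] zs(1,3) unfolding ws_def by simp
  qed
  from someI_ex[OF this] show "zs = concat (map (\<lambda>p. p # gap p) ws)"
    "p \<in> set ws \<Longrightarrow> x \<in> set (gap p) \<Longrightarrow> c x = 0"
    unfolding gap_def by blast+
qed

lemma ws_ne: "ws \<noteq> []"
proof -
  have "zs \<noteq> []" using zs(2) by auto
  then have "hd zs \<in> set ws" using zs(3) by (simp add: set_ws)
  then show ?thesis by auto
qed

definition seg_len :: "'a \<Rightarrow> int" where "seg_len p = 1 + int (length (gap p))"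

text \<open>Exhibits \<open>L\<close> itself as the cycle of the trivial exchange.\<close>

lemma zs_cwalk: "zs = cwalk (\<lambda>e. gap (fst e)) ws"
proof -
  have "map (\<lambda>e. fst e # gap (fst e)) (cpairs ws) = map (\<lambda>p. p # gap p) (map fst (cpairs ws))"
    by (simp only: list.map_comp o_def)
  then show ?thesis using gap(1) by (simp only: cwalk_def map_fst_cpairs)
qed

lemma sum_seg_len: "sum seg_len (set ws) = int (length zs)"
proof -
  have "int (length zs) = sum_list (map seg_len ws)"
    by (subst gap(1)) (simp add: length_concat o_def seg_len_def[abs_def] int_sum_list_map)
  then show ?thesis using distinct_ws by (simp add: sum_list_distinct_conv_sum_set)
qed

lemma gap_arcs: "arc ws p q \<Longrightarrow> (x, y) \<in> set (ipairs (p # gap p @ [q])) \<Longrightarrow> arc zs x y"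
proof -
  assume a: "arc ws p q" "(x, y) \<in> set (ipairs (p # gap p @ [q]))"
  have "set (cpairs zs) = (\<Union>e\<in>set (cpairs ws). set (ipairs (fst e # gap (fst e) @ [snd e])))"
    by (subst zs_cwalk) (rule set_cpairs_cwalk[OF ws_ne])
  then show "arc zs x y" using a by (force simp: arc_def)
qed

lemma gap_disjoint:
  assumes "p \<in> set ws" "q \<in> set ws" "p \<noteq> q" shows "set (gap p) \<inter> set (gap q) = {}"
proof -
  have "distinct (concat (map (\<lambda>p. p # gap p) ws))" using gap(1) zs by simp
  moreover have "p # gap p \<in> set (map (\<lambda>p. p # gap p) ws)" "q # gap q \<in> set (map (\<lambda>p. p # gap p) ws)"
    "p # gap p \<noteq> q # gap q" using assms by auto
  ultimately have "set (p # gap p) \<inter> set (q # gap q) = {}"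
    unfolding distinct_concat_iff by blast
  then show ?thesis by auto
qed

lemma gap_distinct: "p \<in> set ws \<Longrightarrow> distinct (p # gap p)"
proof -
  have "distinct (concat (map (\<lambda>p. p # gap p) ws))" using gap(1) zs by simp
  then show "p \<in> set ws \<Longrightarrow> distinct (p # gap p)" by (auto simp: distinct_concat_iff)
qed

lemma gap_in_zs: "p \<in> set ws \<Longrightarrow> set (gap p) \<subseteq> set zs"
proof -
  have "set zs = (\<Union>p\<in>set ws. set (p # gap p))" by (subst gap(1)) simp
  then show "p \<in> set ws \<Longrightarrow> set (gap p) \<subseteq> set zs" by auto
qed

text \<open>Interior vertices of a tree path are not leaves, and the tree meets the cycle only in
  its leaves.\<close>

lemma chord_exists:
  assumes "p \<in> set ws" "q \<in> set ws" "c p = c q" "p \<noteq> q"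
  shows "\<exists>ys. gpath (edges (T (c p))) (p # ys @ [q]) \<and> set ys \<inter> set zs = {} \<and>
     set ys \<subseteq> verts (T (c p)) \<and> lam {p, q} \<le> 1 + int (length ys)"
proof -
  let ?T = "T (c p)"
  have p: "p \<in> set zs" "c p \<noteq> 0" using assms by (auto simp: set_ws)
  have t: "is_tree ?T" "leaves ?T = {y \<in> set zs. c y = c p}" "verts ?T \<inter> set zs = leaves ?T"
    using tree[OF p] by auto
  have "p \<in> leaves ?T" "q \<in> leaves ?T" using t(2) assms by (auto simp: set_ws)
  then have "p \<in> verts ?T" "q \<in> verts ?T" by (auto simp: leaves_def)
  then have "(p, q) \<in> (link (edges ?T))\<^sup>*"
    using t(1) by (auto simp: is_tree_def connected_graph_def link_def)
  then obtain xs where xs: "gpath (edges ?T) xs" "hd xs = p" "last xs = q" using gpath_exists by metis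
  then obtain ys where ys: "xs = p # ys @ [q]" using gpath_between assms by metis
  have int: "set ys \<subseteq> verts ?T - leaves ?T"
    using gpath_interior_not_leaf[of ?T p ys q] t(1) xs ys by (auto simp: is_tree_def)
  have "lam {p, q} = span_len (edges ?T) {p, q}" by (rule lam_eq) (use assms in auto)
  also have "\<dots> \<le> int (length xs) - 1"
    by (rule span_len_path[OF xs]) (rule finite_tree_edges[OF assms(1)])
  finally show ?thesis using xs ys int t(3) by (intro exI[of _ ys]) auto
qed

definition chord :: "'a \<times> 'a \<Rightarrow> 'a list" where
  "chord e = (SOME ys. gpath (edges (T (c (fst e)))) (fst e # ys @ [snd e]) \<and> set ys \<inter> set zs = {} \<and>
     set ys \<subseteq> verts (T (c (fst e))) \<and> lam {fst e, snd e} \<le> 1 + int (length ys))"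

lemma chord:
  assumes "p \<in> set ws" "q \<in> set ws" "c p = c q" "p \<noteq> q"
  shows "gpath (edges (T (c p))) (p # chord (p, q) @ [q])" "set (chord (p, q)) \<inter> set zs = {}"
    "set (chord (p, q)) \<subseteq> verts (T (c p))" "lam {p, q} \<le> 1 + int (length (chord (p, q)))"
  using someI_ex[OF chord_exists[OF assms]] unfolding chord_def fst_conv snd_conv by blast+

text \<open>The set \<open>K\<close> of steps realised by tree paths is a parameter because a tree
  path may also replace an arc between neighbours, as in the chord clause of
  \<open>ring_ok\<close>.\<close>

definition step_len :: "('a \<times> 'a) set \<Rightarrow> 'a \<times> 'a \<Rightarrow> int" where
  "step_len K e = (if e \<in> K then lam {fst e, snd e}
     else if arc ws (fst e) (snd e) then seg_len (fst e) else seg_len (snd e))"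

text \<open>Arcs are replaced by stretches of \<open>L\<close> and steps in \<open>K\<close> by tree
  paths. The result is a simple cycle: stretches of different arcs are disjoint, tree paths avoid
  \<open>L\<close> inside, and those of different colours lie in disjoint trees. Its length is then
  bounded by that of the longest cycle.\<close>

lemma realize_exchange:
  assumes vs: "distinct vs" "set vs = set ws" "length vs \<ge> 2"
    and K: "K \<subseteq> set (cpairs vs)" "inj_on (c \<circ> fst) K" "\<And>p q. (p, q) \<in> K \<Longrightarrow> c p = c q"
      "length vs \<ge> 3 \<or> K \<noteq> {}"
    and arcs: "\<And>p q. (p, q) \<in> set (cpairs vs) \<Longrightarrow> (p, q) \<notin> K \<Longrightarrow> adj ws p q"
  shows "sum_list (map (step_len K) (cpairs vs)) \<le> int (length zs)"
proof -
  define f where "f e = (if e \<in> K then chord e else if arc ws (fst e) (snd e) then gap (fst e)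
     else rev (gap (snd e)))" for e
  define cs where "cs = cwalk f vs"
  have vne: "vs \<noteq> []" using vs by auto
  have lvw: "length vs = length ws" using vs distinct_ws by (metis distinct_card)
  have mem: "fst e \<in> set ws \<and> snd e \<in> set ws" if "e \<in> set (cpairs vs)" for e
    using that cpairs_in_set[of "fst e" "snd e" vs] vs by simp
  have neq: "fst e \<noteq> snd e" if "e \<in> set (cpairs vs)" for e
  proof
    assume "fst e = snd e"
    then have "(fst e, fst e) \<in> set (cpairs vs)" using that by (metis prod.collapse)
    then show False using arc_irrefl[OF vs(1,3), of "fst e"] by (simp add: arc_def)
  qed
  have kc: "gpath (edges (T (c (fst e)))) (fst e # chord e @ [snd e])" "set (chord e) \<inter> set zs = {}"
    "set (chord e) \<subseteq> verts (T (c (fst e)))" "lam {fst e, snd e} \<le> 1 + int (length (chord e))"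
    if "e \<in> K" for e
  proof -
    have e: "e \<in> set (cpairs vs)" using that K by blast
    have "c (fst e) = c (snd e)" using K(3)[of "fst e" "snd e"] that by simp
    from chord[OF conjunct1[OF mem[OF e]] conjunct2[OF mem[OF e]] this neq[OF e]]
    show "gpath (edges (T (c (fst e)))) (fst e # chord e @ [snd e])" "set (chord e) \<inter> set zs = {}"
      "set (chord e) \<subseteq> verts (T (c (fst e)))" "lam {fst e, snd e} \<le> 1 + int (length (chord e))"
      by simp_all
  qed
  have rev_arc: "arc ws (snd e) (fst e)" if "e \<in> set (cpairs vs)" "e \<notin> K" "\<not> arc ws (fst e) (snd e)" for e
    using arcs[of "fst e" "snd e"] that by (simp add: adj_def)
  \<comment> \<open>The point where the arc used by \<open>e\<close> starts in the orientation of
    the ring; it identifies the stretch of \<open>L\<close> even if \<open>e\<close> runs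
    backwards.\<close>
  define key where "key e = (if arc ws (fst e) (snd e) then fst e else snd e)" for e
  have key_ws: "key e \<in> set ws" if "e \<in> set (cpairs vs)" for e using mem[OF that] by (simp add: key_def)
  have fgap: "set (f e) = set (gap (key e))" "length (f e) = length (gap (key e))" if "e \<notin> K" for e
    using that by (simp_all add: f_def key_def)
  have pairs_eq: "e = e'" if "e \<in> set (cpairs vs)" "e' \<in> set (cpairs vs)" "fst e = fst e' \<or> snd e = snd e'" for e e'
    using that arc_fun[OF vs(1), of "fst e" "snd e" "snd e'"] arc_inj[OF vs(1), of "fst e" "snd e" "fst e'"]
    by (auto simp: arc_def prod_eq_iff)
  have key_inj: "e = e'" if e: "e \<in> set (cpairs vs)" "e \<notin> K" "e' \<in> set (cpairs vs)" "e' \<notin> K" "key e = key e'" for e e'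
  proof -
    \<comment> \<open>Using one arc in both directions means stepping there and straight back, which
      leaves only two points. In such a ring every step already counts as forward.\<close>
    have mixed: False if h: "e \<in> set (cpairs vs)" "e \<notin> K" "e' \<in> set (cpairs vs)" "e' \<notin> K" "fst e = snd e'"
      "arc ws (fst e) (snd e)" "\<not> arc ws (fst e') (snd e')" for e e'
    proof -
      have "arc ws (snd e') (fst e')" using rev_arc[of e'] h by blast
      then have s: "snd e = fst e'" using arc_fun[OF distinct_ws h(6)] h(5) by simp
      have a: "arc vs (fst e) (snd e)" "arc vs (fst e') (snd e')" using h(1,3) by (simp_all add: arc_def)
      then have "arc vs (snd e) (fst e)" using s h(5) by simp
      then have "\<not> length vs \<ge> 3" using arc_antisym[OF vs(1)] a by blast
      then have "length ws = 2" using vs(3) lvw by linarith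
      then obtain x y where "ws = [x, y]" by (auto simp: length_Suc_conv numeral_2_eq_2)
      then have "arc ws = (\<lambda>a b. (a, b) = (x, y) \<or> (a, b) = (y, x))" by (auto simp: arc_def cpairs_def fun_eq_iff)
      then show False using h s by auto
    qed
    show ?thesis
    proof (cases "arc ws (fst e) (snd e) = arc ws (fst e') (snd e')")
      case True
      then show ?thesis using pairs_eq e by (auto simp: key_def split: if_splits)
    next
      case False
      then show ?thesis using mixed[of e e'] mixed[of e' e] e by (auto simp: key_def split: if_splits)
    qed
  qed
  have f_free: "set (f e) \<inter> set ws = {}" if "e \<in> set (cpairs vs)" for e
  proof (cases "e \<in> K")
    case True
    then show ?thesis using kc(2)[OF True] by (auto simp: f_def set_ws)
  next
    case False
    then show ?thesis using fgap gap(2)[OF key_ws[OF that]] by (auto simp: set_ws)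
  qed
  have f_disj: "set (f e) \<inter> set (f e') = {}" if e: "e \<in> set (cpairs vs)" "e' \<in> set (cpairs vs)" "e \<noteq> e'" for e e'
  proof -
    have KG: "set (f e) \<inter> set (f e') = {}" if "e \<in> K" "e' \<notin> K" "e' \<in> set (cpairs vs)" for e e'
      using kc(2)[OF that(1)] fgap[OF that(2)] gap_in_zs[OF key_ws[OF that(3)]] that by (auto simp: f_def)
    consider "e \<in> K" "e' \<in> K" | "e \<in> K" "e' \<notin> K" | "e \<notin> K" "e' \<in> K" | "e \<notin> K" "e' \<notin> K" by blast
    then show ?thesis
    proof cases
      case 1
      then have "c (fst e) \<noteq> c (fst e')" using K(2) e by (auto simp: inj_on_def)
      then have "verts (T (c (fst e))) \<inter> verts (T (c (fst e'))) = {}"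
        using disjoint_trees[of "fst e" "fst e'"] mem e by (auto simp: set_ws)
      then show ?thesis using kc(3)[OF 1(1)] kc(3)[OF 1(2)] 1 by (auto simp: f_def)
    next
      case 2 then show ?thesis using KG e by blast
    next
      case 3 then show ?thesis using KG[of e' e] e by blast
    next
      case 4
      then have "key e \<noteq> key e'" using key_inj e by blast
      then show ?thesis using gap_disjoint key_ws e 4 by (simp add: fgap)
    qed
  qed
  have seg_edges: "{x, y} \<in> edges G"
    if e: "e \<in> set (cpairs vs)" and xy: "(x, y) \<in> set (ipairs (fst e # f e @ [snd e]))" for e x y
  proof -
    consider "e \<in> K" | "e \<notin> K" "arc ws (fst e) (snd e)" | "e \<notin> K" "\<not> arc ws (fst e) (snd e)" by blast
    then show ?thesis
    proof cases
      case 1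
      then have "{x, y} \<in> edges (T (c (fst e)))" using kc(1)[OF 1] xy by (auto simp: f_def gpath_def)
      then show ?thesis using tree[of "fst e"] mem[OF e] by (auto simp: set_ws)
    next
      case 2
      then show ?thesis using gap_arcs[OF 2(2), of x y] xy arc_edge by (simp add: f_def)
    next
      case 3
      have "fst e # f e @ [snd e] = rev (snd e # gap (snd e) @ [fst e])" using 3 by (simp add: f_def)
      then have "(y, x) \<in> set (ipairs (snd e # gap (snd e) @ [fst e]))"
        using xy by (simp only: set_ipairs_rev)
      then have "arc zs y x" by (rule gap_arcs[OF rev_arc[OF e 3]])
      then show ?thesis using arc_edge[of y x] by (simp add: insert_commute)
    qed
  qed
  have edges_cs: "{x, y} \<in> edges G" if "(x, y) \<in> set (cpairs cs)" for x y
    using that seg_edges unfolding cs_def set_cpairs_cwalk[OF vne] by blast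
  have "distinct cs"
    unfolding cs_def cwalk_def
  proof (rule distinct_concat)
    have "distinct (map fst (cpairs vs))" using vs by simp
    then have "distinct (map hd (map (\<lambda>e. fst e # f e) (cpairs vs)))" by (simp add: o_def)
    then show "distinct (map (\<lambda>e. fst e # f e) (cpairs vs))" by (simp only: distinct_map)
  next
    fix ys assume "ys \<in> set (map (\<lambda>e. fst e # f e) (cpairs vs))"
    then obtain e where e: "e \<in> set (cpairs vs)" "ys = fst e # f e" by auto
    have "distinct (f e)"
    proof (cases "e \<in> K")
      case True
      then show ?thesis using kc(1)[OF True] by (simp add: f_def gpath_def)
    next
      case False
      then show ?thesis using gap_distinct[of "fst e"] gap_distinct[of "snd e"] mem[OF e(1)] by (simp add: f_def)
    qed
    then show "distinct ys" using e f_free[OF e(1)] mem[OF e(1)] by auto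
  next
    fix ys ys' assume a: "ys \<in> set (map (\<lambda>e. fst e # f e) (cpairs vs))"
      "ys' \<in> set (map (\<lambda>e. fst e # f e) (cpairs vs))" "ys \<noteq> ys'"
    then obtain e e' where e: "e \<in> set (cpairs vs)" "ys = fst e # f e"
      and e': "e' \<in> set (cpairs vs)" "ys' = fst e' # f e'" by auto
    then have ne: "e \<noteq> e'" using a by blast
    then have "fst e \<noteq> fst e'" using pairs_eq e e' by blast
    then show "set ys \<inter> set ys' = {}"
      using f_disj[OF e(1) e'(1) ne] f_free[OF e(1)] f_free[OF e'(1)] mem[OF e(1)] mem[OF e'(1)] e e'
      by auto
  qed
  \<comment> \<open>A shorter closed list would consist of two points whose chord and whose stretch
    of \<open>L\<close> are the same edge, but tree edges are not edges of \<open>L\<close>.\<close>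
  moreover have "length cs \<ge> 3"
  proof (rule ccontr)
    assume n: "\<not> ?thesis"
    have lc: "length cs = (\<Sum>e\<leftarrow>cpairs vs. Suc (length (f e)))" by (simp add: cs_def length_cwalk)
    have "length vs = (\<Sum>e\<leftarrow>cpairs vs. 1)" by (simp add: sum_list_triv)
    also have "\<dots> \<le> length cs" unfolding lc by (rule sum_list_mono) simp
    finally have l2: "length vs = 2" using n vs(3) by linarith
    then obtain p q where v: "vs = [p, q]" by (auto simp: length_Suc_conv numeral_2_eq_2)
    have cp: "cpairs vs = [(p, q), (q, p)]" by (simp add: v cpairs_def)
    have "length cs = 2 + length (f (p, q)) + length (f (q, p))" using lc cp by simp
    then have "length (f (p, q)) = 0" "length (f (q, p)) = 0" using n by linarith+
    then have emp: "f (p, q) = []" "f (q, p) = []" by simp_all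
    have "K \<noteq> {}" using K(4) l2 by simp
    then consider "(p, q) \<in> K" | "(q, p) \<in> K" using K(1) cp by auto
    moreover have main: False if pq: "(p, q) \<in> K" "vs = [p, q] \<or> vs = [q, p]" "f (p, q) = []" "f (q, p) = []" for p q
    proof -
      have cp: "set (cpairs vs) = {(p, q), (q, p)}" using pq(2) by (auto simp: cpairs_def)
      have "p \<noteq> q" using vs pq by auto
      have "c p = c q" using K(3) pq by blast
      then have nK: "(q, p) \<notin> K" using inj_onD[OF K(2) _ pq(1), of "(q, p)"] \<open>p \<noteq> q\<close> by auto
      have "{p, q} \<in> edges (T (c p))" using kc(1)[OF pq(1)] pq(1,3) by (simp add: f_def gpath_def)
      then have "\<not> adj zs p q" using off_cycle[of p] mem[of "(p, q)"] cp by (auto simp: set_ws)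
      moreover have "adj zs q p"
      proof (cases "arc ws q p")
        case True
        then have "gap q = []" using pq(4) nK by (simp add: f_def)
        then show ?thesis using gap_arcs[OF True, of q p] by (simp add: adj_def)
      next
        case False
        then have "arc ws p q" using rev_arc[of "(q, p)"] cp nK by simp
        moreover have "gap p = []" using pq(4) nK False by (simp add: f_def)
        ultimately show ?thesis using gap_arcs[of p q p q] by (simp add: adj_def)
      qed
      ultimately show False using adj_sym by metis
    qed
    ultimately show False using main[of p q] main[of q p] emp v by cases auto
  qed
  ultimately have "length cs \<le> length zs" using edges_cs by (rule longest)
  moreover have "sum_list (map (step_len K) (cpairs vs)) \<le> int (length cs)"
  proof -
    have "step_len K e \<le> 1 + int (length (f e))" if "e \<in> set (cpairs vs)" for e
      using kc(4)[of e] by (auto simp: step_len_def f_def seg_len_def)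
    then have "sum_list (map (step_len K) (cpairs vs)) \<le> (\<Sum>e\<leftarrow>cpairs vs. int (Suc (length (f e))))"
      by (intro sum_list_mono) simp
    also have "\<dots> = int (length cs)" by (simp only: cs_def length_cwalk int_sum_list_map o_def list.map_comp)
    finally show ?thesis .
  qed
  ultimately show ?thesis by linarith
qed

text \<open>For the chord clause the cyclic order stays as it is and \<open>K\<close> holds only the
  arc in question. For an exchange, \<open>K\<close> consists of the steps that are not
  arcs.\<close>

lemma ring_ok_ws: "ring_ok ws seg_len"
  unfolding ring_ok_def
proof (intro conjI allI impI)
  show "distinct ws" by (rule distinct_ws)
next
  fix p q assume a: "arc ws p q" "p \<noteq> q" "c p = c q"
  have len: "length ws \<ge> 2"
  proof -
    have "card {p, q} \<le> card (set ws)" using arc_in_set[OF a(1)] by (intro card_mono) auto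
    then show ?thesis using a(2) distinct_ws by (simp add: distinct_card)
  qed
  have in_cp: "(p, q) \<in> set (cpairs ws)" using a by (simp add: arc_def)
  have d: "distinct (cpairs ws)" by (rule distinct_cpairs[OF distinct_ws])
  have "sum_list (map (step_len {(p, q)}) (cpairs ws)) \<le> int (length zs)"
    by (rule realize_exchange) (use distinct_ws len in_cp a in \<open>auto simp: adj_def arc_def\<close>)
  moreover have "sum_list (map (step_len {(p, q)}) (cpairs ws)) = sum (step_len {(p, q)}) (set (cpairs ws))"
    using d by (rule sum_list_distinct_conv_sum_set)
  moreover have "sum (step_len {(p, q)}) (set (cpairs ws)) =
    step_len {(p, q)} (p, q) + sum (step_len {(p, q)}) (set (cpairs ws) - {(p, q)})"
    using in_cp by (simp add: sum.remove)
  moreover have "sum (step_len {(p, q)}) (set (cpairs ws) - {(p, q)}) =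
      sum (seg_len \<circ> fst) (set (cpairs ws) - {(p, q)})"
    by (rule sum.cong) (auto simp: step_len_def arc_def)
  moreover have "sum (seg_len \<circ> fst) (set (cpairs ws)) =
    seg_len p + sum (seg_len \<circ> fst) (set (cpairs ws) - {(p, q)})"
    using in_cp by (simp add: sum.remove)
  moreover have "sum (seg_len \<circ> fst) (set (cpairs ws)) = int (length zs)"
  proof -
    have "sum (seg_len \<circ> fst) (set (cpairs ws)) = sum_list (map (seg_len \<circ> fst) (cpairs ws))"
      by (simp only: sum_list_distinct_conv_sum_set[OF d])
    also have "\<dots> = sum_list (map seg_len (map fst (cpairs ws)))" by (simp only: list.map_comp)
    also have "\<dots> = sum_list (map seg_len ws)" by (simp only: map_fst_cpairs)
    also have "\<dots> = sum seg_len (set ws)"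
      using distinct_ws by (simp add: sum_list_distinct_conv_sum_set del: map_map)
    finally show ?thesis by (simp add: sum_seg_len)
  qed
  moreover have "step_len {(p, q)} (p, q) = lam {p, q}" by (simp add: step_len_def)
  ultimately show "lam {p, q} \<le> seg_len p" by linarith
next
  fix vs assume n3: "3 \<le> length ws" and ex: "exch ws vs"
  have vs: "distinct vs" "set vs = set ws" using ex by (auto simp: exch_def)
  have lv: "length vs = length ws" using vs distinct_ws by (metis distinct_card)
  define K where "K = {e \<in> set (cpairs vs). \<not> adj ws (fst e) (snd e)}"
  have "sum_list (map (step_len K) (cpairs vs)) \<le> int (length zs)"
  proof (rule realize_exchange)
    have "inj_on (c \<circ> fst) (set (filter (\<lambda>e. \<not> adj ws (fst e) (snd e)) (cpairs vs)))"
      using ex by (simp add: exch_def chord_cols_def distinct_map)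
    then show "inj_on (c \<circ> fst) K" by (simp add: K_def)
    show "c p = c q" if "(p, q) \<in> K" for p q
      using ex that by (auto simp: K_def exch_def steps_ok_def)
  qed (use vs lv n3 in \<open>auto simp: K_def\<close>)
  moreover have "map (step_len K) (cpairs vs) = map (wt ws seg_len) (cpairs vs)"
    by (rule map_cong) (auto simp: step_len_def wt_def K_def adj_def)
  ultimately show "total ws seg_len (cpairs vs) \<le> sum seg_len (set ws)"
    by (simp add: total_def sum_seg_len)
qed

theorem sum_trees_le:
  assumes "tree_word (map c ws)"
  shows "2 * (\<Sum>i\<in>c ` set ws. card (edges (T i))) \<le> length zs"
proof -
  have "lam {x \<in> set ws. c x = i} = int (card (edges (T i)))" if i: "i \<in> c ` set ws" for i
  proof -
    obtain x where x: "x \<in> set ws" "i = c x" using i by blast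
    then have t: "is_tree (T i)" "leaves (T i) = {y \<in> set zs. c y = i}" "i \<noteq> 0"
      using tree[of x] by (auto simp: set_ws)
    have e: "{x \<in> set ws. c x = i} = leaves (T i)" using t by (auto simp: set_ws)
    have "lam {x \<in> set ws. c x = i} = span_len (edges (T i)) {x \<in> set ws. c x = i}"
      by (rule lam_eq) (use x in auto)
    then show ?thesis unfolding e by (simp add: span_len_leaves[OF t(1)])
  qed
  then have "lam_sum (set ws) = int (\<Sum>i\<in>c ` set ws. card (edges (T i)))"
    by (simp add: lam_sum_def)
  then show ?thesis
    using ring_lower_bound[OF ring_ok_ws assms ws_ne] unfolding sum_seg_len by linarith
qed

end

theorem theorem3:
  fixes G L :: "'a ugraph" and B :: "nat \<Rightarrow> 'a ugraph" and k :: nat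
  assumes "two_connected G"
    and "longest_cycle G L"
    and "k \<ge> 1"
    and "\<And>i. i \<in> {1..k} \<Longrightarrow> is_bridge G L (B i)"
    and "\<And>i j. i \<in> {1..k} \<Longrightarrow> j \<in> {1..k} \<Longrightarrow> i \<noteq> j \<Longrightarrow> verts (B i) \<inter> verts (B j) = {}"
    and "is_tree (induced_subgraph (overlap_graph G L) (B ` {1..k}))"
  shows "(\<Sum>i = 1..k. bridge_length L (B i)) \<le> card (edges L) div 2"
proof -
  let ?I = "{1..k}"
  note br = assms(4) and dis = assms(5)
  have sG: "simple_graph G" using assms(1) by (simp add: two_connected_def)
  have Lc: "is_cycle L" "subgraph L G"
    and Lmax: "\<And>C. is_cycle C \<Longrightarrow> subgraph C G \<Longrightarrow> card (edges C) \<le> card (edges L)"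
    using assms(2) by (auto simp: longest_cycle_def)
  have sL: "simple_graph L" "verts L \<subseteq> verts G" "edges L \<subseteq> edges G" using Lc by (auto simp: subgraph_def)
  note bb = bridge_basic[OF sG sL(1,2) br]
  define A where "A i = attachments L (B i)" for i
  have A_B: "A i \<subseteq> verts (B i)" "A i \<subseteq> verts L" for i by (auto simp: A_def attachments_def)
  have "\<forall>i\<in>?I. \<exists>T. is_tree T \<and> subgraph T (B i) \<and> leaves T = A i \<and> bridge_length L (B i) = card (edges T)"
    using bridge_length_tree[OF assms(1) Lc br] by (simp add: A_def)
  then obtain T where T: "\<And>i. i \<in> ?I \<Longrightarrow> is_tree (T i) \<and> subgraph (T i) (B i) \<and> leaves (T i) = A i \<and>
      bridge_length L (B i) = card (edges (T i))" by metis
  have two_att: "\<exists>a\<in>A i. \<exists>b\<in>A i. a \<noteq> b" if "i \<in> ?I" for i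
    using bridge_tree_exists(2)[OF assms(1) Lc br[OF that]] by (simp add: A_def)
  have A_disj: "i = j" if "i \<in> ?I" "j \<in> ?I" "x \<in> A i" "x \<in> A j" for i j x
    using dis[OF that(1,2)] A_B(1)[of i] A_B(1)[of j] that(3,4) by blast
  \<comment> \<open>The colour of an attachment is the index of its bridge, unique because the
    bridges are disjoint. Indices start at 1, so 0 is free for the other vertices.\<close>
  define c where "c x = (if \<exists>i\<in>?I. x \<in> A i then SOME i. i \<in> ?I \<and> x \<in> A i else 0)" for x
  have c_eq: "c x = i \<longleftrightarrow> x \<in> A i" if "i \<in> ?I" for x i
  proof -
    have "c x = i" if x: "x \<in> A i"
    proof -
      have "c x = (SOME i. i \<in> ?I \<and> x \<in> A i)"
        unfolding c_def by (rule if_P) (use x \<open>i \<in> ?I\<close> in blast)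
      also have "\<dots> = i" by (rule some_equality) (use \<open>i \<in> ?I\<close> x A_disj in blast)+
      finally show ?thesis .
    qed
    moreover have "x \<in> A i" if "c x = i"
    proof -
      have ex: "\<exists>i. i \<in> ?I \<and> x \<in> A i" using that \<open>i \<in> ?I\<close> by (auto simp: c_def split: if_splits)
      then have "c x = (SOME i. i \<in> ?I \<and> x \<in> A i)" by (auto simp: c_def)
      then show ?thesis using someI_ex[OF ex] that by simp
    qed
    ultimately show ?thesis by blast
  qed
  have c_range: "c x \<in> ?I" if "c x \<noteq> 0" for x
  proof -
    have ex: "\<exists>i. i \<in> ?I \<and> x \<in> A i" using that by (auto simp: c_def split: if_splits)
    then have "c x = (SOME i. i \<in> ?I \<and> x \<in> A i)" by (auto simp: c_def)
    then show ?thesis using someI_ex[OF ex] by simp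
  qed
  obtain zs0 where zs0: "length zs0 \<ge> 3" "distinct zs0" "L = cycle_graph zs0"
    using Lc(1) by (auto simp: is_cycle_conv)
  have one: "1 \<in> ?I" using assms(3) by simp
  then obtain a where a: "a \<in> A 1" using two_att by blast
  then have "a \<in> set zs0" using A_B(2)[of 1] zs0 by (auto simp: cycle_graph_def)
  then obtain xs ys where xy: "zs0 = xs @ a # ys" by (metis split_list)
  \<comment> \<open>The cycle is written so that it starts at an attachment, as the decomposition
    into points and gaps requires.\<close>
  define zs where "zs = rotate (length xs) zs0"
  have "zs = (a # ys) @ xs" unfolding zs_def xy by (rule rotate_append)
  then have hd_zs: "hd zs = a" by simp
  have cyc: "length zs \<ge> 3" "distinct zs" "L = cycle_graph zs" using zs0 by (simp_all add: zs_def)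
  have vL: "verts L = set zs" using cyc by (simp add: cycle_graph_def)
  have eL: "{x, y} \<in> edges L \<longleftrightarrow> adj zs x y" for x y unfolding cyc(3) by (rule edge_cycle_graph_iff)
  have cardL: "card (edges L) = length zs" using card_edges_cycle_graph[OF cyc(2,1)] cyc(3) by simp
  have cls: "{x \<in> set zs. c x = i} = A i" if "i \<in> ?I" for i
    using c_eq[OF that] A_B(2)[of i] vL by auto
  interpret tree_system G zs T c
  proof
    show "distinct zs" "3 \<le> length zs" by (rule cyc)+
    have "c a = 1" using c_eq[OF one, of a] a by blast
    then show "c (hd zs) \<noteq> 0" using hd_zs by simp
    show "{x, y} \<in> edges G" if "arc zs x y" for x y
      using that eL[of x y] sL by (auto simp: adj_def)
  next
    fix cs assume cs: "distinct cs" "3 \<le> length cs" "\<And>x y. (x, y) \<in> set (cpairs cs) \<Longrightarrow> {x, y} \<in> edges G"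
    have "set cs \<subseteq> verts G"
    proof
      fix x assume "x \<in> set cs"
      then have "x \<in> fst ` set (cpairs cs)" by (metis map_fst_cpairs set_map)
      then obtain y where "{x, y} \<in> edges G" using cs(3) by force
      then show "x \<in> verts G" using sG by (auto simp: simple_graph_def)
    qed
    then show "length cs \<le> length zs"
      using cycle_graph_subgraph[OF cs] Lmax[of "cycle_graph cs"] card_edges_cycle_graph[OF cs(1,2)] cardL by simp
  next
    fix x assume "x \<in> set zs" "c x \<noteq> 0"
    then have i: "c x \<in> ?I" using c_range by blast
    have "verts (T (c x)) \<inter> set zs = leaves (T (c x))"
    proof
      show "verts (T (c x)) \<inter> set zs \<subseteq> leaves (T (c x))"
        using T[OF i] vL by (auto simp: subgraph_def A_def attachments_def)
      show "leaves (T (c x)) \<subseteq> verts (T (c x)) \<inter> set zs"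
        using T[OF i] vL A_B(2)[of "c x"] by (auto simp: leaves_def)
    qed
    then show "is_tree (T (c x)) \<and> edges (T (c x)) \<subseteq> edges G \<and>
        leaves (T (c x)) = {y \<in> set zs. c y = c x} \<and> verts (T (c x)) \<inter> set zs = leaves (T (c x))"
      using T[OF i] bb(1)[OF i] cls[OF i] by (auto simp: subgraph_def)
    show "\<not> adj zs u v" if "{u, v} \<in> edges (T (c x))" for u v
      using T[OF i] bb(1)[OF i] that eL[of u v] by (auto simp: subgraph_def)
  next
    fix x y assume "x \<in> set zs" "y \<in> set zs" "c x \<noteq> 0" "c y \<noteq> 0" "c x \<noteq> c y"
    then show "verts (T (c x)) \<inter> verts (T (c y)) = {}"
      using dis[OF c_range[of x] c_range[of y]] T[OF c_range[of x]] T[OF c_range[of y]]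
      by (auto simp: subgraph_def)
  qed
  define u where "u = map c ws"
  have cls_ws: "{x \<in> set ws. c x = i} = A i" if "i \<in> ?I" for i
  proof -
    have "{x \<in> set ws. c x = i} = {x \<in> set zs. c x = i}" using that by (auto simp: set_ws)
    then show ?thesis by (simp only: cls[OF that])
  qed
  have set_u: "set u = ?I"
  proof
    show "set u \<subseteq> ?I" using c_range by (auto simp: u_def set_ws)
    show "?I \<subseteq> set u"
    proof
      fix i assume i: "i \<in> ?I"
      then obtain x where "x \<in> A i" using two_att by blast
      then have "x \<in> {x \<in> set ws. c x = i}" using cls_ws[OF i] by simp
      then show "i \<in> set u" by (auto simp: u_def)
    qed
  qed
  have crossed_iff: "crossed u i j \<longleftrightarrow> i \<noteq> j \<and> overlap L (B i) (B j)" if ij: "i \<in> ?I" "j \<in> ?I" for i j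
  proof (cases "i = j")
    case False
    have "uncrossed u i j \<longleftrightarrow> splits zs (A i) (A j)"
      using splits_iff_uncrossed[of "\<lambda>i. i \<noteq> 0" i j c zs] ij cls[OF ij(1)] cls[OF ij(2)]
      by (simp add: u_def ws_def)
    also have "\<dots> \<longleftrightarrow> \<not> overlap L (B i) (B j)"
      unfolding overlap_def not_not A_def[symmetric]
    proof (rule splits_iff_path_cover[of zs "A i" "A j", folded cyc(3)])
      show "A i \<subseteq> set zs" "A j \<subseteq> set zs" using A_B(2) vL by auto
      show "A i \<noteq> {}" "A j \<noteq> {}" using two_att ij by blast+
      show "A i \<inter> A j = {}" using A_disj ij False by blast
    qed (rule cyc)+
    finally show ?thesis using False ij set_u by (simp add: crossed_def)
  qed (simp add: crossed_def)
  \<comment> \<open>Disjoint nonempty bridges are different, so the indices can stand for the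
    vertices of the overlap graph.\<close>
  have inj: "inj_on B ?I"
  proof (rule inj_onI, rule ccontr)
    fix i j assume ij: "i \<in> ?I" "j \<in> ?I" "B i = B j" "i \<noteq> j"
    then show False using dis[OF ij(1,2)] bb(5)[OF ij(1)] by simp
  qed
  define O' where "O' = induced_subgraph (overlap_graph G L) (B ` ?I)"
  have O': "is_tree O'" using assms(6) by (simp add: O'_def)
  have vO: "verts O' = B ` ?I"
    using br by (auto simp: O'_def induced_subgraph_def overlap_graph_def)
  have eO: "{B i, B j} \<in> edges O' \<longleftrightarrow> crossed u i j" if ij: "i \<in> ?I" "j \<in> ?I" for i j
  proof
    assume "{B i, B j} \<in> edges O'"
    then obtain B1 B2 where b: "{B i, B j} = {B1, B2}" "B1 \<noteq> B2" "overlap L B1 B2"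
      by (auto simp: O'_def induced_subgraph_def overlap_graph_def)
    then have "i \<noteq> j" by auto
    from b consider "B i = B1" "B j = B2" | "B i = B2" "B j = B1" by (auto simp: doubleton_eq_iff)
    then show "crossed u i j"
      using b(3) \<open>i \<noteq> j\<close> crossed_iff[OF ij] crossed_iff[OF ij(2,1)] crossed_sym[of u j i] by cases auto
  next
    assume "crossed u i j"
    then have "i \<noteq> j" "overlap L (B i) (B j)" using crossed_iff[OF ij] by auto
    moreover have "B i \<noteq> B j" using inj ij \<open>i \<noteq> j\<close> by (auto dest: inj_onD)
    ultimately show "{B i, B j} \<in> edges O'"
      using br ij by (auto simp: O'_def induced_subgraph_def overlap_graph_def)
  qed
  have "tree_word u"
    unfolding tree_word_def
  proof (intro conjI allI impI ballI)
    fix S assume S: "S \<subset> set u" "S \<noteq> {}"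
    show "\<exists>C\<in>S. \<exists>D\<in>set u - S. crossed u C D"
    proof (rule ccontr)
      assume n: "\<not> ?thesis"
      obtain i j where i: "i \<in> S" "i \<in> ?I" and j: "j \<in> ?I" "j \<notin> S" using S set_u by blast
      have path: "(B i, B j) \<in> {(x, y). {x, y} \<in> edges O'}\<^sup>*"
        using O' i j vO by (auto simp: is_tree_def connected_graph_def)
      \<comment> \<open>If no crossing leaves \<open>S\<close>, no walk in the overlap tree leaves
        the bridges with index in \<open>S\<close>, against its connectedness.\<close>
      have reach: "y \<in> B ` S" if "(B i, y) \<in> {(x, y). {x, y} \<in> edges O'}\<^sup>*" for y
        using that
      proof (induction rule: rtrancl_induct)
        case base
        then show ?case using i by blast
      next
        case (step y z)
        then obtain s where s: "s \<in> S" "y = B s" by blast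
        have e: "{y, z} \<in> edges O'" using step by simp
        then have "z \<in> verts O'" using O' by (auto simp: is_tree_def simple_graph_def)
        then obtain t where t: "t \<in> ?I" "z = B t" using vO by blast
        have "s \<in> ?I" using s S set_u by blast
        then have "crossed u s t" using eO[of s t] e s t by simp
        then show ?case using n s t set_u by blast
      qed
      obtain s where "s \<in> S" "B s = B j" using reach[OF path] by force
      then show False using inj_onD[OF inj, of s j] j S set_u by auto
    qed
  next
    show "acyclic_rel (crossed u)"
      unfolding acyclic_rel_def
    proof
      assume "\<exists>cs. 3 \<le> length cs \<and> distinct cs \<and> (\<forall>(x, y)\<in>set (cpairs cs). crossed u x y)"
      then obtain cs where cs: "3 \<le> length cs" "distinct cs" "\<And>x y. (x, y) \<in> set (cpairs cs) \<Longrightarrow> crossed u x y"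
        by auto
      have csI: "set cs \<subseteq> ?I"
      proof
        fix x assume "x \<in> set cs"
        then have "x \<in> fst ` set (cpairs cs)" by (metis map_fst_cpairs set_map)
        then show "x \<in> ?I" using cs(3) set_u by (force simp: crossed_def)
      qed
      have cp: "cpairs (map B cs) = map (\<lambda>(x, y). (B x, B y)) (cpairs cs)"
        by (simp add: cpairs_def rotate1_map zip_map_map)
      have "{x, y} \<in> edges O'" if h: "(x, y) \<in> set (cpairs (map B cs))" for x y
      proof -
        obtain i j where ij: "(i, j) \<in> set (cpairs cs)" "x = B i" "y = B j" using h cp by auto
        have "i \<in> ?I" "j \<in> ?I" using cpairs_in_set[OF ij(1)] csI by blast+
        then show ?thesis using eO[of i j] cs(3)[OF ij(1)] ij(2,3) by simp
      qed
      moreover have "distinct (map B cs)" using cs(2) inj csI by (simp add: distinct_map inj_on_subset)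
      ultimately show False
        using tree_acyclic_rel[OF O'] cs(1) unfolding acyclic_rel_def by (metis (no_types, lifting) case_prodI2 length_map)
    qed
  next
    fix i assume "i \<in> set u"
    then have i: "i \<in> ?I" using set_u by blast
    have "count_list u i = card (A i)"
      using class_card[OF distinct_ws, of i] cls_ws[OF i] by (simp add: u_def)
    moreover obtain x y where xy: "x \<in> A i" "y \<in> A i" "x \<noteq> y" using two_att[OF i] by blast
    moreover have "finite (A i)" using A_B(2)[of i] vL finite_subset by fastforce
    then have "card {x, y} \<le> card (A i)" using xy by (intro card_mono) auto
    ultimately show "2 \<le> count_list u i" by simp
  qed
  then have "2 * (\<Sum>i\<in>c ` set ws. card (edges (T i))) \<le> length zs"
    unfolding u_def by (rule sum_trees_le)
  moreover have "c ` set ws = ?I" using set_u by (simp add: u_def)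
  moreover have "(\<Sum>i = 1..k. bridge_length L (B i)) = (\<Sum>i\<in>?I. card (edges (T i)))"
    by (rule sum.cong) (use T in auto)
  ultimately show ?thesis using cardL by simp
qed

end
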